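(* Let $1\le r\le\infty$, $1\le p<\infty$, let $\mathcal G=(V,E)$ be a connected simple graph whose counting measure satisfies the doubling property, and let $w$ be a Muckenhoupt $A_p$-weight on $V$. If $A$ belongs to $\mathcal B_{r,\alpha}(\mathcal G)$ for some $\alpha>\tilde d_{\mathcal G}-d_{\mathcal G}/r$ and $A$ is invertible in $\mathcal B(\ell^p_w)$, then $A^{-1}\in\mathcal B_{r,\alpha}(\mathcal G)$. Moreover, there exists an absolute constant $C$ (independent of $A$ and $w$) such that $$\|A^{-1}\|_{\mathcal B_{r,\alpha}}\le C(A_p(w))^{1/p}\|A^{-1}\|_{\mathcal B(\ell^p_w)}\Big((A_p(w))^{2/p}\|A^{-1}\|_{\mathcal B(\ell^p_w)}\|A\|_{\mathcal B_{r,\alpha}}\Big)^{\frac{\alpha+d_{\mathcal G}(1+1/r)}{\min(\alpha-d_{\mathcal G}/r',1)}}\times\begin{cases}1&\text{if }\alpha\ne1+d_{\mathcal G}/r',\\[4pt]\Big(\ln\big((A_p(w))^{2/p}\|A^{-1}\|_{\mathcal B(\ell^p_w)}\|A\|_{\mathcal B_{r,\alpha}}+1\big)\Big)^{(2d_{\mathcal G}+1)/r'}&\text{if }\alpha=1+d_{\mathcal G}/r',\end{cases}$$ where $1/r'=1-1/r$.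
   Context: Graph. $\rho$ is the geodesic distance on the connected simple graph $\mathcal G=(V,E)$ (number of edges in a shortest path), $B(\lambda,r)=\{\lambda'\in V:\rho(\lambda,\lambda')\le r\}$, and $\mu$ is the counting measure on $V$. Doubling property: there is $D>0$ with $\mu(B(\lambda,2r))\le D\mu(B(\lambda,r))$ for all $\lambda\in V$, $r>0$. Beurling dimension. $d_{\mathcal G}$ and $D_{\mathcal G}$ are the minimal constants $d_1,D_1$ such that $\mu(B(\lambda,r))\le D_1(r+1)^{d_1}$ for all $\lambda\in V$, $r\ge0$. Generalized Beurling dimension. For $N\ge0$, a set $V_N\subset V$ is maximal $N$-disjoint if $B(\lambda,N)\cap\bigcup_{\lambda_m\in V_N}B(\lambda_m,N)\ne\emptyset$ for all $\lambda\in V$ and $B(\lambda_m,N)\cap B(\lambda_n,N)=\emptyset$ for all distinct $\lambda_m,\lambda_n\in V_N$. $\tilde d_{\mathcal G}$ and $\tilde D_{\mathcal G}$ are the minimal constants $d,D$ such that $\sup_{\lambda\in V}\mu(\{\lambda_m\in V_N:\rho(\lambda_m,\lambda)\le(N+1)R\})\le D(R+1)^d$ for all $R,N\ge0$ and all maximal $N$-disjoint sets $V_N$. Beurling algebra. For a matrix $A=(a(\lambda,\lambda'))_{\lambda,\lambda'\in V}$ put $h_A(n)=\sup_{\rho(\lambda,\lambda')\ge n}|a(\lambda,\lambda')|$. For $1\le r\le\infty$, $\alpha\ge0$, $\mathcal B_{r,\alpha}(\mathcal G)$ is the set of matrices with $\|A\|_{\mathcal B_{r,\alpha}}<\infty$,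 where $\|A\|_{\mathcal B_{r,\alpha}}=\big(\sum_{n=0}^\infty h_A(n)^r(n+1)^{\alpha r+d_{\mathcal G}-1}\big)^{1/r}$ if $r<\infty$ and $\|A\|_{\mathcal B_{\infty,\alpha}}=\sup_{n\ge0}h_A(n)(n+1)^\alpha$. Weights. For $1<p<\infty$, a positive function $w=(w(\lambda))_{\lambda\in V}$ is a Muckenhoupt $A_p$-weight if there is $C>0$ with $\big(\frac1{\mu(B)}\sum_{\lambda\in B}w(\lambda)\big)\big(\frac1{\mu(B)}\sum_{\lambda\in B}w(\lambda)^{-1/(p-1)}\big)^{p-1}\le C$ for all balls $B\subset V$; it is an $A_1$-weight if $\frac1{\mu(B)}\sum_{\lambda\in B}w(\lambda)\le C\inf_{\lambda\in B}w(\lambda)$ for all balls $B$. The smallest such $C$ is the $A_p$-bound $A_p(w)$. Operators. $\ell^p_w$ is the space of sequences $c=(c(\lambda))_{\lambda\in V}$ with $\|c\|_{p,w}=(\sum_{\lambda\in V}|c(\lambda)|^pw(\lambda))^{1/p}<\infty$. $\mathcal B(\ell^p_w)$ is the Banach algebra of all matrices (indexed by $V\times V$) that are bounded operators on $\ell^p_w$, with the operator norm $\|\cdot\|_{\mathcal B(\ell^p_w)}$. *)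

theory Defs
  imports "HOL-Analysis.Analysis"
begin

section \<open>Graphs with the geodesic distance\<close>

text \<open>
  The vertex set is the whole type, and an undirected edge is encoded by its two
  orientations, so that a simple graph is a symmetric irreflexive relation. It may be infinite.
\<close>

definition connected_simple_graph :: "'v rel \<Rightarrow> bool" where
  "connected_simple_graph E \<longleftrightarrow> sym E \<and> irrefl E \<and> (\<forall>x y. (x, y) \<in> E\<^sup>*)"

definition gdist :: "'v rel \<Rightarrow> 'v \<Rightarrow> 'v \<Rightarrow> nat" where
  "gdist E x y = (LEAST n. (x, y) \<in> E ^^ n)"

definition gball :: "'v rel \<Rightarrow> 'v \<Rightarrow> real \<Rightarrow> 'v set" where
  "gball E x r = {y. real (gdist E x y) \<le> r}"

text \<open>The counting measure, with value \<open>\<infinity>\<close> on infinite sets.\<close>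

abbreviation counting :: "'v set \<Rightarrow> ennreal" where
  "counting S \<equiv> emeasure (count_space UNIV) S"

definition doubling :: "'v rel \<Rightarrow> bool" where
  "doubling E \<longleftrightarrow>
     (\<exists>D::real. D > 0 \<and>
        (\<forall>x. \<forall>r>0. counting (gball E x (2 * r)) \<le> ennreal D * counting (gball E x r)))"


section \<open>Beurling dimensions\<close>

text \<open>
  The dimensions are minimal exponents: \<open>is_beurling_dim E d\<close> states that \<open>d\<close> is the least
  admissible exponent, so in particular that the minimum is attained (an infimum need not be).
  Since a ball contains its centre, admissible exponents are automatically nonnegative.
\<close>

definition beurling_exponent :: "'v rel \<Rightarrow> real \<Rightarrow> bool" where
  "beurling_exponent E d \<longleftrightarrow>
     (\<exists>D::real. \<forall>x. \<forall>r\<ge>0. counting (gball E x r) \<le> ennreal (D * (r + 1) powr d))"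

definition is_beurling_dim :: "'v rel \<Rightarrow> real \<Rightarrow> bool" where
  "is_beurling_dim E d \<longleftrightarrow>
     beurling_exponent E d \<and> (\<forall>d'. beurling_exponent E d' \<longrightarrow> d \<le> d')"

definition maximal_disjoint :: "'v rel \<Rightarrow> real \<Rightarrow> 'v set \<Rightarrow> bool" where
  "maximal_disjoint E N S \<longleftrightarrow>
     (\<forall>x. gball E x N \<inter> (\<Union>m\<in>S. gball E m N) \<noteq> {}) \<and>
     (\<forall>m\<in>S. \<forall>n\<in>S. m \<noteq> n \<longrightarrow> gball E m N \<inter> gball E n N = {})"

definition gen_beurling_exponent :: "'v rel \<Rightarrow> real \<Rightarrow> bool" where
  "gen_beurling_exponent E d \<longleftrightarrow>
     (\<exists>D::real. \<forall>R\<ge>0. \<forall>N\<ge>0. \<forall>S. maximal_disjoint E N S \<longrightarrow>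
        (SUP x. counting {m \<in> S. real (gdist E m x) \<le> (N + 1) * R})
          \<le> ennreal (D * (R + 1) powr d))"

definition is_gen_beurling_dim :: "'v rel \<Rightarrow> real \<Rightarrow> bool" where
  "is_gen_beurling_dim E d \<longleftrightarrow>
     gen_beurling_exponent E d \<and> (\<forall>d'. gen_beurling_exponent E d' \<longrightarrow> d \<le> d')"


section \<open>Beurling algebras of matrices\<close>

type_synonym 'v matrix = "'v \<Rightarrow> 'v \<Rightarrow> complex"

text \<open>
  The exponent \<open>r \<in> [1, \<infinity>]\<close> is an extended real, and \<open>recip r\<close> is \<open>1 / r\<close>
  with \<open>1 / \<infinity> = 0\<close>.
\<close>

definition recip :: "ennreal \<Rightarrow> real" where
  "recip r = enn2real (1 / r)"

text \<open>Powers of extended nonnegative reals; used only for exponents \<open>s > 0\<close>.\<close>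

definition epowr :: "ennreal \<Rightarrow> real \<Rightarrow> ennreal" where
  "epowr x s = (if x = \<infinity> then \<infinity> else ennreal (enn2real x powr s))"

text \<open>In \<open>ennreal\<close> the supremum of the empty set is \<open>0\<close> (finite graphs, \<open>n\<close> beyond the diameter).\<close>

definition decay :: "'v rel \<Rightarrow> 'v matrix \<Rightarrow> nat \<Rightarrow> ennreal" where
  "decay E A n = (SUP (x, y) \<in> {(x, y). gdist E x y \<ge> n}. ennreal (norm (A x y)))"

text \<open>The argument \<open>d\<close> is the Beurling dimension of the graph.\<close>

definition beurling_norm ::
    "'v rel \<Rightarrow> real \<Rightarrow> ennreal \<Rightarrow> real \<Rightarrow> 'v matrix \<Rightarrow> ennreal" where
  "beurling_norm E d r \<alpha> A =
     (if r = \<infinity> then (SUP n. decay E A n * ennreal (real (n + 1) powr \<alpha>))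
      else epowr (\<Sum>n. epowr (decay E A n) (enn2real r) *
                     ennreal (real (n + 1) powr (\<alpha> * enn2real r + d - 1)))
             (1 / enn2real r))"

definition beurling_algebra ::
    "'v rel \<Rightarrow> real \<Rightarrow> ennreal \<Rightarrow> real \<Rightarrow> 'v matrix set" where
  "beurling_algebra E d r \<alpha> = {A. beurling_norm E d r \<alpha> A < \<infinity>}"


section \<open>Muckenhoupt weights\<close>

text \<open>
  Averages over finite balls. Under the doubling property all balls are finite: the case
  \<open>r = 1/2\<close> bounds the vertex degrees.
\<close>

definition average :: "('v \<Rightarrow> real) \<Rightarrow> 'v set \<Rightarrow> real" where
  "average f B = (\<Sum>x\<in>B. f x) / real (card B)"

definition muckenhoupt_bound :: "'v rel \<Rightarrow> real \<Rightarrow> ('v \<Rightarrow> real) \<Rightarrow> real \<Rightarrow> bool" where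
  "muckenhoupt_bound E p w C \<longleftrightarrow> C > 0 \<and>
     (\<forall>x. \<forall>\<rho>\<ge>0. let B = gball E x \<rho> in
        if p = 1 then average w B \<le> C * (INF y\<in>B. w y)
        else average w B * average (\<lambda>y. w y powr (- 1 / (p - 1))) B powr (p - 1) \<le> C)"

definition muckenhoupt_weight :: "'v rel \<Rightarrow> real \<Rightarrow> ('v \<Rightarrow> real) \<Rightarrow> bool" where
  "muckenhoupt_weight E p w \<longleftrightarrow> (\<forall>x. w x > 0) \<and> (\<exists>C. muckenhoupt_bound E p w C)"

definition Ap_const :: "'v rel \<Rightarrow> real \<Rightarrow> ('v \<Rightarrow> real) \<Rightarrow> real" where
  "Ap_const E p w = Inf {C. muckenhoupt_bound E p w C}"


section \<open>Matrices acting on weighted sequence spaces\<close>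

definition wlp :: "real \<Rightarrow> ('v \<Rightarrow> real) \<Rightarrow> ('v \<Rightarrow> complex) set" where
  "wlp p w = {c. (\<lambda>x. norm (c x) powr p * w x) summable_on UNIV}"

definition wlp_norm :: "real \<Rightarrow> ('v \<Rightarrow> real) \<Rightarrow> ('v \<Rightarrow> complex) \<Rightarrow> real" where
  "wlp_norm p w c = (\<Sum>\<^sub>\<infinity>x. norm (c x) powr p * w x) powr (1 / p)"

definition mat_apply :: "'v matrix \<Rightarrow> ('v \<Rightarrow> complex) \<Rightarrow> 'v \<Rightarrow> complex" where
  "mat_apply A c = (\<lambda>x. \<Sum>\<^sub>\<infinity>y. A x y * c y)"

definition mat_mult :: "'v matrix \<Rightarrow> 'v matrix \<Rightarrow> 'v matrix" where
  "mat_mult A B = (\<lambda>x y. \<Sum>\<^sub>\<infinity>z. A x z * B z y)"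

definition mat_id :: "'v matrix" where
  "mat_id = (\<lambda>x y. if x = y then 1 else 0)"

text \<open>
  Convergence of the row sums is required explicitly because \<open>infsum\<close> returns \<open>0\<close> on
  non-summable families. For members of \<open>bounded_matrices p w\<close> the sums defining \<open>mat_mult\<close>
  converge as well, since the columns of such a matrix lie in \<open>wlp p w\<close>.
\<close>

definition bounded_matrices :: "real \<Rightarrow> ('v \<Rightarrow> real) \<Rightarrow> 'v matrix set" where
  "bounded_matrices p w = {A.
     (\<forall>c\<in>wlp p w. (\<forall>x. (\<lambda>y. A x y * c y) summable_on UNIV) \<and> mat_apply A c \<in> wlp p w) \<and>
     (\<exists>K. \<forall>c\<in>wlp p w. wlp_norm p w (mat_apply A c) \<le> K * wlp_norm p w c)}"

definition op_norm :: "real \<Rightarrow> ('v \<Rightarrow> real) \<Rightarrow> 'v matrix \<Rightarrow> real" where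
  "op_norm p w A = (SUP c\<in>{c \<in> wlp p w. wlp_norm p w c \<le> 1}. wlp_norm p w (mat_apply A c))"

definition is_inverse_in :: "real \<Rightarrow> ('v \<Rightarrow> real) \<Rightarrow> 'v matrix \<Rightarrow> 'v matrix \<Rightarrow> bool" where
  "is_inverse_in p w A B \<longleftrightarrow>
     A \<in> bounded_matrices p w \<and> B \<in> bounded_matrices p w \<and>
     mat_mult A B = mat_id \<and> mat_mult B A = mat_id"

end

theory Submission
  imports Defs "HOL-Library.Discrete_Functions"
begin

text \<open>
  Fix a scale \<open>N = 2 ^ k\<close> and put \<open>\<gamma> = \<alpha> + d / r\<close>, \<open>\<delta> = \<gamma> - d\<close>. A column \<open>c\<close> of the inverse
  solves \<open>A c = \<one>\<^sub>y\<close>. Multiply it by a Lipschitz cutoff \<open>\<psi>\<close> that is \<open>1\<close> on the ball of radius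
  \<open>2 N\<close> around \<open>m\<close> and \<open>0\<close> outside the ball of radius \<open>4 N\<close>. Then \<open>\<parallel>\<psi> c\<parallel> \<le> \<parallel>A\<^sup>-\<^sup>1\<parallel> \<parallel>A (\<psi> c)\<parallel>\<close>
  and \<open>A (\<psi> c) = \<psi> A c + [A, \<psi>] c\<close>. The first term vanishes unless \<open>m\<close> is near \<open>y\<close>. The
  commutator has the entries \<open>A(x, z) (\<psi>(z) - \<psi>(x))\<close>, which are small: for \<open>x\<close> close to \<open>z\<close>
  because \<open>\<psi>\<close> varies slowly, for \<open>x\<close> far from \<open>z\<close> because \<open>A\<close> decays. So the size \<open>b m\<close> of \<open>c\<close>
  near \<open>m\<close>, suitably normalized by the weight, satisfies
  \<open>b m \<le> F [m near y] + \<epsilon> (\<Sum>m'. \<kappa>(m, m') b m')\<close>, the sum running over a maximal \<open>N\<close>-disjoint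
  set (lemma \<open>local_estimate\<close>).

  The kernel \<open>\<kappa>\<close> is the dyadic profile of \<open>A\<close>, rescaled by \<open>N\<close> and made slowly varying by
  passing to an envelope. Because \<open>\<gamma>\<close> exceeds the generalized dimension, \<open>\<kappa>\<close> is summable over
  the net and \<open>\<kappa> * \<kappa> \<le> C \<kappa>\<close>. Convolving the inequality with \<open>\<kappa>\<close> gives
  \<open>\<kappa> * b \<le> C F \<kappa>(\<cdot>, y) + \<epsilon> C (\<kappa> * b)\<close>, and once \<open>\<epsilon>\<close> is small the last term is absorbed: the
  column decays like \<open>\<kappa>\<close> (\<open>kernel_inequality_self_improves\<close>, \<open>column_decay\<close>). The absorption
  requires \<open>\<kappa> * b\<close> to be finite, which is a crude consequence of \<open>c\<close> lying in the weighted
  space (\<open>kernel_b_summable\<close>).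

  The powers come out as follows. Passing from local averages to entries costs \<open>N powr d\<close>, and
  the envelope at scale \<open>N\<close> has Beurling norm of order \<open>N powr \<gamma>\<close>, so that the norm of the
  inverse is at most of order \<open>a powr (1 / p) \<parallel>A\<^sup>-\<^sup>1\<parallel> N powr (d + \<gamma>)\<close>. The number \<open>\<epsilon>\<close> is of
  the order of \<open>K\<close> times the dyadic sum of \<open>S j 2 powr (- \<delta> j) min 1 (2 powr (j - k))\<close> with
  \<open>S\<close> bounded in \<open>\<ell>\<^sup>r\<close>, which is of order \<open>2 powr (- k min \<delta> 1)\<close>; only at \<open>\<delta> = 1\<close> do all
  levels below \<open>k\<close> contribute equally, and Hoelder's inequality gives the extra factor
  \<open>(k + 1) powr (1 - 1 / r)\<close> (\<open>commutator_sum_le\<close>). The smallest admissible \<open>N\<close> is therefore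
  of order \<open>K powr (1 / min \<delta> 1)\<close>, with a logarithm at \<open>\<delta> = 1\<close> (\<open>choose_scale\<close>); this uses
  that \<open>K\<close> is bounded below (\<open>norm_product_lower_bound\<close>).

  The weight enters only through an averaging inequality on balls (\<open>averaging_weight\<close>), one
  application of which costs a factor \<open>a powr (1 / p)\<close>.
\<close>

section \<open>Elementary sums and powers\<close>

lemma le_of_powr_le_powr:
  fixes x y p :: real
  assumes "x powr p \<le> y powr p" "0 < p" "0 \<le> y"
  shows "x \<le> y"
  using assms powr_less_mono2[of p y x] by linarith

lemma sum_lessThan_add:
  fixes f :: "nat \<Rightarrow> real"
  shows "(\<Sum>j<k + J. f j) = (\<Sum>j<k. f j) + (\<Sum>i<J. f (k + i))"
  by (induction J) auto

lemma sum_power_less: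
  fixes q :: real
  assumes "1 < q"
  shows "(\<Sum>j<k. q ^ j) \<le> q ^ k / (q - 1)"
  using assms by (subst sum_gp_strict) (auto simp: field_simps)

lemma sum_power_less_1:
  fixes q :: real
  assumes "0 < q" "q < 1"
  shows "(\<Sum>j<k. q ^ j) \<le> 1 / (1 - q)"
  using assms by (subst sum_gp_strict) (auto intro!: divide_right_mono)

lemma sum_Union_le:
  fixes g :: "'a \<Rightarrow> real"
  assumes "finite L" "\<And>i. i \<in> L \<Longrightarrow> finite (G i)" "\<And>z. 0 \<le> g z"
  shows "sum g (\<Union>i\<in>L. G i) \<le> (\<Sum>i\<in>L. sum g (G i))"
  using assms(1,2)
proof (induction rule: finite_induct)
  case (insert i L)
  have "sum g (G i \<union> (\<Union>i\<in>L. G i)) \<le> sum g (G i) + sum g (\<Union>i\<in>L. G i)"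
    using sum.union_inter[of "G i" "\<Union>i\<in>L. G i" g] sum_nonneg[of "G i \<inter> (\<Union>i\<in>L. G i)" g] insert assms(3) by simp
  then show ?case using insert by simp
qed simp

lemma has_sum_finite_sum:
  fixes f :: "'i \<Rightarrow> 'z \<Rightarrow> 'b::topological_comm_monoid_add"
  assumes "finite M" and "\<And>i. i \<in> M \<Longrightarrow> (f i has_sum s i) S"
  shows "((\<lambda>z. \<Sum>i\<in>M. f i z) has_sum (\<Sum>i\<in>M. s i)) S"
  using assms by (induction rule: finite_induct) (auto intro!: has_sum_add)

lemma summable_on_finite_sum:
  fixes f :: "'i \<Rightarrow> 'z \<Rightarrow> real"
  assumes "finite M" and "\<And>i. i \<in> M \<Longrightarrow> f i summable_on S"
  shows "(\<lambda>z. \<Sum>i\<in>M. f i z) summable_on S"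
  using has_sum_finite_sum[OF assms(1) has_sum_infsum[OF assms(2)]] by (rule has_sum_imp_summable)

lemma infsum_finite_sum:
  fixes f :: "'i \<Rightarrow> 'z \<Rightarrow> real"
  assumes "finite M" and "\<And>i. i \<in> M \<Longrightarrow> f i summable_on S"
  shows "(\<Sum>\<^sub>\<infinity>z\<in>S. \<Sum>i\<in>M. f i z) = (\<Sum>i\<in>M. \<Sum>\<^sub>\<infinity>z\<in>S. f i z)"
  using has_sum_finite_sum[OF assms(1) has_sum_infsum[OF assms(2)]] by (rule infsumI)

text \<open>
  The convexity of \<open>x powr p\<close> in homogeneous form. It serves as Hoelder's inequality (with \<open>t\<close>
  a dual weight) and as Minkowski's inequality up to constants (with \<open>t\<close> a summable sequence
  of norms).
\<close>
lemma sum_powr_Jensen: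
  fixes t u :: "'i \<Rightarrow> real"
  assumes "finite I" and p: "1 \<le> p"
    and t: "\<And>i. i \<in> I \<Longrightarrow> 0 \<le> t i" and u: "\<And>i. i \<in> I \<Longrightarrow> 0 \<le> u i"
  shows "(\<Sum>i\<in>I. t i * u i) powr p \<le> (\<Sum>i\<in>I. t i) powr (p - 1) * (\<Sum>i\<in>I. t i * u i powr p)"
proof -
  \<comment> \<open>Convexity is used on the open half line only, so indices with a zero are discarded first.\<close>
  define J where "J = {i \<in> I. 0 < t i \<and> 0 < u i}"
  have fJ: "finite J" and JI: "J \<subseteq> I" using assms(1) by (auto simp: J_def)
  have e1: "(\<Sum>i\<in>I. t i * u i) = (\<Sum>i\<in>J. t i * u i)"
    by (rule sum.mono_neutral_right) (use assms t u in \<open>force simp: J_def\<close>)+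
  have e2: "(\<Sum>i\<in>I. t i * u i powr p) = (\<Sum>i\<in>J. t i * u i powr p)"
    by (rule sum.mono_neutral_right) (use assms t u in \<open>force simp: J_def\<close>)+
  define T where "T = (\<Sum>i\<in>J. t i)"
  have TI: "T \<le> (\<Sum>i\<in>I. t i)"
    unfolding T_def by (rule sum_mono2) (use assms t JI in auto)
  have T0: "0 \<le> T" unfolding T_def by (rule sum_nonneg) (auto simp: J_def)
  have R0: "0 \<le> (\<Sum>i\<in>J. t i * u i powr p)" by (rule sum_nonneg) (auto simp: J_def)
  have "(\<Sum>i\<in>J. t i * u i) powr p \<le> T powr (p - 1) * (\<Sum>i\<in>J. t i * u i powr p)"
  proof (cases "J = {}")
    case False
    then have Tpos: "0 < T" unfolding T_def by (intro sum_pos fJ) (auto simp: J_def)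
    have "(\<Sum>i\<in>J. (t i / T) *\<^sub>R u i) powr p \<le> (\<Sum>i\<in>J. (t i / T) * u i powr p)"
      by (rule convex_on_sum[OF fJ False powr_convex[OF p]])
        (use Tpos in \<open>auto simp: J_def T_def sum_divide_distrib[symmetric]\<close>)
    also have "(\<Sum>i\<in>J. (t i / T) *\<^sub>R u i) = (\<Sum>i\<in>J. t i * u i) / T"
      by (simp add: sum_divide_distrib)
    also have "(\<Sum>i\<in>J. (t i / T) * u i powr p) = (\<Sum>i\<in>J. t i * u i powr p) / T"
      by (simp add: sum_divide_distrib)
    also have "((\<Sum>i\<in>J. t i * u i) / T) powr p = (\<Sum>i\<in>J. t i * u i) powr p / T powr p"
      by (rule powr_divide)
    finally have "(\<Sum>i\<in>J. t i * u i) powr p \<le> T powr p * ((\<Sum>i\<in>J. t i * u i powr p) / T)"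
      using Tpos by (simp add: field_simps)
    also have "\<dots> = T powr (p - 1) * (\<Sum>i\<in>J. t i * u i powr p)"
      using Tpos by (simp add: powr_diff)
    finally show ?thesis .
  qed auto
  also have "\<dots> \<le> (\<Sum>i\<in>I. t i) powr (p - 1) * (\<Sum>i\<in>J. t i * u i powr p)"
    by (intro mult_right_mono powr_mono2 R0 TI T0) (use p in auto)
  finally show ?thesis by (simp add: e1 e2)
qed

lemma sum_powr_le_powr_sum:
  fixes b :: "'i \<Rightarrow> real"
  assumes "finite I" and p: "1 \<le> p" and b: "\<And>i. i \<in> I \<Longrightarrow> 0 \<le> b i"
  shows "(\<Sum>i\<in>I. b i powr p) \<le> (\<Sum>i\<in>I. b i) powr p"
proof -
  define s where "s = (\<Sum>i\<in>I. b i)"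
  have s0: "0 \<le> s" unfolding s_def by (rule sum_nonneg) (use b in auto)
  have split: "x powr p = x * x powr (p - 1)" if "0 \<le> x" for x :: real
    using that by (cases "x = 0") (auto simp: powr_mult_base)
  have "(\<Sum>i\<in>I. b i powr p) \<le> (\<Sum>i\<in>I. b i * s powr (p - 1))"
  proof (rule sum_mono)
    fix i assume i: "i \<in> I"
    have "b i \<le> s" unfolding s_def by (rule member_le_sum) (use i b assms(1) in auto)
    then show "b i powr p \<le> b i * s powr (p - 1)"
      unfolding split[OF b[OF i]] by (intro mult_left_mono powr_mono2 b i) (use p in auto)
  qed
  also have "\<dots> = s powr p" by (simp add: s_def[symmetric] sum_distrib_right[symmetric] split[OF s0])
  finally show ?thesis unfolding s_def .
qed

lemma add3_powr_le:
  fixes x y z :: real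
  assumes "1 \<le> p" "0 \<le> x" "0 \<le> y" "0 \<le> z"
  shows "(x + y + z) powr p \<le> 3 powr p * (x powr p + y powr p + z powr p)"
proof -
  define m where "m = max x (max y z)"
  have "(x + y + z) powr p \<le> (3 * m) powr p"
    by (rule powr_mono2) (use assms in \<open>auto simp: m_def\<close>)
  also have "\<dots> = 3 powr p * m powr p" using assms by (simp add: powr_mult m_def)
  also have "m powr p \<le> x powr p + y powr p + z powr p"
    by (auto simp: m_def max_def add_nonneg_nonneg)
  finally show ?thesis by simp
qed


section \<open>Dyadic levels\<close>

text \<open>
  Level \<open>j\<close> consists of the distances \<open>n\<close> with \<open>2 ^ j \<le> n + 1 < 2 ^ (j + 1)\<close>; the shift by one
  puts distance \<open>0\<close> on level \<open>0\<close> and matches the weights \<open>n + 1\<close> of the Beurling norms.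
\<close>
definition lev :: "nat \<Rightarrow> nat" where
  "lev n = floor_log (n + 1)"

lemma two_pow_lev_le: "2 ^ lev n \<le> n + 1"
  unfolding lev_def by (rule floor_log_exp2_le) simp

lemma less_two_pow_lev: "n + 1 < 2 ^ (lev n + 1)"
  using floor_log_exp2_gt[of "n + 1"] by (simp add: lev_def)

lemma lev_mono: "m \<le> n \<Longrightarrow> lev m \<le> lev n"
  unfolding lev_def by (intro floor_log_le_iff) simp

lemma lev_less_iff: "lev n < j \<longleftrightarrow> n + 1 < 2 ^ j"
proof
  assume "lev n < j"
  then have "(2::nat) ^ (lev n + 1) \<le> 2 ^ j" by (intro power_increasing) auto
  then show "n + 1 < 2 ^ j" using less_two_pow_lev[of n] by linarith
next
  assume "n + 1 < 2 ^ j"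
  then have "(2::nat) ^ lev n < 2 ^ j" using two_pow_lev_le[of n] by linarith
  then show "lev n < j" by simp
qed

lemma le_lev_iff: "j \<le> lev n \<longleftrightarrow> 2 ^ j \<le> n + 1"
  by (simp only: not_less[symmetric] lev_less_iff)

lemma lev_add_le: "lev (m + n) \<le> max (lev m) (lev n) + 1"
proof -
  have "m + n + 1 < 2 ^ (max (lev m) (lev n) + 2)"
  proof -
    have "m + 1 < 2 ^ (max (lev m) (lev n) + 1)" "n + 1 < 2 ^ (max (lev m) (lev n) + 1)"
      by (simp_all only: lev_less_iff[symmetric])
    then show ?thesis by (simp add: power_add)
  qed
  then have "lev (m + n) < max (lev m) (lev n) + 2" by (simp only: lev_less_iff)
  then show ?thesis by simp
qed

text \<open>
  A sum of a profile \<open>t\<close> over levels costs no more than summing \<open>t i\<close> against the full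
  sublevel sets, which for distances are balls.
\<close>
lemma sum_levels_le:
  fixes t u :: "_ \<Rightarrow> real"
  assumes F: "finite F" and t: "\<And>i. 0 \<le> t i" and u: "\<And>z. z \<in> F \<Longrightarrow> 0 \<le> u z"
    and I: "\<And>z. z \<in> F \<Longrightarrow> l z < (I::nat)"
  shows "(\<Sum>z\<in>F. t (l z) * u z) \<le> (\<Sum>i<I. t i * (\<Sum>z | z \<in> F \<and> l z \<le> i. u z))"
proof -
  have "(\<Sum>z\<in>F. t (l z) * u z) \<le> (\<Sum>z\<in>F. \<Sum>i<I. if l z \<le> i then t i * u z else 0)"
  proof (rule sum_mono)
    fix z assume z: "z \<in> F"
    have "t (l z) * u z = (if l z \<le> l z then t (l z) * u z else 0)" by simp
    also have "\<dots> \<le> (\<Sum>i<I. if l z \<le> i then t i * u z else 0)"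
      by (rule member_le_sum) (use I[OF z] t u[OF z] in auto)
    finally show "t (l z) * u z \<le> (\<Sum>i<I. if l z \<le> i then t i * u z else 0)" .
  qed
  also have "\<dots> = (\<Sum>i<I. \<Sum>z\<in>F. if l z \<le> i then t i * u z else 0)" by (rule sum.swap)
  also have "\<dots> = (\<Sum>i<I. t i * (\<Sum>z | z \<in> F \<and> l z \<le> i. u z))"
    by (simp add: sum_distrib_left sum.inter_filter[OF F] if_distrib cong: if_cong)
  finally show ?thesis .
qed


section \<open>Weighted averages over a space of polynomial growth\<close>

text \<open>
  All that the proof uses about the graph: polynomial volume growth with exponent \<open>d\<close>,
  doubling of balls, and at each scale \<open>N\<close> a net whose number of points in a ball of radius
  \<open>(N + 1) R\<close> is bounded by a power \<open>dt\<close> of \<open>R\<close>, uniformly in \<open>N\<close>. The exponent \<open>p\<close> of the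
  sequence space is included so that the constants below depend on the parameters of the
  locale alone.
\<close>
locale growth_space =
  fixes \<rho> :: "'v \<Rightarrow> 'v \<Rightarrow> nat" and d dt p D Q P :: real
  assumes rho_self [simp]: "\<rho> x x = 0"
    and rho_sym: "\<rho> x y = \<rho> y x"
    and rho_triangle: "\<rho> x z \<le> \<rho> x y + \<rho> y z"
    and finite_balls: "finite {z. \<rho> x z \<le> n}"
    and growth: "real (card {z. \<rho> x z \<le> n}) \<le> D * real (n + 1) powr d"
    and doubling_balls:
      "real (card {z. \<rho> x z \<le> 2 * n}) \<le> Q * real (card {z. \<rho> x z \<le> n})"
    and nets: "\<exists>S. (\<forall>x. \<exists>m\<in>S. \<rho> x m \<le> 2 * N) \<and>
       (\<forall>x R. real (card {m \<in> S. \<rho> x m \<le> (N + 1) * R}) \<le> P * real (R + 1) powr dt)"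
    and d_nonneg: "0 \<le> d" and d_le_dt: "d \<le> dt" and p_ge_1: "1 \<le> p"
    and D_ge_1: "1 \<le> D" and Q_ge_1: "1 \<le> Q" and P_ge_1: "1 \<le> P"
begin

abbreviation B :: "'v \<Rightarrow> nat \<Rightarrow> 'v set" where
  "B x n \<equiv> {z. \<rho> x z \<le> n}"

lemma centre_in_ball: "x \<in> B x n" by simp

lemma card_ball_pos: "0 < card (B x n)"
  using finite_balls centre_in_ball card_gt_0_iff by blast

text \<open>
  An average over a ball is at most \<open>a powr (1 / p)\<close> times the weighted \<open>p\<close>-average. This form
  of the Muckenhoupt condition is the same for \<open>p = 1\<close> and \<open>p > 1\<close>, and on indicator functions
  it compares the weight of a ball with that of its subsets.
\<close>
definition averaging_weight :: "('v \<Rightarrow> real) \<Rightarrow> real \<Rightarrow> bool" where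
  "averaging_weight w a \<longleftrightarrow> (\<forall>x. 0 < w x) \<and> 1 \<le> a \<and>
     (\<forall>x n u. (\<forall>z. 0 \<le> u z) \<longrightarrow>
        (\<Sum>z\<in>B x n. u z) powr p * sum w (B x n)
          \<le> a * real (card (B x n)) powr p * (\<Sum>z\<in>B x n. u z powr p * w z))"

lemma averaging_weightD:
  assumes "averaging_weight w a"
  shows weight_pos: "0 < w x" and weight_const_ge_1: "1 \<le> a"
    and weight_average: "(\<And>z. 0 \<le> u z) \<Longrightarrow> (\<Sum>z\<in>B x n. u z) powr p * sum w (B x n)
          \<le> a * real (card (B x n)) powr p * (\<Sum>z\<in>B x n. u z powr p * w z)"
  using assms unfolding averaging_weight_def by auto

lemma weight_ball_pos:
  assumes "averaging_weight w a" shows "0 < sum w (B x n)"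
  by (rule sum_pos[OF finite_balls]) (use weight_pos[OF assms] centre_in_ball in blast)+

lemma weight_nonneg: "averaging_weight w a \<Longrightarrow> 0 \<le> w x"
  using weight_pos less_imp_le by blast

lemma weight_ball_nonneg: "averaging_weight w a \<Longrightarrow> 0 \<le> sum w (B x n)"
  using weight_ball_pos less_imp_le by blast

lemma weight_subset:
  assumes m: "averaging_weight w a" and E: "E \<subseteq> B x n"
  shows "real (card E) powr p * sum w (B x n) \<le> a * real (card (B x n)) powr p * sum w E"
proof -
  have r: "B x n \<inter> E = E" using E by blast
  have s: "(\<Sum>z\<in>B x n. if z \<in> E then f z else 0) = sum f E" for f :: "'v \<Rightarrow> real"
    using sum.inter_restrict[OF finite_balls, of f x n E] r by simp
  have pw: "(if z \<in> E then 1 else (0::real)) powr p * w z = (if z \<in> E then w z else 0)" for z by simp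
  show ?thesis
    using weight_average[OF m, of "\<lambda>z. if z \<in> E then 1 else 0" x n]
    by (simp add: pw s)
qed

text \<open>
  Cover the ball by boundedly many pieces of diameter at most \<open>n\<close>, the fibres of a map to
  nearby points of a net. If \<open>x\<close> lies in the piece \<open>Y\<close>, then \<open>Y\<close> is contained in the ball
  around \<open>x\<close>, so the denominators on \<open>Y\<close> are at least the weight of \<open>Y\<close> and each piece
  contributes at most \<open>1\<close>. The bound does not depend on \<open>a\<close>, so that the next lemma has the
  first power of \<open>a\<close> only.
\<close>
lemma sum_ratio_le:
  assumes m: "averaging_weight w a"
  shows "(\<Sum>x\<in>B z n. w x / sum w (B x n)) \<le> P * 9 powr dt"
proof -
  \<comment> \<open>Points of one piece are at distance at most \<open>4 N \<le> n\<close>, while all pieces belong to net points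
    within \<open>n + 2 N \<le> 8 (N + 1)\<close> of \<open>z\<close>.\<close>
  define N where "N = n div 4"
  obtain S where cov: "\<And>x. \<exists>m\<in>S. \<rho> x m \<le> 2 * N"
    and cnt: "\<And>x R. real (card {m \<in> S. \<rho> x m \<le> (N + 1) * R}) \<le> P * real (R + 1) powr dt"
    using nets[of N] by blast
  define f where "f x = (SOME m. m \<in> S \<and> \<rho> x m \<le> 2 * N)" for x
  have f: "f x \<in> S" "\<rho> x (f x) \<le> 2 * N" for x
    using someI_ex[of "\<lambda>m. m \<in> S \<and> \<rho> x m \<le> 2 * N"] cov[of x] unfolding f_def by auto
  define M where "M = f ` B z n"
  have fM: "finite M" unfolding M_def using finite_balls by blast
  have "M \<subseteq> {m \<in> S. \<rho> z m \<le> (N + 1) * 8}"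
  proof
    fix m assume "m \<in> M"
    then obtain x where x: "\<rho> z x \<le> n" "m = f x" unfolding M_def by auto
    have "\<rho> z m \<le> n + 2 * N" using rho_triangle[of z m x] f(2)[of x] x(1) unfolding x(2) by linarith
    also have "\<dots> \<le> (N + 1) * 8" unfolding N_def by presburger
    finally show "m \<in> {m \<in> S. \<rho> z m \<le> (N + 1) * 8}" using f(1) x by auto
  qed
  then have "card M \<le> card {m \<in> S. \<rho> z m \<le> (N + 1) * 8}"
    by (intro card_mono) (rule finite_subset[OF _ finite_balls[of z "(N + 1) * 8"]], auto)
  then have cM: "real (card M) \<le> P * 9 powr dt" using cnt[of z 8] by simp
  have "(\<Sum>x\<in>B z n. w x / sum w (B x n)) = (\<Sum>m\<in>M. \<Sum>x | x \<in> B z n \<and> f x = m. w x / sum w (B x n))"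
    unfolding M_def by (rule sum.image_gen[OF finite_balls])
  also have "\<dots> \<le> (\<Sum>m\<in>M. 1)"
  proof (rule sum_mono)
    fix m
    define Y where "Y = {x. x \<in> B z n \<and> f x = m}"
    have fY: "finite Y" unfolding Y_def using finite_balls[of z n] by simp
    show "(\<Sum>x | x \<in> B z n \<and> f x = m. w x / sum w (B x n)) \<le> 1"
    proof (cases "Y = {}")
      case False
      have pY: "0 < sum w Y" by (rule sum_pos[OF fY False]) (use weight_pos[OF m] in auto)
      have "(\<Sum>x\<in>Y. w x / sum w (B x n)) \<le> (\<Sum>x\<in>Y. w x / sum w Y)"
      proof (rule sum_mono)
        fix x assume x: "x \<in> Y"
        have "Y \<subseteq> B x n"
        proof
          fix y assume y: "y \<in> Y"
          have "\<rho> x y \<le> 2 * N + 2 * N"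
            using rho_triangle[of x y m] f(2)[of x] f(2)[of y] x y rho_sym[of m y] unfolding Y_def by auto
          then show "y \<in> B x n" unfolding N_def by simp
        qed
        then have "sum w Y \<le> sum w (B x n)"
          by (intro sum_mono2 finite_balls) (use weight_nonneg[OF m] in auto)
        then show "w x / sum w (B x n) \<le> w x / sum w Y"
          using pY weight_pos[OF m, of x] by (intro divide_left_mono) auto
      qed
      also have "\<dots> = 1" using pY by (simp add: sum_divide_distrib[symmetric])
      finally show ?thesis unfolding Y_def .
    next
      case True
      then have "{x. x \<in> B z n \<and> f x = m} = {}" unfolding Y_def .
      then show ?thesis by (simp only: sum.empty zero_le_one)
    qed
  qed
  finally show ?thesis using cM by simp
qed

text \<open>
  Ball averages at one fixed radius are bounded on the weighted space with norm of order
  \<open>a powr (1 / p)\<close>: apply the averaging inequality at each \<open>x\<close> and sum over \<open>x\<close> first, where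
  the previous lemma applies.
\<close>
lemma weighted_ball_sum_bound:
  assumes m: "averaging_weight w a" and X: "finite X" and F: "finite F" and u: "\<And>z. 0 \<le> u z"
  shows "(\<Sum>x\<in>X. w x * ((\<Sum>z\<in>F \<inter> B x n. u z) / real (n + 1) powr d) powr p)
    \<le> a * (P * 9 powr dt * D powr p) * (\<Sum>z\<in>F. u z powr p * w z)"
proof -
  let ?W = "\<lambda>x. sum w (B x n)"
  let ?S = "\<lambda>x. \<Sum>z\<in>F \<inter> B x n. u z powr p * w z"
  let ?s = "\<lambda>x. \<Sum>z\<in>F \<inter> B x n. u z"
  let ?g = "\<lambda>x z. a * D powr p * (u z powr p * w z) * (w x / ?W x)"
  define c where "c x = a * real (card (B x n)) powr p" for x
  define n' where "n' = real (n + 1) powr d"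
  have n'pos: "0 < n'" unfolding n'_def by simp
  have a1: "1 \<le> a" by (rule weight_const_ge_1[OF m])
  have one: "w x * (?s x / n') powr p
     \<le> (\<Sum>z\<in>F. if \<rho> x z \<le> n then ?g x z else 0)" for x
  proof -
    have e: "(\<Sum>z\<in>F \<inter> B x n. g z) = (\<Sum>z\<in>B x n. if z \<in> F then g z else 0)" for g :: "'v \<Rightarrow> real"
      using sum.inter_restrict[OF finite_balls, of g x n F] by (simp add: Int_commute)
    have pw: "(if z \<in> F then u z else (0::real)) powr p * w z = (if z \<in> F then u z powr p * w z else 0)" for z by simp
    have av: "?s x powr p * ?W x \<le> c x * ?S x"
      using weight_average[OF m, of "\<lambda>z. if z \<in> F then u z else 0" x n] u
      by (simp add: e pw c_def)
    have s0: "0 \<le> ?S x"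
      by (rule sum_nonneg) (use weight_nonneg[OF m] in auto)
    have cb: "c x \<le> a * D powr p * n' powr p"
    proof -
      have "real (card (B x n)) powr p \<le> (D * n') powr p"
        using growth[of x n] p_ge_1 by (intro powr_mono2) (auto simp: n'_def)
      also have "\<dots> = D powr p * n' powr p" using D_ge_1 n'pos by (simp add: powr_mult)
      finally show ?thesis unfolding c_def using a1 by (simp add: mult_left_mono mult.assoc)
    qed
    have W: "0 < ?W x" by (rule weight_ball_pos[OF m])
    have w: "0 < w x" by (rule weight_pos[OF m])
    have "w x * (?s x / n') powr p
        = w x / (?W x * n' powr p) * (?s x powr p * ?W x)"
      using W by (simp add: powr_divide)
    also have "\<dots> \<le> w x / (?W x * n' powr p) * (c x * ?S x)"
      by (rule mult_left_mono[OF av]) (use w W in simp)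
    also have "\<dots> \<le> w x / (?W x * n' powr p) * (a * D powr p * n' powr p * ?S x)"
      by (intro mult_left_mono mult_right_mono cb s0) (use w W in simp)
    also have "\<dots> = a * D powr p * ?S x * (w x / ?W x)"
      using n'pos by simp
    also have "\<dots> = (\<Sum>z\<in>F \<inter> B x n. ?g x z)"
      by (simp add: sum_distrib_left sum_distrib_right sum_divide_distrib)
    also have "\<dots> = (\<Sum>z\<in>F. if \<rho> x z \<le> n then ?g x z else 0)"
      using sum.inter_restrict[OF F, of "?g x" "B x n"] by simp
    finally show ?thesis .
  qed
  have "(\<Sum>x\<in>X. w x * (?s x / n') powr p)
     \<le> (\<Sum>x\<in>X. \<Sum>z\<in>F. if \<rho> x z \<le> n then ?g x z else 0)"
    by (intro sum_mono one)
  also have "\<dots> = (\<Sum>z\<in>F. \<Sum>x\<in>X. if \<rho> x z \<le> n then ?g x z else 0)"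
    by (rule sum.swap)
  also have "\<dots> \<le> (\<Sum>z\<in>F. a * (P * 9 powr dt * D powr p) * (u z powr p * w z))"
  proof (rule sum_mono)
    fix z
    have "(\<Sum>x\<in>X. if \<rho> x z \<le> n then ?g x z else 0)
       = (\<Sum>x\<in>X \<inter> B z n. ?g x z)"
      using sum.inter_restrict[OF X, of "\<lambda>x. ?g x z" "B z n"] by (simp add: rho_sym[of z])
    also have "\<dots> = a * D powr p * (u z powr p * w z) * (\<Sum>x\<in>X \<inter> B z n. w x / ?W x)"
      by (simp add: sum_distrib_left)
    also have "\<dots> \<le> a * D powr p * (u z powr p * w z) * (\<Sum>x\<in>B z n. w x / ?W x)"
      by (intro mult_left_mono sum_mono2 finite_balls)
        (use a1 D_ge_1 weight_nonneg[OF m] weight_ball_nonneg[OF m] in auto)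
    also have "\<dots> \<le> a * D powr p * (u z powr p * w z) * (P * 9 powr dt)"
      by (intro mult_left_mono sum_ratio_le[OF m]) (use a1 weight_nonneg[OF m] in auto)
    finally show "(\<Sum>x\<in>X. if \<rho> x z \<le> n then ?g x z else 0)
       \<le> a * (P * 9 powr dt * D powr p) * (u z powr p * w z)" by (simp add: mult_ac)
  qed
  finally show ?thesis by (simp add: sum_distrib_left n'_def)
qed

text \<open>
  Decompose a radial kernel into dyadic balls and add up the norms of the ball averages. The
  norms add up by convexity, applied at each \<open>x\<close> with the summable weights \<open>q j\<close>.
\<close>
lemma weighted_kernel_bound:
  assumes m: "averaging_weight w a" and X: "finite X" and F: "finite F" and u: "\<And>z. 0 \<le> u z"
    and t0: "\<And>j. 0 \<le> t j" and T0: "\<And>x z. 0 \<le> T x z" and Tt: "\<And>x z. T x z \<le> t (lev (\<rho> x z))"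
    and tau: "\<And>J. (\<Sum>j<J. t j * (2 ^ (j + 1)) powr d) \<le> \<tau>"
  shows "(\<Sum>x\<in>X. w x * (\<Sum>z\<in>F. T x z * u z) powr p)
    \<le> a * (P * 9 powr dt * D powr p) * \<tau> powr p * (\<Sum>z\<in>F. u z powr p * w z)"
proof -
  let ?T = "\<lambda>x. \<Sum>z\<in>F. T x z * u z"
  let ?C = "a * (P * 9 powr dt * D powr p) * (\<Sum>z\<in>F. u z powr p * w z)"
  define J where "J = Suc (Max (insert 0 ((\<lambda>(x, z). lev (\<rho> x z)) ` (X \<times> F))))"
  have J: "lev (\<rho> x z) < J" if "x \<in> X" "z \<in> F" for x z
    unfolding J_def less_Suc_eq_le by (rule Max_ge) (use that X F in auto)
  define n where "n j = (2 ^ (j + 1) - 1 :: nat)" for j :: nat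
  have n1: "real (n j + 1) = 2 ^ (j + 1)" for j unfolding n_def by (simp add: of_nat_diff)
  define q where "q j = t j * (2 ^ (j + 1)) powr d" for j
  define U where "U x j = (\<Sum>z\<in>F \<inter> B x (n j). u z) / real (n j + 1) powr d" for x j
  have q0: "0 \<le> q j" for j unfolding q_def using t0 by simp
  have U0: "0 \<le> U x j" for x j unfolding U_def by (intro divide_nonneg_nonneg sum_nonneg) (use u in auto)
  have tau0: "0 \<le> \<tau>" using tau[of 0] by simp
  have qU: "q j * U x j = t j * (\<Sum>z\<in>F \<inter> B x (n j). u z)" for x j
    unfolding q_def U_def n1 by simp
  have pt: "?T x \<le> (\<Sum>j<J. q j * U x j)" if x: "x \<in> X" for x
  proof -
    have "?T x \<le> (\<Sum>z\<in>F. t (lev (\<rho> x z)) * u z)"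
      by (intro sum_mono mult_right_mono Tt u)
    also have "\<dots> \<le> (\<Sum>j<J. t j * (\<Sum>z | z \<in> F \<and> lev (\<rho> x z) \<le> j. u z))"
      by (rule sum_levels_le[OF F t0 u J[OF x]])
    also have "\<dots> \<le> (\<Sum>j<J. t j * (\<Sum>z\<in>F \<inter> B x (n j). u z))"
    proof (intro sum_mono mult_left_mono t0 sum_mono2)
      fix j
      show "{z. z \<in> F \<and> lev (\<rho> x z) \<le> j} \<subseteq> F \<inter> B x (n j)"
        using lev_less_iff[of _ "Suc j"] by (auto simp: n_def less_Suc_eq_le)
    qed (use F u in auto)
    also have "\<dots> = (\<Sum>j<J. q j * U x j)" by (simp add: qU)
    finally show ?thesis .
  qed
  have "(\<Sum>x\<in>X. w x * ?T x powr p)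
      \<le> (\<Sum>x\<in>X. w x * (\<tau> powr (p - 1) * (\<Sum>j<J. q j * U x j powr p)))"
  proof (intro sum_mono mult_left_mono)
    fix x assume x: "x \<in> X"
    have "?T x powr p \<le> (\<Sum>j<J. q j * U x j) powr p"
      by (rule powr_mono2[OF _ _ pt[OF x]]) (use p_ge_1 T0 u in \<open>auto intro!: sum_nonneg\<close>)
    also have "\<dots> \<le> (\<Sum>j<J. q j) powr (p - 1) * (\<Sum>j<J. q j * U x j powr p)"
      by (rule sum_powr_Jensen) (use p_ge_1 q0 U0 in auto)
    also have "\<dots> \<le> \<tau> powr (p - 1) * (\<Sum>j<J. q j * U x j powr p)"
      by (intro mult_right_mono powr_mono2 sum_nonneg)
        (use p_ge_1 q0 tau[of J] in \<open>auto simp: q_def\<close>)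
    finally show "?T x powr p \<le> \<tau> powr (p - 1) * (\<Sum>j<J. q j * U x j powr p)" .
  qed (use weight_nonneg[OF m] in auto)
  also have "\<dots> = \<tau> powr (p - 1) * (\<Sum>x\<in>X. \<Sum>j<J. q j * (w x * U x j powr p))"
    by (simp add: sum_distrib_left mult_ac)
  also have "(\<Sum>x\<in>X. \<Sum>j<J. q j * (w x * U x j powr p)) = (\<Sum>j<J. q j * (\<Sum>x\<in>X. w x * U x j powr p))"
    by (subst sum.swap) (simp add: sum_distrib_left)
  also have "\<tau> powr (p - 1) * \<dots> \<le> \<tau> powr (p - 1) * (\<Sum>j<J. q j * ?C)"
    unfolding U_def by (intro mult_left_mono sum_mono weighted_ball_sum_bound[OF m X F u] q0) simp
  also have "\<dots> = \<tau> powr (p - 1) * (\<Sum>j<J. q j) * ?C"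
    by (simp add: sum_distrib_right mult.assoc)
  also have "\<dots> \<le> \<tau> powr (p - 1) * \<tau> * ?C"
    using tau[of J] weight_const_ge_1[OF m] P_ge_1 weight_nonneg[OF m]
    by (intro mult_right_mono mult_left_mono mult_nonneg_nonneg sum_nonneg) (auto simp: q_def)
  also have "\<tau> powr (p - 1) * \<tau> = \<tau> powr p"
    using tau0 by (cases "\<tau> = 0") (auto simp: powr_mult_base mult.commute)
  finally show ?thesis by (simp add: mult_ac)
qed

text \<open>
  Constants of the estimates below. \<open>C_net\<close> bounds the sum of a kernel over a net, \<open>C_near\<close>
  and \<open>C_far\<close> belong to the two parts of the commutator, \<open>C_entry\<close> to the entries of the
  inverse.
\<close>
definition C_net :: "real \<Rightarrow> real" where
  "C_net \<gamma> = P * 4 powr dt / (1 - 2 powr (dt - \<gamma>))"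

definition C_near :: "real \<Rightarrow> real" where
  "C_near \<gamma> = (P * 9 powr dt * D powr p) powr (1 / p) * Q ^ 2 * 2 powr (3 * (\<gamma> + 1))"

definition C_far :: "real \<Rightarrow> real" where
  "C_far \<gamma> = 2 powr (3 * (\<gamma> + 1)) * (D * 5 powr d)"

definition C_entry :: "real \<Rightarrow> real" where
  "C_entry \<gamma> = 6 * (5 powr dt * P * 2 powr (3 * (\<gamma> + 1))) * (D * 5 powr d) * 2 powr (2 * (\<gamma> + 1))"

end

section \<open>Slowly decaying kernels at a fixed scale\<close>

text \<open>
  The least majorant of \<open>v\<close>, normalized to \<open>1\<close> at level \<open>0\<close>, that drops by at most the factor
  \<open>2 powr (\<gamma> + 1)\<close> from one level to the next. This regularity makes kernels with this profile
  closed under convolution. Since \<open>\<gamma> + 1 > \<gamma>\<close>, the dyadic norm with weight \<open>2 powr (\<gamma> i)\<close> of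
  the envelope is still controlled by that of \<open>v\<close>.
\<close>
primrec envelope :: "real \<Rightarrow> (nat \<Rightarrow> real) \<Rightarrow> nat \<Rightarrow> real" where
  "envelope \<gamma> v 0 = 1"
| "envelope \<gamma> v (Suc i) = max (2 powr - (\<gamma> + 1) * envelope \<gamma> v i) (v (Suc i))"

locale scaled_kernel = growth_space +
  fixes \<gamma> :: real and k :: nat and v :: "nat \<Rightarrow> real"
  assumes dt_less: "dt < \<gamma>"
    and v_antimono: "i \<le> j \<Longrightarrow> v j \<le> v i"
    and v_decay: "v i \<le> 2 powr - (\<gamma> * real i)"
begin

lemma gamma_pos: "0 < \<gamma>"
  using dt_less d_nonneg d_le_dt by simp

abbreviation e :: "nat \<Rightarrow> real" where "e \<equiv> envelope \<gamma> v"

lemma e_pos: "0 < e i"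
  by (induction i) (auto simp: less_max_iff_disj)

lemma e_nonneg: "0 \<le> e i"
  using e_pos less_imp_le by blast

lemma v_le_e: "v i \<le> e i"
  using v_decay[of 0] by (cases i) auto

lemma e_step: "e i \<le> 2 powr (\<gamma> + 1) * e (Suc i)"
proof -
  have "2 powr (\<gamma> + 1) * (2 powr - (\<gamma> + 1) * e i) \<le> 2 powr (\<gamma> + 1) * e (Suc i)"
    by (rule mult_left_mono) auto
  then show ?thesis by (simp add: powr_add[symmetric] mult.assoc[symmetric] del: envelope.simps)
qed

lemma e_antimono: "i \<le> j \<Longrightarrow> e j \<le> e i"
proof (induction rule: dec_induct)
  case (step n)
  have "2 powr - (\<gamma> + 1) * e n \<le> 1 * e n"
    using gamma_pos powr_mono[of "- (\<gamma> + 1)" 0 2] by (intro mult_right_mono e_nonneg) simp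
  moreover have "v (Suc n) \<le> e n" using v_antimono[of n "Suc n"] v_le_e[of n] by simp
  ultimately have "e (Suc n) \<le> e n" by simp
  then show ?case using step.IH by linarith
qed simp

lemma e_decay: "e i \<le> 2 powr - (\<gamma> * real i)"
proof (induction i)
  case (Suc i)
  have "2 powr - (\<gamma> + 1) * e i \<le> 2 powr - \<gamma> * 2 powr - (\<gamma> * real i)"
    by (intro mult_mono Suc.IH) (use e_nonneg[of i] in auto)
  also have "\<dots> = 2 powr - (\<gamma> * real (Suc i))" by (simp add: powr_add[symmetric] algebra_simps)
  finally show ?case using v_decay[of "Suc i"] by simp
qed simp

lemma e_shift: "i' \<le> i + n \<Longrightarrow> e i \<le> 2 powr ((\<gamma> + 1) * real n) * e i'"
proof (induction n arbitrary: i')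
  case 0
  then show ?case using e_antimono by simp
next
  case (Suc n)
  show ?case
  proof (cases "i' \<le> i + n")
    case True
    have "2 powr ((\<gamma> + 1) * real n) * e i' \<le> 2 powr ((\<gamma> + 1) * real (Suc n)) * e i'"
      using e_pos[of i'] gamma_pos by (intro mult_right_mono powr_mono) (auto simp: distrib_left)
    then show ?thesis using Suc.IH[OF True] by linarith
  next
    case False
    then have i': "i' = Suc (i + n)" using Suc.prems by simp
    have "e i \<le> 2 powr ((\<gamma> + 1) * real n) * e (i + n)" by (rule Suc.IH) simp
    also have "\<dots> \<le> 2 powr ((\<gamma> + 1) * real n) * (2 powr (\<gamma> + 1) * e i')"
      unfolding i' by (intro mult_left_mono e_step) simp
    also have "\<dots> = 2 powr ((\<gamma> + 1) * real (Suc n)) * e i'"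
      by (simp add: mult.assoc[symmetric] powr_add[symmetric] distrib_left add.commute)
    finally show ?thesis .
  qed
qed

text \<open>
  Levels relative to the scale \<open>2 ^ k\<close>: all distances below the scale have level \<open>0\<close>, so that
  no logarithm of the scale enters when levels are summed.
\<close>
definition level :: "'a \<Rightarrow> 'a \<Rightarrow> nat" where
  "level x z = lev (\<rho> x z) - k"

lemma level_sym: "level x z = level z x"
  by (simp add: level_def rho_sym)

lemma level_le_iff: "level x z \<le> i \<longleftrightarrow> \<rho> x z + 1 < 2 ^ (k + i + 1)"
  using lev_less_iff[of "\<rho> x z" "k + i + 1"] unfolding level_def by linarith

lemma level_triangle: "level x z \<le> max (level x y) (level y z) + 1"
proof -
  have "lev (\<rho> x z) \<le> lev (\<rho> x y + \<rho> y z)" by (rule lev_mono[OF rho_triangle])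
  also have "\<dots> \<le> max (lev (\<rho> x y)) (lev (\<rho> y z)) + 1" by (rule lev_add_le)
  finally show ?thesis unfolding level_def by linarith
qed

definition is_net :: "'a set \<Rightarrow> bool" where
  "is_net S \<longleftrightarrow> (\<forall>x. \<exists>m\<in>S. \<rho> x m \<le> 2 * 2 ^ k) \<and>
     (\<forall>x R. real (card {m \<in> S. \<rho> x m \<le> (2 ^ k + 1) * R}) \<le> P * real (R + 1) powr dt)"

lemma is_net_exists: "\<exists>S. is_net S"
  unfolding is_net_def using nets[of "2 ^ k"] by simp

lemma net_count:
  assumes "is_net S" and "M \<subseteq> S" and "\<And>m. m \<in> M \<Longrightarrow> \<rho> x m \<le> (2 ^ k + 1) * R"
  shows "real (card M) \<le> P * real (R + 1) powr dt"
proof -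
  have "card M \<le> card {m \<in> S. \<rho> x m \<le> (2 ^ k + 1) * R}"
    by (rule card_mono, rule finite_subset[OF _ finite_balls[of x "(2 ^ k + 1) * R"]]) (use assms in auto)
  then show ?thesis using assms(1) unfolding is_net_def by (meson of_nat_mono order_trans)
qed

lemma ratio_less_1: "2 powr (dt - \<gamma>) < 1"
  using dt_less by (simp add: powr_less_one)

lemma C_net_pos: "0 < C_net \<gamma>"
  unfolding C_net_def using ratio_less_1 P_ge_1 by simp

text \<open>
  Level \<open>i\<close> contains at most \<open>C 2 powr (dt i)\<close> points of the net and the profile is at most
  \<open>2 powr (- \<gamma> i)\<close>; this is where \<open>dt < \<gamma>\<close> is needed.
\<close>
lemma net_kernel_sum:
  assumes S: "is_net S" and M: "M \<subseteq> S" "finite M"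
  shows "(\<Sum>m\<in>M. e (level x m)) \<le> C_net \<gamma>"
proof -
  let ?c = "\<lambda>i. real (card {m \<in> M. level x m \<le> i})"
  let ?q = "2 powr (dt - \<gamma>)"
  define I where "I = Suc (Max (insert 0 (level x ` M)))"
  have I: "level x m < I" if "m \<in> M" for m
    unfolding I_def less_Suc_eq_le by (rule Max_ge) (use that M in auto)
  have "(\<Sum>m\<in>M. e (level x m)) \<le> (\<Sum>i<I. e i * ?c i)"
    using sum_levels_le[of M e "\<lambda>_. 1" "level x" I, OF M(2) e_nonneg _ I] by simp
  also have "\<dots> \<le> (\<Sum>i<I. (P * 4 powr dt) * ?q ^ i)"
  proof (rule sum_mono)
    fix i
    have "?c i \<le> P * real (2 ^ (i + 1) + 1) powr dt"
    proof (rule net_count[OF S, where x = x])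
      fix m assume "m \<in> {m \<in> M. level x m \<le> i}"
      then have "\<rho> x m + 1 < 2 ^ (k + i + 1)" by (simp add: level_le_iff)
      then show "\<rho> x m \<le> (2 ^ k + 1) * 2 ^ (i + 1)" by (simp add: power_add algebra_simps)
    qed (use M in auto)
    also have "\<dots> \<le> P * (4 * 2 ^ i) powr dt"
      using P_ge_1 d_nonneg d_le_dt one_le_power[of "2::real" i] by (intro mult_left_mono powr_mono2) (auto simp del: one_le_power)
    also have "\<dots> = P * 4 powr dt * 2 powr (dt * real i)"
      by (simp add: powr_mult powr_powr mult.commute powr_realpow[symmetric])
    finally have c: "?c i \<le> P * 4 powr dt * 2 powr (dt * real i)" .
    have "e i * ?c i \<le> 2 powr - (\<gamma> * real i) * (P * 4 powr dt * 2 powr (dt * real i))"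
      by (intro mult_mono e_decay c) auto
    also have "\<dots> = (P * 4 powr dt) * ?q ^ i"
      by (simp add: powr_realpow[symmetric] powr_powr powr_add[symmetric] algebra_simps)
    finally show "e i * ?c i \<le> (P * 4 powr dt) * ?q ^ i" .
  qed
  also have "\<dots> = (P * 4 powr dt) * (\<Sum>i<I. ?q ^ i)" by (simp add: sum_distrib_left)
  also have "\<dots> \<le> (P * 4 powr dt) * (1 / (1 - ?q))"
    by (intro mult_left_mono sum_power_less_1 ratio_less_1) (use P_ge_1 in auto)
  finally show ?thesis by (simp add: C_net_def)
qed

text \<open>
  One of the two distances \<open>x m\<close> and \<open>m z\<close> is at least half of the distance \<open>x z\<close>; its factor
  is comparable with \<open>e (level x z)\<close>, and the other factor is summed over the net.
\<close>
lemma net_kernel_convolution: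
  assumes S: "is_net S" and M: "M \<subseteq> S" "finite M"
  shows "(\<Sum>m\<in>M. e (level x m) * e (level m z)) \<le> 2 * 2 powr (\<gamma> + 1) * C_net \<gamma> * e (level x z)"
proof -
  have "(\<Sum>m\<in>M. e (level x m) * e (level m z)) \<le> (\<Sum>m\<in>M. 2 powr (\<gamma> + 1) * e (level x z) * (e (level x m) + e (level z m)))"
  proof (rule sum_mono)
    fix m
    have "e (max (level x m) (level m z)) \<le> 2 powr ((\<gamma> + 1) * real 1) * e (level x z)"
      by (rule e_shift[OF level_triangle])
    then have mx: "e (max (level x m) (level m z)) \<le> 2 powr (\<gamma> + 1) * e (level x z)" by simp
    have "e (level x m) * e (level m z) \<le> e (max (level x m) (level m z)) * (e (level x m) + e (level m z))"
      using e_nonneg by (auto simp: max_def algebra_simps)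
    also have "\<dots> \<le> 2 powr (\<gamma> + 1) * e (level x z) * (e (level x m) + e (level m z))"
      by (intro mult_right_mono mx add_nonneg_nonneg) (use e_nonneg in auto)
    finally show "e (level x m) * e (level m z) \<le> 2 powr (\<gamma> + 1) * e (level x z) * (e (level x m) + e (level z m))"
      by (simp add: level_sym[of z])
  qed
  also have "\<dots> = 2 powr (\<gamma> + 1) * e (level x z) * ((\<Sum>m\<in>M. e (level x m)) + (\<Sum>m\<in>M. e (level z m)))"
    unfolding sum_distrib_left[symmetric] sum.distrib ..
  also have "\<dots> \<le> 2 powr (\<gamma> + 1) * e (level x z) * (C_net \<gamma> + C_net \<gamma>)"
    by (intro mult_left_mono add_mono net_kernel_sum[OF S M]) (use e_nonneg[of "level x z"] in auto)
  finally show ?thesis by (simp add: algebra_simps)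
qed

lemma net_kernel_near:
  assumes S: "is_net S" and M: "M \<subseteq> S" "finite M"
    and near: "\<And>m. m \<in> M \<Longrightarrow> \<rho> m y \<le> 4 * 2 ^ k"
  shows "(\<Sum>m\<in>M. e (level x m)) \<le> 5 powr dt * P * 2 powr (3 * (\<gamma> + 1)) * e (level x y)"
proof -
  have "(\<Sum>m\<in>M. e (level x m)) \<le> (\<Sum>m\<in>M. 2 powr ((\<gamma> + 1) * real 3) * e (level x y))"
  proof (intro sum_mono e_shift)
    fix m assume m: "m \<in> M"
    have "level m y \<le> 2"
    proof -
      have "1 \<le> (2::nat) ^ k" by simp
      then have "\<rho> m y + 1 < 8 * 2 ^ k" using near[OF m] by linarith
      then show ?thesis by (simp add: level_le_iff power_add)
    qed
    then show "level x y \<le> level x m + 3" using level_triangle[of x y m] by linarith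
  qed
  also have "\<dots> = real (card M) * (2 powr (3 * (\<gamma> + 1)) * e (level x y))"
    by (simp add: mult.commute)
  also have "\<dots> \<le> (P * real (4 + 1) powr dt) * (2 powr (3 * (\<gamma> + 1)) * e (level x y))"
  proof (intro mult_right_mono)
    show "real (card M) \<le> P * real (4 + 1) powr dt"
      by (rule net_count[OF S M(1), of y]) (use near in \<open>force simp: rho_sym[of y] algebra_simps\<close>)
  qed (use e_pos[of "level x y"] in simp)
  finally show ?thesis by (simp add: mult_ac)
qed

text \<open>
  Convolve the hypothesis on \<open>b\<close> with the kernel. The result bounds \<open>X = \<kappa> * b\<close> by the source
  near \<open>y\<close> plus at most half of \<open>X\<close> itself; as \<open>X\<close> is finite, that half can be subtracted. All
  infinite sums are handled through finite subsets of the net.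
\<close>
lemma kernel_inequality_self_improves:
  assumes S: "is_net S" and b: "\<And>m. m \<in> S \<Longrightarrow> 0 \<le> b m"
    and sm: "\<And>m. m \<in> S \<Longrightarrow> (\<lambda>m'. e (level m m') * b m') summable_on S"
    and F: "0 \<le> F" and \<epsilon>: "0 \<le> \<epsilon>" "\<epsilon> * (2 * 2 powr (\<gamma> + 1) * C_net \<gamma>) \<le> 1 / 2"
    and ineq: "\<And>m. m \<in> S \<Longrightarrow> b m \<le> F * of_bool (\<rho> m y \<le> 4 * 2 ^ k)
        + \<epsilon> * (\<Sum>\<^sub>\<infinity>m'\<in>S. e (level m m') * b m')"
    and m: "m \<in> S"
  shows "(\<Sum>\<^sub>\<infinity>m'\<in>S. e (level m m') * b m') \<le> 2 * F * (5 powr dt * P * 2 powr (3 * (\<gamma> + 1))) * e (level m y)"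
proof -
  let ?K = "\<lambda>m m'. e (level m m')"
  define X where "X m = (\<Sum>\<^sub>\<infinity>m'\<in>S. ?K m m' * b m')" for m
  define C where "C = 2 * 2 powr (\<gamma> + 1) * C_net \<gamma>"
  define Cn where "Cn = 5 powr dt * P * 2 powr (3 * (\<gamma> + 1))"
  have X0: "0 \<le> X m" for m
    unfolding X_def by (rule infsum_nonneg) (use b e_nonneg in auto)
  have main: "(\<Sum>m'\<in>M. ?K m m' * b m') \<le> F * (Cn * e (level m y)) + \<epsilon> * (C * X m)"
    if M: "finite M" "M \<subseteq> S" for M
  proof -
    define M' where "M' = {m' \<in> M. \<rho> m' y \<le> 4 * 2 ^ k}"
    have "(\<Sum>m'\<in>M. ?K m m' * b m')
        \<le> (\<Sum>m'\<in>M. ?K m m' * (F * of_bool (\<rho> m' y \<le> 4 * 2 ^ k) + \<epsilon> * X m'))"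
      unfolding X_def by (intro sum_mono mult_left_mono ineq) (use M e_nonneg in auto)
    also have "\<dots> = F * (\<Sum>m'\<in>M. if \<rho> m' y \<le> 4 * 2 ^ k then ?K m m' else 0) + \<epsilon> * (\<Sum>m'\<in>M. ?K m m' * X m')"
      unfolding distrib_left sum.distrib sum_distrib_left
      by (intro arg_cong2[of _ _ _ _ "(+)"] sum.cong) auto
    also have "(\<Sum>m'\<in>M. if \<rho> m' y \<le> 4 * 2 ^ k then ?K m m' else 0) = (\<Sum>m'\<in>M'. ?K m m')"
      unfolding M'_def by (rule sum.inter_filter[OF M(1), symmetric])
    also have "(\<Sum>m'\<in>M'. ?K m m') \<le> Cn * e (level m y)"
      unfolding Cn_def by (rule net_kernel_near[OF S]) (use M in \<open>auto simp: M'_def\<close>)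
    also have "(\<Sum>m'\<in>M. ?K m m' * X m') = (\<Sum>\<^sub>\<infinity>z\<in>S. \<Sum>m'\<in>M. ?K m m' * (e (level m' z) * b z))"
    proof -
      have "(\<Sum>m'\<in>M. ?K m m' * X m') = (\<Sum>m'\<in>M. \<Sum>\<^sub>\<infinity>z\<in>S. ?K m m' * (e (level m' z) * b z))"
        unfolding X_def by (intro sum.cong refl infsum_cmult_right[symmetric]) (use M sm in auto)
      also have "\<dots> = (\<Sum>\<^sub>\<infinity>z\<in>S. \<Sum>m'\<in>M. ?K m m' * (e (level m' z) * b z))"
        by (rule infsum_finite_sum[symmetric]) (use M sm in \<open>auto intro!: summable_on_cmult_right\<close>)
      finally show ?thesis .
    qed
    also have "\<dots> \<le> (\<Sum>\<^sub>\<infinity>z\<in>S. C * (e (level m z) * b z))"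
    proof (rule infsum_mono)
      show "(\<lambda>z. \<Sum>m'\<in>M. ?K m m' * (e (level m' z) * b z)) summable_on S"
        by (rule summable_on_finite_sum) (use M sm in \<open>auto intro!: summable_on_cmult_right\<close>)
      show "(\<lambda>z. C * (e (level m z) * b z)) summable_on S"
        by (rule summable_on_cmult_right[OF sm[OF m]])
      fix z assume z: "z \<in> S"
      have "(\<Sum>m'\<in>M. ?K m m' * e (level m' z)) * b z \<le> (C * e (level m z)) * b z"
        unfolding C_def by (intro mult_right_mono net_kernel_convolution[OF S] b z M)
      then show "(\<Sum>m'\<in>M. ?K m m' * (e (level m' z) * b z)) \<le> C * (e (level m z) * b z)"
        by (simp add: sum_distrib_right mult.assoc)
    qed
    also have "\<dots> = C * X m"
      unfolding X_def by (rule infsum_cmult_right[OF sm[OF m]])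
    finally show ?thesis using F \<epsilon> by (simp add: mult_left_mono)
  qed
  have "X m \<le> F * (Cn * e (level m y)) + \<epsilon> * (C * X m)"
    unfolding X_def[of m] by (rule infsum_le_finite_sums[OF sm[OF m]]) (use main X_def in auto)
  also have "\<epsilon> * (C * X m) \<le> 1 / 2 * X m"
    using mult_right_mono[OF \<epsilon>(2) X0[of m]] by (simp add: C_def mult.assoc)
  finally have "X m \<le> 2 * F * Cn * e (level m y)" by (simp add: mult_ac)
  then show ?thesis unfolding X_def Cn_def .
qed

end

section \<open>Local estimates for a column of the inverse\<close>

text \<open>
  The column \<open>c\<close> of the inverse at \<open>y\<close>, seen at scale \<open>2 ^ k\<close>. The profile \<open>s\<close> bounds the
  entries of \<open>A\<close>; \<open>v\<close> is its rescaled tail; \<open>\<omega>\<close> bounds the norm of the commutator of \<open>A\<close> with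
  a cutoff of Lipschitz constant \<open>1 / 2 ^ k\<close>. The inverse, of norm \<open>\<beta>\<close>, enters through the
  lower bound \<open>\<parallel>f\<parallel> \<le> \<beta> \<parallel>A f\<parallel>\<close> for finitely supported \<open>f\<close>.
\<close>
locale localized_column = scaled_kernel \<rho> d dt p D Q P \<gamma> k v
  for \<rho> :: "'v \<Rightarrow> 'v \<Rightarrow> nat" and d dt p D Q P \<gamma> k v +
  fixes A :: "'v \<Rightarrow> 'v \<Rightarrow> complex" and s :: "nat \<Rightarrow> real" and w :: "'v \<Rightarrow> real"
    and a H \<omega> \<beta> :: real and c :: "'v \<Rightarrow> complex" and y :: 'v and M :: real
  assumes weight: "averaging_weight w a"
    and A_decay: "norm (A x z) \<le> s (lev (\<rho> x z))"
    and s_nonneg: "0 \<le> s j"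
    and H_nonneg: "0 \<le> H"
    and s_tail: "s (k + i) \<le> H * (2 ^ k) powr - \<gamma> * v i"
    and commutator_sum: "(\<Sum>j<J. s j * min 1 (2 ^ (j + 1) / 2 ^ k) * (2 ^ (j + 1)) powr d) \<le> \<omega>"
    and beta_nonneg: "0 \<le> \<beta>"
    and lower_bound: "\<lbrakk>finite F; \<And>X. finite X \<Longrightarrow> (\<Sum>x\<in>X. norm (\<Sum>z\<in>F. A x z * f z) powr p * w x) \<le> G\<rbrakk>
        \<Longrightarrow> (\<Sum>z\<in>F. norm (f z) powr p * w z) \<le> \<beta> powr p * G"
    and c_summable: "(\<lambda>z. A x z * c z) summable_on UNIV"
    and A_c: "(\<Sum>\<^sub>\<infinity>z. A x z * c z) = of_bool (x = y)"
    and c_norm: "finite X \<Longrightarrow> (\<Sum>x\<in>X. norm (c x) powr p * w x) \<le> M"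
begin

abbreviation N :: nat where "N \<equiv> 2 ^ k"

lemma N_ge_1: "1 \<le> N" by simp

text \<open>
  The weight is taken over the ball of radius \<open>4 N\<close> although \<open>b\<close> sees \<open>c\<close> only on the ball of
  radius \<open>2 N\<close>. Hence \<open>w y \<le> W m\<close> as soon as \<open>y\<close> lies in the support of the cutoff at \<open>m\<close>, so
  that the source term is bounded by \<open>\<beta>\<close> without a factor \<open>a powr (1 / p)\<close>.
\<close>
definition W :: "'v \<Rightarrow> real" where "W m = sum w (B m (4 * N))"

definition b :: "'v \<Rightarrow> real" where
  "b m = ((\<Sum>z\<in>B m (2 * N). norm (c z) powr p * w z) / W m) powr (1 / p)"

lemma p_pos: "0 < p" using p_ge_1 by simp

lemmas w_nonneg = weight_nonneg[OF weight]
lemmas w_pos = weight_pos[OF weight]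

lemma a_ge_1: "1 \<le> a" by (rule weight_const_ge_1[OF weight])

lemma W_pos: "0 < W m" unfolding W_def by (rule weight_ball_pos[OF weight])

lemma b_nonneg: "0 \<le> b m" unfolding b_def by simp

lemma b_powr: "b m powr p * W m = (\<Sum>z\<in>B m (2 * N). norm (c z) powr p * w z)"
proof -
  have "0 \<le> (\<Sum>z\<in>B m (2 * N). norm (c z) powr p * w z) / W m"
    by (intro divide_nonneg_nonneg sum_nonneg mult_nonneg_nonneg w_nonneg) (use W_pos[of m] in auto)
  then show ?thesis
    unfolding b_def powr_powr using p_pos W_pos[of m] by (simp del: abs_divide)
qed

lemma w_le_W: "\<rho> m z \<le> 4 * N \<Longrightarrow> w z \<le> W m"
  unfolding W_def by (rule member_le_sum) (use w_nonneg finite_balls in auto)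

lemma root_powr: "0 \<le> x \<Longrightarrow> (x powr (1 / p)) powr p = x"
  using p_pos by (simp add: powr_powr)

lemma card_ball_le: "real (card (B m (4 * N))) \<le> D * 5 powr d * real N powr d"
proof -
  have "real (card (B m (4 * N))) \<le> D * real (4 * N + 1) powr d" by (rule growth)
  also have "\<dots> \<le> D * (5 * real N) powr d"
    using D_ge_1 d_nonneg N_ge_1 by (intro mult_left_mono powr_mono2) auto
  finally show ?thesis by (simp add: powr_mult)
qed

lemma ball_l1_le: "(\<Sum>z\<in>B m (2 * N). norm (c z)) \<le> real (card (B m (4 * N))) * a powr (1 / p) * b m"
proof (rule le_of_powr_le_powr[OF _ p_pos])
  define u where "u z = (if z \<in> B m (2 * N) then norm (c z) else 0)" for z
  have r: "(\<Sum>z\<in>B m (4 * N). if z \<in> B m (2 * N) then g z else 0) = sum g (B m (2 * N))" for g :: "'v \<Rightarrow> real"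
  proof -
    have "B m (4 * N) \<inter> B m (2 * N) = B m (2 * N)" by auto
    then show ?thesis using sum.inter_restrict[OF finite_balls, of g m "4 * N" "B m (2 * N)"] by simp
  qed
  have "(\<Sum>z\<in>B m (4 * N). u z) powr p * W m
      \<le> a * real (card (B m (4 * N))) powr p * (\<Sum>z\<in>B m (4 * N). u z powr p * w z)"
    unfolding W_def by (rule weight_average[OF weight]) (simp add: u_def)
  also have "(\<Sum>z\<in>B m (4 * N). u z) = (\<Sum>z\<in>B m (2 * N). norm (c z))"
    unfolding u_def by (rule r)
  also have "(\<Sum>z\<in>B m (4 * N). u z powr p * w z) = (\<Sum>z\<in>B m (2 * N). norm (c z) powr p * w z)"
    unfolding r[symmetric] u_def by (rule sum.cong) auto
  also have "\<dots> = b m powr p * W m" by (rule b_powr[symmetric])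
  finally have "(\<Sum>z\<in>B m (2 * N). norm (c z)) powr p \<le> a * real (card (B m (4 * N))) powr p * b m powr p"
    using W_pos[of m] by simp
  also have "\<dots> = (real (card (B m (4 * N))) * a powr (1 / p) * b m) powr p"
    using a_ge_1 b_nonneg by (simp add: powr_mult root_powr)
  finally show "(\<Sum>z\<in>B m (2 * N). norm (c z)) powr p \<le> \<dots>" .
qed (use b_nonneg in auto)

lemma b_le_l1: "b m \<le> (\<Sum>z\<in>B m (2 * N). norm (c z))"
proof (rule le_of_powr_le_powr[OF _ p_pos])
  have "b m powr p * W m \<le> (\<Sum>z\<in>B m (2 * N). norm (c z) powr p * W m)"
    unfolding b_powr by (intro sum_mono mult_left_mono w_le_W) auto
  also have "\<dots> = (\<Sum>z\<in>B m (2 * N). norm (c z) powr p) * W m" by (simp add: sum_distrib_right)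
  finally have "b m powr p \<le> (\<Sum>z\<in>B m (2 * N). norm (c z) powr p)"
    using W_pos[of m] by simp
  also have "\<dots> \<le> (\<Sum>z\<in>B m (2 * N). norm (c z)) powr p"
    by (rule sum_powr_le_powr_sum[OF finite_balls p_ge_1]) simp
  finally show "b m powr p \<le> \<dots>" .
qed (simp add: sum_nonneg)

lemma level_le_small:
  assumes "\<rho> x z \<le> n * N" "n + 1 < 2 ^ (i + 1)"
  shows "level x z \<le> i"
proof -
  have "\<rho> x z + 1 \<le> (n + 1) * N" using assms(1) N_ge_1 unfolding distrib_right by linarith
  also have "\<dots> < 2 ^ (i + 1) * N" by (rule mult_strict_right_mono[OF assms(2)]) simp
  finally show ?thesis by (simp add: level_le_iff power_add mult_ac)
qed

lemma c_ball_l1: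
  "(\<Sum>z\<in>B m n. norm (c z)) \<le> D * real (n + 1) powr d * (a * M / w m) powr (1 / p)"
proof (rule le_of_powr_le_powr[OF _ p_pos])
  have M0: "0 \<le> M" using c_norm[of "{}"] by simp
  have "(\<Sum>z\<in>B m n. norm (c z)) powr p * w m \<le> (\<Sum>z\<in>B m n. norm (c z)) powr p * sum w (B m n)"
    by (intro mult_left_mono member_le_sum) (use w_nonneg finite_balls in auto)
  also have "\<dots> \<le> a * real (card (B m n)) powr p * (\<Sum>z\<in>B m n. norm (c z) powr p * w z)"
    by (rule weight_average[OF weight]) simp
  also have "\<dots> \<le> a * (D * real (n + 1) powr d) powr p * M"
    by (intro mult_mono powr_mono2 growth c_norm finite_balls sum_nonneg mult_nonneg_nonneg)
      (use a_ge_1 p_pos w_nonneg M0 in auto)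
  finally have "(\<Sum>z\<in>B m n. norm (c z)) powr p \<le> (D * real (n + 1) powr d) powr p * (a * M / w m)"
    using w_pos[of m] by (simp add: field_simps)
  also have "\<dots> = (D * real (n + 1) powr d * (a * M / w m) powr (1 / p)) powr p"
    using a_ge_1 M0 w_pos[of m] D_ge_1 by (simp add: powr_mult root_powr)
  finally show "(\<Sum>z\<in>B m n. norm (c z)) powr p \<le> \<dots>" .
qed (use D_ge_1 in auto)

text \<open>
  The averaging inequality bounds the sum of \<open>\<bar>c\<bar>\<close> over the ball of radius \<open>n\<close> around \<open>m\<close> by
  \<open>n powr d\<close> times a number that depends on \<open>m\<close>; the kernel decays faster, since \<open>d \<le> dt < \<gamma>\<close>.
\<close>
lemma kernel_c_bounded:
  "\<exists>K. \<forall>Z. finite Z \<longrightarrow> (\<Sum>z\<in>Z. e (level m z) * norm (c z)) \<le> K"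
proof (intro exI allI impI)
  fix Z :: "'v set" assume Z: "finite Z"
  let ?s = "\<lambda>i. \<Sum>z | z \<in> Z \<and> level m z \<le> i. norm (c z)"
  define q where "q = 2 powr (d - \<gamma>)"
  have q: "0 < q" "q < 1" unfolding q_def using d_le_dt dt_less by (auto intro: powr_less_one)
  define R where "R = (a * M / w m) powr (1 / p)"
  let ?D = "D * (4 * real N) powr d * R"
  define I where "I = Suc (Max (insert 0 (level m ` Z)))"
  have I: "level m z < I" if "z \<in> Z" for z
    unfolding I_def less_Suc_eq_le by (rule Max_ge) (use that Z in auto)
  have "(\<Sum>z\<in>Z. e (level m z) * norm (c z)) \<le> (\<Sum>i<I. e i * ?s i)"
    by (rule sum_levels_le[OF Z e_nonneg _ I]) simp
  also have "\<dots> \<le> (\<Sum>i<I. ?D * q ^ i)"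
  proof (rule sum_mono)
    fix i
    have "?s i \<le> (\<Sum>z\<in>B m (2 ^ (k + i + 1)). norm (c z))"
      by (rule sum_mono2[OF finite_balls]) (auto simp: level_le_iff)
    also have "\<dots> \<le> D * real (2 ^ (k + i + 1) + 1) powr d * R"
      unfolding R_def by (rule c_ball_l1)
    also have "\<dots> \<le> D * (4 * real N * 2 ^ i) powr d * R"
    proof (intro mult_right_mono mult_left_mono powr_mono2)
      have "1 \<le> (2::real) ^ (k + i + 1)" by (rule one_le_power) simp
      then show "real (2 ^ (k + i + 1) + 1) \<le> 4 * real N * 2 ^ i" by (simp add: power_add) (simp add: mult_ac)
    qed (use D_ge_1 d_nonneg in \<open>auto simp: R_def\<close>)
    also have "\<dots> = ?D * 2 powr (d * real i)"
      by (simp add: powr_mult powr_powr mult.commute powr_realpow[symmetric])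
    finally have "e i * ?s i
        \<le> 2 powr - (\<gamma> * real i) * (?D * 2 powr (d * real i))"
      by (intro mult_mono e_decay) (auto intro: sum_nonneg)
    also have "\<dots> = ?D * (2 powr - (\<gamma> * real i) * 2 powr (d * real i))" by simp
    also have "2 powr - (\<gamma> * real i) * 2 powr (d * real i) = q ^ i"
      unfolding q_def by (simp add: powr_realpow[symmetric] powr_powr powr_add[symmetric] left_diff_distrib)
    finally show "e i * ?s i \<le> ?D * q ^ i" .
  qed
  also have "\<dots> = ?D * (\<Sum>i<I. q ^ i)" by (simp add: sum_distrib_left)
  also have "\<dots> \<le> ?D * (1 / (1 - q))"
    by (intro mult_left_mono sum_power_less_1 q) (use D_ge_1 in \<open>auto simp: R_def\<close>)
  finally show "(\<Sum>z\<in>Z. e (level m z) * norm (c z))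
      \<le> (D * (4 * real N) powr d * (a * M / w m) powr (1 / p)) * (1 / (1 - 2 powr (d - \<gamma>)))"
    unfolding R_def q_def .
qed

text \<open>
  Qualitative: bound \<open>b\<close> by local sums of \<open>\<bar>c\<bar>\<close> and use that each point lies in boundedly many
  balls of the net. A bound that is uniform in \<open>m\<close> cannot be expected here, because \<open>b m\<close> may
  a priori grow with the distance from \<open>y\<close>.
\<close>
lemma kernel_b_summable:
  assumes S: "is_net S"
  shows "(\<lambda>m'. e (level m m') * b m') summable_on S"
proof -
  obtain K where K: "\<And>Z. finite Z \<Longrightarrow> (\<Sum>z\<in>Z. e (level m z) * norm (c z)) \<le> K"
    using kernel_c_bounded by blast
  define C where "C = 2 powr ((\<gamma> + 1) * 2)"
  let ?f = "\<lambda>z. C * (e (level m z) * norm (c z))"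
  define K' where "K' = P * real (2 + 1) powr dt"
  have bd: "(\<Sum>m'\<in>L. e (level m m') * b m') \<le> C * K' * K" if L: "finite L" "L \<subseteq> S" for L
  proof -
    define Z where "Z = (\<Union>m'\<in>L. B m' (2 * N))"
    have fZ: "finite Z" unfolding Z_def using L finite_balls by blast
    have "(\<Sum>m'\<in>L. e (level m m') * b m') \<le> (\<Sum>m'\<in>L. \<Sum>z\<in>Z. if \<rho> m' z \<le> 2 * N then ?f z else 0)"
    proof (rule sum_mono)
      fix m' assume m': "m' \<in> L"
      have "e (level m m') * b m' \<le> e (level m m') * (\<Sum>z\<in>B m' (2 * N). norm (c z))"
        by (intro mult_left_mono b_le_l1 e_nonneg)
      also have "\<dots> = (\<Sum>z\<in>B m' (2 * N). e (level m m') * norm (c z))" by (simp add: sum_distrib_left)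
      also have "\<dots> \<le> (\<Sum>z\<in>B m' (2 * N). ?f z)"
      proof (rule sum_mono)
        fix z assume z: "z \<in> B m' (2 * N)"
        have "level m' z \<le> 1" by (rule level_le_small[of _ _ 2]) (use z in auto)
        then have "level m z \<le> level m m' + 2" using level_triangle[of m z m'] by linarith
        then have "e (level m m') \<le> C * e (level m z)" unfolding C_def using e_shift[of _ _ 2] by simp
        then show "e (level m m') * norm (c z) \<le> ?f z"
          by (simp add: mult_right_mono mult.assoc[symmetric])
      qed
      also have "\<dots> = (\<Sum>z\<in>Z \<inter> B m' (2 * N). ?f z)"
        by (rule sum.cong) (use m' in \<open>auto simp: Z_def\<close>)
      also have "\<dots> = (\<Sum>z\<in>Z. if \<rho> m' z \<le> 2 * N then ?f z else 0)"
        by (simp add: sum.inter_restrict[OF fZ])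
      finally show "e (level m m') * b m' \<le> \<dots>" .
    qed
    also have "\<dots> = (\<Sum>z\<in>Z. \<Sum>m'\<in>L. if \<rho> m' z \<le> 2 * N then ?f z else 0)"
      by (rule sum.swap)
    also have "\<dots> = (\<Sum>z\<in>Z. real (card {m' \<in> L. \<rho> m' z \<le> 2 * N}) * (?f z))"
      by (simp add: sum.inter_filter[OF L(1), symmetric])
    also have "\<dots> \<le> (\<Sum>z\<in>Z. K' * (?f z))"
    proof (intro sum_mono mult_right_mono)
      fix z
      show "real (card {m' \<in> L. \<rho> m' z \<le> 2 * N}) \<le> K'"
        unfolding K'_def by (rule net_count[OF S, of _ z]) (use L in \<open>auto simp: rho_sym[of z] intro: order_trans\<close>)
    qed (auto simp: C_def e_nonneg)
    also have "\<dots> = C * K' * (\<Sum>z\<in>Z. e (level m z) * norm (c z))" by (simp add: sum_distrib_left mult_ac)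
    also have "\<dots> \<le> C * K' * K"
      by (intro mult_left_mono K fZ) (use P_ge_1 in \<open>auto simp: C_def K'_def\<close>)
    finally show ?thesis .
  qed
  show ?thesis
    by (rule nonneg_bdd_above_summable_on) (use bd e_nonneg b_nonneg in \<open>auto intro!: bdd_aboveI2\<close>)
qed

definition X :: "'v set \<Rightarrow> 'v \<Rightarrow> real" where
  "X S m = (\<Sum>\<^sub>\<infinity>m'\<in>S. e (level m m') * b m')"

lemma partial_sum_le_X:
  assumes "is_net S" "finite L" "L \<subseteq> S"
  shows "(\<Sum>m'\<in>L. e (level m m') * b m') \<le> X S m"
  unfolding X_def
  by (rule finite_sum_le_infsum[OF kernel_b_summable]) (use assms e_nonneg b_nonneg in auto)

lemma X_nonneg: "0 \<le> X S m"
  unfolding X_def by (rule infsum_nonneg) (use e_nonneg b_nonneg in auto)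

definition cutoff :: "'v \<Rightarrow> 'v \<Rightarrow> real" where
  "cutoff m x = max 0 (min 1 (2 - real (\<rho> m x) / (2 * real N)))"

lemma cutoff_bounds: "0 \<le> cutoff m x" "cutoff m x \<le> 1"
  unfolding cutoff_def by auto

lemma cutoff_eq_1: "\<rho> m x \<le> 2 * N \<Longrightarrow> cutoff m x = 1"
proof -
  assume "\<rho> m x \<le> 2 * N"
  then have "real (\<rho> m x) \<le> 2 * real N" using of_nat_mono by fastforce
  then have "real (\<rho> m x) / (2 * real N) \<le> 1" by (simp add: divide_le_eq)
  then show ?thesis unfolding cutoff_def by simp
qed

lemma cutoff_eq_0: "4 * N \<le> \<rho> m x \<Longrightarrow> cutoff m x = 0"
proof -
  assume "4 * N \<le> \<rho> m x"
  then have "4 * real N \<le> real (\<rho> m x)" using of_nat_mono by fastforce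
  then have "2 \<le> real (\<rho> m x) / (2 * real N)" by (simp add: le_divide_eq)
  then show ?thesis unfolding cutoff_def by simp
qed

lemma cutoff_lipschitz:
  "\<bar>cutoff m z - cutoff m x\<bar> \<le> min 1 (2 ^ (lev (\<rho> x z) + 1) / 2 ^ k)"
proof -
  have "\<bar>cutoff m z - cutoff m x\<bar> \<le> \<bar>real (\<rho> m z) / (2 * real N) - real (\<rho> m x) / (2 * real N)\<bar>"
    unfolding cutoff_def by linarith
  also have "\<dots> = \<bar>real (\<rho> m z) - real (\<rho> m x)\<bar> / (2 * real N)"
    by (simp add: diff_divide_distrib[symmetric])
  also have "\<dots> \<le> 2 ^ (lev (\<rho> x z) + 1) / real N"
  proof (rule frac_le)
    have "real (\<rho> m z) \<le> real (\<rho> m x) + real (\<rho> x z)" "real (\<rho> m x) \<le> real (\<rho> m z) + real (\<rho> x z)"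
      using rho_triangle[of m z x] rho_triangle[of m x z] rho_sym[of x z] by linarith+
    moreover have "real (\<rho> x z) \<le> 2 ^ (lev (\<rho> x z) + 1)"
      using less_two_pow_lev[of "\<rho> x z"] by (metis Suc_eq_plus1 Suc_lessD less_imp_le of_nat_le_iff of_nat_numeral of_nat_power)
    ultimately show "\<bar>real (\<rho> m z) - real (\<rho> m x)\<bar> \<le> 2 ^ (lev (\<rho> x z) + 1)" by linarith
  qed auto
  finally show ?thesis using cutoff_bounds[of m x] cutoff_bounds[of m z] by (auto simp: abs_if)
qed

text \<open>
  The part of the commutator that sees \<open>c\<close> at distance more than \<open>8 N\<close> from \<open>m\<close>: each such \<open>z\<close>
  is assigned to a point of the net, the entry of \<open>A\<close> is bounded through the profile \<open>v\<close>,
  which is essentially constant on the balls of the net, and the sum of \<open>\<bar>c\<bar>\<close> over such a ball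
  through \<open>b\<close>.
\<close>
lemma far_part_le:
  assumes S: "is_net S" and x: "\<rho> m x \<le> 4 * N"
  shows "norm (\<Sum>\<^sub>\<infinity>z\<in>- B m (8 * N). A x z * c z)
    \<le> C_far \<gamma> * a powr (1 / p) * H * real N powr (d - \<gamma>) * X S m"
proof -
  let ?D = "D * 5 powr d * real N powr d * a powr (1 / p)"
  let ?V = "C_far \<gamma> * a powr (1 / p) * H * real N powr (d - \<gamma>) * X S m"
  define R where "R = 2 powr ((\<gamma> + 1) * real 3) * (H * (2 ^ k) powr - \<gamma>)"
  have R0: "0 \<le> R" unfolding R_def using H_nonneg by simp
  define near where "near z = (SOME m'. m' \<in> S \<and> \<rho> z m' \<le> 2 * N)" for z
  have near: "near z \<in> S" "\<rho> z (near z) \<le> 2 * N" for z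
  proof -
    have "\<exists>m'. m' \<in> S \<and> \<rho> z m' \<le> 2 * N" using S unfolding is_net_def by auto
    from someI_ex[OF this] show "near z \<in> S" "\<rho> z (near z) \<le> 2 * N"
      unfolding near_def by auto
  qed
  have fin: "(\<Sum>z\<in>Z. norm (A x z * c z)) \<le> ?V"
    if Z: "finite Z" "Z \<subseteq> - B m (8 * N)" for Z
  proof -
    define L where "L = near ` Z"
    have L: "finite L" "L \<subseteq> S" unfolding L_def using Z near by auto
    have pt: "norm (A x z * c z) \<le> R * e (level m (near z)) * norm (c z)" if z: "z \<in> Z" for z
    proof -
      have "8 * N < \<rho> m z" using z Z(2) by auto
      then have "N + 1 \<le> \<rho> x z + 1" using rho_triangle[of m z x] x by linarith
      then have "k \<le> lev (\<rho> x z)" by (simp add: le_lev_iff)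
      then have kl: "lev (\<rho> x z) = k + level x z" unfolding level_def by simp
      have "level m x \<le> 2" by (rule level_le_small[of _ _ 4]) (use x in auto)
      moreover have "level z (near z) \<le> 1" by (rule level_le_small[of _ _ 2]) (use near in auto)
      ultimately have lv: "level m (near z) \<le> level x z + 3"
        using level_triangle[of m "near z" x] level_triangle[of x "near z" z] by linarith
      have "norm (A x z) \<le> s (k + level x z)" using A_decay[of x z] kl by simp
      also have "\<dots> \<le> H * (2 ^ k) powr - \<gamma> * v (level x z)" by (rule s_tail)
      also have "\<dots> \<le> H * (2 ^ k) powr - \<gamma> * (2 powr ((\<gamma> + 1) * real 3) * e (level m (near z)))"
        using v_le_e[of "level x z"] e_shift[OF lv] H_nonneg by (intro mult_left_mono) auto
      finally show ?thesis unfolding R_def norm_mult by (intro mult_right_mono) (simp_all add: mult_ac)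
    qed
    have "(\<Sum>z\<in>Z. norm (A x z * c z)) \<le> (\<Sum>z\<in>Z. R * e (level m (near z)) * norm (c z))"
      by (intro sum_mono pt)
    also have "\<dots> = (\<Sum>m'\<in>L. \<Sum>z | z \<in> Z \<and> near z = m'. R * e (level m (near z)) * norm (c z))"
      unfolding L_def by (rule sum.image_gen[OF Z(1)])
    also have "\<dots> \<le> (\<Sum>m'\<in>L. R * e (level m m') * (?D * b m'))"
    proof (rule sum_mono)
      fix m' assume "m' \<in> L"
      have "(\<Sum>z | z \<in> Z \<and> near z = m'. R * e (level m (near z)) * norm (c z))
          = R * e (level m m') * (\<Sum>z | z \<in> Z \<and> near z = m'. norm (c z))"
        by (simp add: sum_distrib_left)
      also have "\<dots> \<le> R * e (level m m') * (\<Sum>z\<in>B m' (2 * N). norm (c z))"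
        by (intro mult_left_mono sum_mono2 finite_balls) (use R0 e_nonneg near in \<open>auto simp: rho_sym[of m']\<close>)
      also have "\<dots> \<le> R * e (level m m') * (?D * b m')"
        using order_trans[OF ball_l1_le mult_right_mono[OF mult_right_mono[OF card_ball_le]]] R0 e_nonneg b_nonneg
        by (intro mult_left_mono) auto
      finally show "(\<Sum>z | z \<in> Z \<and> near z = m'. R * e (level m (near z)) * norm (c z)) \<le> \<dots>" .
    qed
    also have "\<dots> = R * (?D) * (\<Sum>m'\<in>L. e (level m m') * b m')"
      by (simp add: sum_distrib_left mult_ac)
    also have "\<dots> \<le> R * (?D) * X S m"
      using R0 D_ge_1 by (intro mult_left_mono partial_sum_le_X[OF S L]) auto
    also have "\<dots> = 2 powr (3 * (\<gamma> + 1)) * (D * 5 powr d) * a powr (1 / p) * H * ((2 ^ k) powr - \<gamma> * real N powr d) * X S m"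
      unfolding R_def by (simp add: mult_ac)
    also have "(2 ^ k) powr - \<gamma> * real N powr d = real N powr (d - \<gamma>)"
      by (simp add: powr_add[symmetric])
    finally show ?thesis unfolding C_far_def .
  qed
  have sm: "(\<lambda>z. norm (A x z * c z)) summable_on - B m (8 * N)"
    using c_summable[of x] summable_on_subset_banach[of "\<lambda>z. A x z * c z" UNIV "- B m (8 * N)"]
    by (simp add: summable_on_iff_abs_summable_on_complex)
  have "norm (\<Sum>\<^sub>\<infinity>z\<in>- B m (8 * N). A x z * c z) \<le> (\<Sum>\<^sub>\<infinity>z\<in>- B m (8 * N). norm (A x z * c z))"
    by (rule norm_infsum_bound[OF sm])
  also have "\<dots> \<le> ?V"
    by (rule infsum_le_finite_sums[OF sm fin])
  finally show ?thesis .
qed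

text \<open>
  The part of the commutator that sees \<open>c\<close> within distance \<open>8 N\<close> of \<open>m\<close> is estimated in
  operator norm. One factor \<open>a powr (1 / p)\<close> comes from that norm, another one from comparing
  the weights of the balls of the net that cover the ball of radius \<open>8 N\<close> with \<open>W m\<close>.
\<close>
lemma near_part_le:
  assumes S: "is_net S" and X: "finite X'"
  shows "(\<Sum>x\<in>X'. w x * (\<Sum>z\<in>B m (8 * N). (s (lev (\<rho> x z)) * min 1 (2 ^ (lev (\<rho> x z) + 1) / 2 ^ k)) * norm (c z)) powr p)
    \<le> W m * (C_near \<gamma> * a powr (2 / p) * \<omega> * X S m) powr p"
proof -
  let ?p = "\<lambda>z. norm (c z) powr p * w z"
  let ?k = "\<lambda>n. real (card (B m n))"
  let ?c = "2 powr (3 * (\<gamma> + 1))"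
  define C where "C = P * 9 powr dt * D powr p"
  have C0: "0 \<le> C" unfolding C_def using P_ge_1 by simp
  have w0: "0 \<le> \<omega>" using commutator_sum[of 0] by simp
  define L where "L = {m' \<in> S. \<rho> m m' \<le> 10 * N}"
  have L: "finite L" "L \<subseteq> S"
    unfolding L_def using finite_subset[OF _ finite_balls[of m "10 * N"]] by auto
  \<comment> \<open>Two doublings lead from the ball of radius \<open>4 N\<close> to one that contains all balls of the cover.\<close>
  have Wm': "W m' \<le> a * (Q ^ 2) powr p * W m" if m': "m' \<in> L" for m'
  proof -
    have sub: "B m' (4 * N) \<subseteq> B m (16 * N)"
    proof
      fix z assume "z \<in> B m' (4 * N)"
      then show "z \<in> B m (16 * N)" using rho_triangle[of m z m'] m' unfolding L_def by auto
    qed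
    have "B m (4 * N) \<subseteq> B m (16 * N)" by auto
    from weight_subset[OF weight this]
    have 1: "?k (4 * N) powr p * sum w (B m (16 * N)) \<le> a * ?k (16 * N) powr p * W m"
      unfolding W_def .
    have "?k (16 * N) \<le> Q * ?k (8 * N)" using doubling_balls[of m "8 * N"] by simp
    also have "\<dots> \<le> Q * (Q * ?k (4 * N))" using doubling_balls[of m "4 * N"] Q_ge_1 by simp
    finally have 2: "?k (16 * N) \<le> Q ^ 2 * ?k (4 * N)" by (simp add: power2_eq_square)
    have cp: "0 < ?k (4 * N)" using card_ball_pos by simp
    have "?k (4 * N) powr p * sum w (B m (16 * N))
        \<le> a * (Q ^ 2 * ?k (4 * N)) powr p * W m"
      using 1 2 p_pos a_ge_1 W_pos[of m] by (elim order_trans) (intro mult_right_mono mult_left_mono powr_mono2, auto)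
    also have "\<dots> = ?k (4 * N) powr p * (a * (Q ^ 2) powr p * W m)"
      using Q_ge_1 by (simp add: powr_mult mult_ac)
    finally have "sum w (B m (16 * N)) \<le> a * (Q ^ 2) powr p * W m"
      using cp by simp
    moreover have "W m' \<le> sum w (B m (16 * N))"
      unfolding W_def by (rule sum_mono2[OF finite_balls sub]) (rule w_nonneg)
    ultimately show ?thesis by linarith
  qed
  have cov: "(\<Sum>z\<in>B m (8 * N). ?p z) \<le> (\<Sum>m'\<in>L. b m' powr p * W m')"
  proof -
    have "(\<Sum>z\<in>B m (8 * N). ?p z) \<le> (\<Sum>z\<in>(\<Union>m'\<in>L. B m' (2 * N)). ?p z)"
    proof (rule sum_mono2)
      show "B m (8 * N) \<subseteq> (\<Union>m'\<in>L. B m' (2 * N))"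
      proof
        fix z assume z: "z \<in> B m (8 * N)"
        obtain m' where m': "m' \<in> S" "\<rho> z m' \<le> 2 * N" using S unfolding is_net_def by blast
        then have "m' \<in> L" using rho_triangle[of m m' z] z unfolding L_def by auto
        then show "z \<in> (\<Union>m'\<in>L. B m' (2 * N))" using m' rho_sym by auto
      qed
    qed (use L finite_balls w_nonneg in auto)
    also have "\<dots> \<le> (\<Sum>m'\<in>L. \<Sum>z\<in>B m' (2 * N). ?p z)"
      by (rule sum_Union_le[OF L(1) finite_balls]) (use w_nonneg in auto)
    finally show ?thesis by (simp add: b_powr)
  qed
  have sb: "(\<Sum>m'\<in>L. b m') \<le> ?c * X S m"
  proof -
    have "(\<Sum>m'\<in>L. b m') \<le> (\<Sum>m'\<in>L. ?c * (e (level m m') * b m'))"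
    proof (rule sum_mono)
      fix m' assume "m' \<in> L"
      then have "level m m' \<le> 3" unfolding L_def by (intro level_le_small[of _ _ 10]) auto
      then have "e 0 \<le> 2 powr ((\<gamma> + 1) * real 3) * e (level m m')" by (intro e_shift) simp
      then have "1 * b m' \<le> (?c * e (level m m')) * b m'"
        by (intro mult_right_mono b_nonneg) (simp add: mult.commute)
      then show "b m' \<le> ?c * (e (level m m') * b m')" by simp
    qed
    also have "\<dots> \<le> ?c * X S m"
      unfolding sum_distrib_left[symmetric] by (intro mult_left_mono partial_sum_le_X[OF S L]) simp
    finally show ?thesis .
  qed
  have "(\<Sum>m'\<in>L. b m' powr p * W m') \<le> (\<Sum>m'\<in>L. b m' powr p) * (a * (Q ^ 2) powr p * W m)"
    unfolding sum_distrib_right by (intro sum_mono mult_left_mono Wm') auto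
  also have "\<dots> \<le> (?c * X S m) powr p * (a * (Q ^ 2) powr p * W m)"
  proof (rule mult_right_mono)
    have "(\<Sum>m'\<in>L. b m' powr p) \<le> (\<Sum>m'\<in>L. b m') powr p"
      by (rule sum_powr_le_powr_sum[OF L(1) p_ge_1 b_nonneg])
    also have "\<dots> \<le> (?c * X S m) powr p"
      by (rule powr_mono2[OF _ _ sb]) (use p_pos b_nonneg in \<open>auto intro: sum_nonneg\<close>)
    finally show "(\<Sum>m'\<in>L. b m' powr p) \<le> (?c * X S m) powr p" .
  qed (use a_ge_1 W_pos[of m] in auto)
  finally have sumc: "(\<Sum>z\<in>B m (8 * N). ?p z)
      \<le> (?c * X S m) powr p * (a * (Q ^ 2) powr p * W m)"
    using cov by linarith
  have "(\<Sum>x\<in>X'. w x * (\<Sum>z\<in>B m (8 * N). (s (lev (\<rho> x z)) * min 1 (2 ^ (lev (\<rho> x z) + 1) / 2 ^ k)) * norm (c z)) powr p)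
      \<le> a * C * \<omega> powr p * (\<Sum>z\<in>B m (8 * N). ?p z)"
    unfolding C_def
    by (rule weighted_kernel_bound[OF weight X finite_balls, where t = "\<lambda>j. s j * min 1 (2 ^ (j + 1) / 2 ^ k)"])
      (use s_nonneg commutator_sum in auto)
  also have "\<dots> \<le> a * C * \<omega> powr p * ((?c * X S m) powr p * (a * (Q ^ 2) powr p * W m))"
    by (rule mult_left_mono[OF sumc]) (use a_ge_1 C0 in auto)
  also have "\<dots> = W m * (C_near \<gamma> * a powr (2 / p) * \<omega> * X S m) powr p"
  proof -
    have "(a powr (2 / p)) powr p = a * a"
    proof -
      have "2 / p * p = 2" using p_pos by simp
      then have "(a powr (2 / p)) powr p = a powr 2" unfolding powr_powr by (simp only:)
      then show ?thesis using a_ge_1 by (simp add: power2_eq_square)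
    qed
    then show ?thesis
      unfolding C_near_def C_def[symmetric] using C0 w0 X_nonneg[of S m] root_powr[OF C0]
      by (simp add: powr_mult mult_ac)
  qed
  finally show ?thesis .
qed

text \<open>
  Apply the lower bound for \<open>A\<close> to the cut-off column and split \<open>A (\<psi> c)\<close> into source, near
  part and far part of the commutator.
\<close>
lemma local_estimate:
  assumes S: "is_net S"
  shows "b m \<le> 3 * \<beta> * of_bool (\<rho> m y \<le> 4 * N)
    + 3 * \<beta> * (C_near \<gamma> * a powr (2 / p) * \<omega> + C_far \<gamma> * a powr (1 / p) * H * real N powr (d - \<gamma>)) * X S m"
proof -
  let ?\<chi> = "\<lambda>x. of_bool (\<rho> m x \<le> 4 * N) :: real"
  let ?d = "\<lambda>x z. of_real (cutoff m z - cutoff m x) * (A x z * c z)"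
  define f where "f z = of_real (cutoff m z) * c z" for z
  define F where "F = B m (8 * N)"
  have fF: "finite F" unfolding F_def by (rule finite_balls)
  let ?n = "\<lambda>x. norm (\<Sum>z\<in>F. A x z * f z)"
  let ?t = "\<lambda>x. \<Sum>\<^sub>\<infinity>z\<in>- F. A x z * c z"
  define I where "I = (of_bool (\<rho> m y \<le> 4 * N) :: real)"
  define U where "U = C_near \<gamma> * a powr (2 / p) * \<omega> * X S m"
  define V where "V = C_far \<gamma> * a powr (1 / p) * H * real N powr (d - \<gamma>) * X S m"
  define T where "T x = (\<Sum>z\<in>F. (s (lev (\<rho> x z)) * min 1 (2 ^ (lev (\<rho> x z) + 1) / 2 ^ k)) * norm (c z))" for x
  have w0: "0 \<le> \<omega>" using commutator_sum[of 0] by simp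
  have U0: "0 \<le> U" unfolding U_def C_near_def using w0 X_nonneg P_ge_1 by simp
  have V0: "0 \<le> V" unfolding V_def C_far_def using H_nonneg X_nonneg D_ge_1 by simp
  have T0: "0 \<le> T x" for x unfolding T_def by (intro sum_nonneg) (use s_nonneg in auto)
  have I0: "0 \<le> I" unfolding I_def by simp
  have Af: "?n x
      \<le> of_bool (x = y) * I + T x + ?\<chi> x * V" for x
  proof -
    have split: "of_bool (x = y) = (\<Sum>z\<in>F. A x z * c z) + (?t x)"
    proof -
      have sub: "(\<lambda>z. A x z * c z) summable_on Z" for Z
        using c_summable[of x] summable_on_subset_banach by blast
      have "(\<Sum>\<^sub>\<infinity>z\<in>F \<union> - F. A x z * c z) = (\<Sum>\<^sub>\<infinity>z\<in>F. A x z * c z) + (?t x)"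
        by (rule infsum_Un_disjoint[OF sub sub]) auto
      then show ?thesis using A_c[of x] fF by simp
    qed
    \<comment> \<open>\<open>A (\<psi> c) = \<psi> A c + [A, \<psi>] c\<close>; on \<open>- F\<close> the cutoff vanishes, so that the commutator is \<open>- \<psi> A c\<close> there.\<close>
    have eq: "(\<Sum>z\<in>F. A x z * f z) = of_real (cutoff m x) * of_bool (x = y)
        + (\<Sum>z\<in>F. ?d x z)
        - of_real (cutoff m x) * (?t x)"
      unfolding split f_def by (simp add: algebra_simps sum_subtractf sum_distrib_left)
    have n1: "norm (of_real (cutoff m x) * of_bool (x = y) :: complex) \<le> of_bool (x = y) * I"
      using cutoff_bounds[of m x] cutoff_eq_0[of m x] unfolding I_def by (auto simp: not_le)
    have n2: "norm (\<Sum>z\<in>F. ?d x z) \<le> T x"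
      unfolding T_def
    proof (rule sum_norm_le)
      fix z
      have "norm (?d x z)
          = norm (A x z) * \<bar>cutoff m z - cutoff m x\<bar> * norm (c z)"
        unfolding norm_mult norm_of_real by simp
      also have "\<dots> \<le> s (lev (\<rho> x z)) * min 1 (2 ^ (lev (\<rho> x z) + 1) / 2 ^ k) * norm (c z)"
        by (intro mult_right_mono mult_mono A_decay cutoff_lipschitz) (use s_nonneg in auto)
      finally show "norm (?d x z) \<le> \<dots>" .
    qed
    have n3: "norm (of_real (cutoff m x) * (?t x)) \<le> ?\<chi> x * V"
    proof (cases "\<rho> m x \<le> 4 * N")
      case True
      have "cutoff m x * norm (?t x) \<le> 1 * V"
        unfolding V_def F_def by (intro mult_mono far_part_le[OF S True]) (use cutoff_bounds in auto)
      then show ?thesis using True cutoff_bounds[of m x] by (simp add: norm_mult)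
    qed (use cutoff_eq_0 in auto)
    show ?thesis
      unfolding eq
      using norm_triangle_ineq4[of "of_real (cutoff m x) * of_bool (x = y) + (\<Sum>z\<in>F. ?d x z)" "of_real (cutoff m x) * (?t x)"]
        norm_triangle_ineq[of "of_real (cutoff m x) * of_bool (x = y)" "\<Sum>z\<in>F. ?d x z"]
        n1 n2 n3 by linarith
  qed
  have tot: "(\<Sum>x\<in>X'. ?n x powr p * w x) \<le> 3 powr p * (W m * (I + U + V) powr p)"
    if X': "finite X'" for X'
  proof -
    have "(\<Sum>x\<in>X'. ?n x powr p * w x)
      \<le> (\<Sum>x\<in>X'. 3 powr p * (of_bool (x = y) * (I * w x) + w x * T x powr p + ?\<chi> x * w x * V powr p))"
    proof (rule sum_mono)
      fix x
      have "?n x powr p \<le> (of_bool (x = y) * I + T x + ?\<chi> x * V) powr p"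
        by (rule powr_mono2[OF _ _ Af]) (use p_pos in auto)
      also have "\<dots> \<le> 3 powr p * ((of_bool (x = y) * I) powr p + T x powr p + (?\<chi> x * V) powr p)"
        by (rule add3_powr_le[OF p_ge_1]) (use I0 T0 V0 in auto)
      also have "\<dots> = 3 powr p * (of_bool (x = y) * I + T x powr p + ?\<chi> x * V powr p)"
        unfolding I_def by (auto simp: of_bool_def)
      finally have "?n x powr p * w x
          \<le> 3 powr p * (of_bool (x = y) * I + T x powr p + ?\<chi> x * V powr p) * w x"
        by (rule mult_right_mono[OF _ w_nonneg])
      then show "?n x powr p * w x \<le> 3 powr p * (of_bool (x = y) * (I * w x) + w x * T x powr p + ?\<chi> x * w x * V powr p)"
        by (simp add: algebra_simps)
    qed
    also have "\<dots> = 3 powr p * ((\<Sum>x\<in>X'. of_bool (x = y) * (I * w x)) + (\<Sum>x\<in>X'. w x * T x powr p)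
        + (\<Sum>x\<in>X'. ?\<chi> x * w x) * V powr p)"
      unfolding sum_distrib_left[symmetric] sum.distrib sum_distrib_right ..
    also have "\<dots> \<le> 3 powr p * (W m * I + W m * U powr p + W m * V powr p)"
    proof (intro mult_left_mono add_mono mult_right_mono)
      have "(\<Sum>x\<in>X'. of_bool (x = y) * (I * w x)) = (\<Sum>x\<in>X'. if x = y then I * w x else 0)"
        by (rule sum.cong) auto
      also have "\<dots> \<le> I * w y" using X' I0 w_nonneg by (simp add: sum.delta)
      also have "\<dots> \<le> W m * I" unfolding I_def using w_le_W[of m y] by simp
      finally show "(\<Sum>x\<in>X'. of_bool (x = y) * (I * w x)) \<le> W m * I" .
      show "(\<Sum>x\<in>X'. w x * T x powr p) \<le> W m * U powr p"
        unfolding T_def F_def U_def by (rule near_part_le[OF S X'])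
      have "(\<Sum>x\<in>X'. ?\<chi> x * w x) = (\<Sum>x\<in>X'. if x \<in> B m (4 * N) then w x else 0)"
        by (rule sum.cong) auto
      also have "\<dots> = (\<Sum>x\<in>X' \<inter> B m (4 * N). w x)"
        by (rule sum.inter_restrict[OF X', symmetric])
      also have "\<dots> \<le> W m" unfolding W_def
        by (intro sum_mono2 finite_balls) (use w_nonneg in auto)
      finally show "(\<Sum>x\<in>X'. ?\<chi> x * w x) \<le> W m" .
    qed auto
    also have "\<dots> = 3 powr p * (W m * (I powr p + U powr p + V powr p))"
      unfolding I_def by (simp add: algebra_simps of_bool_def)
    also have "\<dots> \<le> 3 powr p * (W m * (I + U + V) powr p)"
    proof (intro mult_left_mono)
      have "(\<Sum>i<(3::nat). (if i = 0 then I else if i = 1 then U else V) powr p)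
          \<le> (\<Sum>i<(3::nat). (if i = 0 then I else if i = 1 then U else V)) powr p"
        by (rule sum_powr_le_powr_sum[OF _ p_ge_1]) (use I0 U0 V0 in auto)
      then show "I powr p + U powr p + V powr p \<le> (I + U + V) powr p"
        by (simp add: numeral_3_eq_3)
    qed (use W_pos[of m] in auto)
    finally show ?thesis .
  qed
  have "b m powr p * W m = (\<Sum>z\<in>B m (2 * N). norm (f z) powr p * w z)"
    unfolding b_powr f_def by (rule sum.cong) (auto simp: cutoff_eq_1)
  also have "\<dots> \<le> (\<Sum>z\<in>F. norm (f z) powr p * w z)"
    unfolding F_def by (rule sum_mono2[OF finite_balls]) (use w_nonneg in auto)
  also have "\<dots> \<le> \<beta> powr p * (3 powr p * (W m * (I + U + V) powr p))"
    by (rule lower_bound[OF fF tot])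
  also have "\<dots> = (3 * \<beta> * (I + U + V)) powr p * W m"
    unfolding powr_mult by (simp only: mult_ac)
  finally have "b m powr p \<le> (3 * \<beta> * (I + U + V)) powr p" using W_pos[of m] by simp
  then have "b m \<le> 3 * \<beta> * (I + U + V)"
    by (rule le_of_powr_le_powr[OF _ p_pos]) (use beta_nonneg I0 U0 V0 in simp)
  then show ?thesis unfolding I_def U_def V_def by (simp add: algebra_simps)
qed

text \<open>
  The self-improving inequality bounds the local averages; the entry at \<open>x\<close> is recovered from
  the average over a ball containing \<open>x\<close>, at the price of \<open>(W m / w x) powr (1 / p)\<close>, which
  the averaging inequality bounds by \<open>a powr (1 / p)\<close> times the number of points of the ball.
\<close>
theorem column_decay:
  assumes small: "3 * \<beta> * (C_near \<gamma> * a powr (2 / p) * \<omega> + C_far \<gamma> * a powr (1 / p) * H * real N powr (d - \<gamma>))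
      * (2 * 2 powr (\<gamma> + 1) * C_net \<gamma>) \<le> 1 / 2"
  shows "norm (c x) \<le> C_entry \<gamma> * a powr (1 / p) * \<beta> * real N powr d * e (level x y)"
proof -
  let ?e = "2 powr (2 * (\<gamma> + 1)) * e (level x y)"
  let ?c = "6 * (5 powr dt * P * 2 powr (3 * (\<gamma> + 1))) * \<beta>"
  obtain S where S: "is_net S" using is_net_exists by blast
  then obtain m where m: "m \<in> S" "\<rho> x m \<le> 2 * N" unfolding is_net_def by blast
  define \<epsilon> where "\<epsilon> = 3 * \<beta> * (C_near \<gamma> * a powr (2 / p) * \<omega> + C_far \<gamma> * a powr (1 / p) * H * real N powr (d - \<gamma>))"
  have w0: "0 \<le> \<omega>" using commutator_sum[of 0] by simp
  have eps0: "0 \<le> \<epsilon>"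
    unfolding \<epsilon>_def C_near_def C_far_def
    using beta_nonneg w0 H_nonneg P_ge_1 D_ge_1 by (intro mult_nonneg_nonneg add_nonneg_nonneg) auto
  have Xm: "X S m \<le> 2 * (3 * \<beta>) * (5 powr dt * P * 2 powr (3 * (\<gamma> + 1))) * e (level m y)"
    unfolding X_def
    by (rule kernel_inequality_self_improves[where \<epsilon> = \<epsilon>, OF S b_nonneg kernel_b_summable[OF S]])
      (use local_estimate[OF S] beta_nonneg eps0 small m in \<open>auto simp: \<epsilon>_def X_def[symmetric]\<close>)
  have "level m m = 0" unfolding level_def lev_def by simp
  then have bX: "b m \<le> X S m" using partial_sum_le_X[OF S, of "{m}" m] m by simp
  have "level y x \<le> level y m + 2"
  proof -
    have "level m x \<le> 1" by (rule level_le_small[of _ _ 2]) (use m rho_sym in auto)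
    then show ?thesis using level_triangle[of y x m] by linarith
  qed
  then have "level x y \<le> level m y + 2" by (simp add: level_sym[of x] level_sym[of m])
  from e_shift[OF this] have ee: "e (level m y) \<le> ?e" by (simp add: mult.commute)
  have bm: "b m \<le> ?c * (?e)"
  proof -
    have "b m \<le> ?c * e (level m y)"
      using bX Xm by (simp add: mult_ac)
    also have "\<dots> \<le> ?c * (?e)"
      by (rule mult_left_mono[OF ee]) (use beta_nonneg P_ge_1 in auto)
    finally show ?thesis .
  qed
  have "norm (c x) \<le> b m * a powr (1 / p) * real (card (B m (4 * N)))"
  proof (rule le_of_powr_le_powr[OF _ p_pos])
    have xm: "\<rho> m x \<le> 2 * N" using m rho_sym by simp
    have "norm (c x) powr p * w x \<le> (\<Sum>z\<in>B m (2 * N). norm (c z) powr p * w z)"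
      by (rule member_le_sum) (use xm w_nonneg finite_balls in auto)
    also have "\<dots> = b m powr p * W m" by (rule b_powr[symmetric])
    also have "\<dots> \<le> b m powr p * (a * real (card (B m (4 * N))) powr p * w x)"
      using weight_subset[OF weight, of "{x}" m "4 * N"] xm unfolding W_def by (intro mult_left_mono) auto
    finally have "norm (c x) powr p \<le> b m powr p * (a * real (card (B m (4 * N))) powr p)"
      using w_pos[of x] by simp
    also have "\<dots> = (b m * a powr (1 / p) * real (card (B m (4 * N)))) powr p"
      using a_ge_1 b_nonneg by (simp add: powr_mult root_powr)
    finally show "norm (c x) powr p \<le> \<dots>" .
  qed (use b_nonneg in auto)
  also have "\<dots> \<le> (?c * (?e))
      * a powr (1 / p) * (D * 5 powr d * real N powr d)"
    by (intro mult_mono mult_right_mono bm card_ball_le)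
      (use beta_nonneg P_ge_1 e_nonneg in auto)
  also have "\<dots> = C_entry \<gamma> * a powr (1 / p) * \<beta> * real N powr d * e (level x y)"
    unfolding C_entry_def by (simp add: mult_ac)
  finally show ?thesis .
qed

end

section \<open>Beurling norms through dyadic sums\<close>

text \<open>
  The Beurling norm condensed to the levels: for a profile that is constant on levels,
  \<open>(n + 1) powr (\<alpha> r + d - 1)\<close> summed over level \<open>j\<close> is of order \<open>2 powr (\<gamma> r j)\<close> with
  \<open>\<gamma> = \<alpha> + d / r\<close>.
\<close>
definition dyadic_bounded :: "ennreal \<Rightarrow> real \<Rightarrow> (nat \<Rightarrow> real) \<Rightarrow> real \<Rightarrow> bool" where
  "dyadic_bounded r \<gamma> s Z \<longleftrightarrow> 0 \<le> Z \<and>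
     (if r = \<infinity> then \<forall>j. s j * 2 powr (\<gamma> * real j) \<le> Z
      else \<forall>J. (\<Sum>j<J. (s j * 2 powr (\<gamma> * real j)) powr enn2real r) \<le> Z powr enn2real r)"

lemma enn2real_ge_1:
  assumes "1 \<le> r" "r \<noteq> \<infinity>"
  shows "1 \<le> enn2real r"
  using assms by (cases r) (auto simp: ennreal_1[symmetric] simp del: ennreal_1)

lemma recip_eq:
  assumes "1 \<le> r"
  shows "recip r = (if r = \<infinity> then 0 else 1 / enn2real r)"
proof (cases "r = \<infinity>")
  case True
  then show ?thesis by (simp add: recip_def)
next
  case False
  then obtain R where R: "r = ennreal R" "0 \<le> R" by (cases r) auto
  have "1 \<le> R" using enn2real_ge_1[OF assms False] R by simp
  then have "1 / r = ennreal (1 / R)"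
    unfolding R(1) by (simp add: divide_ennreal[symmetric] ennreal_1[symmetric] del: ennreal_1)
  then show ?thesis using False R \<open>1 \<le> R\<close> by (simp add: recip_def)
qed

lemma dyadic_bounded_pointwise:
  assumes b: "dyadic_bounded r \<gamma> s Z" and r: "1 \<le> r"
  shows "s j * 2 powr (\<gamma> * real j) \<le> Z"
proof (cases "r = \<infinity>")
  case False
  note R = enn2real_ge_1[OF r False]
  have "(s j * 2 powr (\<gamma> * real j)) powr enn2real r \<le> (\<Sum>j<Suc j. (s j * 2 powr (\<gamma> * real j)) powr enn2real r)"
    by (rule member_le_sum) auto
  also have "\<dots> \<le> Z powr enn2real r" using b False unfolding dyadic_bounded_def by (simp del: sum.lessThan_Suc)
  finally have le: "(s j * 2 powr (\<gamma> * real j)) powr enn2real r \<le> Z powr enn2real r" .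
  have "0 \<le> Z" using b unfolding dyadic_bounded_def by blast
  then show ?thesis using le_of_powr_le_powr[OF le] R by simp
qed (use b in \<open>auto simp: dyadic_bounded_def\<close>)

text \<open>
  Cauchy condensation for a decreasing \<open>h\<close>. Writing the weight as
  \<open>(n + 1) powr (\<gamma> R) / (n + 1)\<close> avoids a case distinction on the sign of \<open>\<gamma> R - 1\<close>.
\<close>
lemma dyadic_sum_le_power_sum:
  fixes h :: "nat \<Rightarrow> real"
  assumes h: "\<And>n. 0 \<le> h n" and mono: "\<And>m n. m \<le> n \<Longrightarrow> h n \<le> h m" and R: "0 < R" and g: "0 < \<gamma>"
  shows "(\<Sum>j\<le>J. (h (2 ^ j - 1) * 2 powr (\<gamma> * real j)) powr R)
    \<le> 2 * 2 powr (\<gamma> * R) * (\<Sum>n<2 ^ J. h n powr R * real (n + 1) powr (\<gamma> * R - 1))"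
proof (induction J)
  case 0
  have "1 \<le> 2 * 2 powr (\<gamma> * R)"
    using ge_one_powr_ge_zero[of 2 "\<gamma> * R"] R g by simp
  then have "1 * h 0 powr R \<le> 2 * 2 powr (\<gamma> * R) * h 0 powr R" by (rule mult_right_mono) simp
  then show ?case by (simp add: lessThan_Suc)
next
  case (Suc J)
  let ?f = "\<lambda>n. h n powr R * real (n + 1) powr (\<gamma> * R - 1)"
  let ?v = "h (2 ^ Suc J - 1) powr R * 2 powr (\<gamma> * R * real J) / 2 ^ Suc J"
  have split: "(\<Sum>n<2 ^ Suc J. ?f n) = (\<Sum>n<2 ^ J. ?f n) + (\<Sum>n=2 ^ J..<2 ^ Suc J. ?f n)"
    by (simp add: lessThan_atLeast0 sum.atLeastLessThan_concat)
  have "(\<Sum>n=2 ^ J..<(2::nat) ^ Suc J. ?v) \<le> (\<Sum>n=2 ^ J..<2 ^ Suc J. ?f n)"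
  proof (rule sum_mono)
    fix n :: nat assume n: "n \<in> {2 ^ J..<2 ^ Suc J}"
    then have n1: "2 ^ J \<le> n + 1" "n + 1 \<le> 2 ^ Suc J" by auto
    have r1: "(2::real) ^ J \<le> real (n + 1)" "real (n + 1) \<le> 2 ^ Suc J"
      using n1 by (metis of_nat_le_iff of_nat_numeral of_nat_power)+
    have "2 powr (\<gamma> * R * real J) = (2 ^ J) powr (\<gamma> * R)"
      by (simp add: powr_powr mult_ac powr_realpow[symmetric])
    also have "\<dots> \<le> real (n + 1) powr (\<gamma> * R)" by (rule powr_mono2[OF _ _ r1(1)]) (use R g in auto)
    finally have "2 powr (\<gamma> * R * real J) / 2 ^ Suc J \<le> real (n + 1) powr (\<gamma> * R) / real (n + 1)"
      by (intro frac_le r1) auto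
    also have "\<dots> = real (n + 1) powr (\<gamma> * R - 1)" by (simp add: powr_diff)
    finally have p2: "2 powr (\<gamma> * R * real J) / 2 ^ Suc J \<le> real (n + 1) powr (\<gamma> * R - 1)" .
    have "h (2 ^ Suc J - 1) powr R \<le> h n powr R"
      by (rule powr_mono2[OF _ h mono]) (use R n in auto)
    from mult_mono[OF this p2] show "?v \<le> ?f n" by simp
  qed
  moreover have "(\<Sum>n=2 ^ J..<(2::nat) ^ Suc J. ?v) = h (2 ^ Suc J - 1) powr R * 2 powr (\<gamma> * R * real J) / 2"
    by simp
  moreover have "(h (2 ^ Suc J - 1) * 2 powr (\<gamma> * real (Suc J))) powr R
      = 2 * 2 powr (\<gamma> * R) * (h (2 ^ Suc J - 1) powr R * 2 powr (\<gamma> * R * real J) / 2)"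
  proof -
    have "(2 powr (\<gamma> * real (Suc J))) powr R = 2 powr (\<gamma> * R) * 2 powr (\<gamma> * R * real J)"
      by (simp add: powr_powr powr_add[symmetric] algebra_simps)
    then show ?thesis by (simp add: powr_mult)
  qed
  ultimately have "(h (2 ^ Suc J - 1) * 2 powr (\<gamma> * real (Suc J))) powr R
      \<le> 2 * 2 powr (\<gamma> * R) * (\<Sum>n=2 ^ J..<2 ^ Suc J. ?f n)" by simp
  then show ?case using Suc.IH unfolding split distrib_left by simp
qed

lemma power_sum_le_dyadic_sum:
  fixes t :: "nat \<Rightarrow> real"
  assumes R: "0 < R" and g: "0 < \<gamma>"
  shows "(\<Sum>n<2 ^ J - 1. t (lev n) powr R * real (n + 1) powr (\<gamma> * R - 1))
    \<le> 2 powr (\<gamma> * R) * (\<Sum>j<J. (t j * 2 powr (\<gamma> * real j)) powr R)"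
proof (induction J)
  case (Suc J)
  let ?f = "\<lambda>n. t (lev n) powr R * real (n + 1) powr (\<gamma> * R - 1)"
  let ?v = "t J powr R * (2 powr (\<gamma> * R * real (Suc J)) / 2 ^ J)"
  have split: "(\<Sum>n<2 ^ Suc J - 1. ?f n) = (\<Sum>n<2 ^ J - 1. ?f n) + (\<Sum>n=2 ^ J - 1..<2 ^ Suc J - 1. ?f n)"
    by (simp add: lessThan_atLeast0 sum.atLeastLessThan_concat diff_le_mono)
  have "(\<Sum>n=2 ^ J - 1..<2 ^ Suc J - 1. ?f n) \<le> (\<Sum>n=2 ^ J - 1..<(2::nat) ^ Suc J - 1. ?v)"
  proof (rule sum_mono)
    fix n :: nat assume "n \<in> {2 ^ J - 1..<2 ^ Suc J - 1}"
    then have n1: "2 ^ J \<le> n + 1" "n + 1 < 2 ^ Suc J" by auto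
    then have lv: "lev n = J" using le_lev_iff[of J n] lev_less_iff[of n "Suc J"] by linarith
    have r1: "(2::real) ^ J \<le> real (n + 1)" "real (n + 1) \<le> 2 ^ Suc J"
      using n1 less_imp_le by (metis of_nat_le_iff of_nat_numeral of_nat_power)+
    have "real (n + 1) powr (\<gamma> * R) \<le> (2 ^ Suc J) powr (\<gamma> * R)"
      by (rule powr_mono2[OF _ _ r1(2)]) (use R g in auto)
    also have "(2::real) ^ Suc J = 2 powr real (Suc J)" by (rule powr_realpow[symmetric]) simp
    also have "(2 powr real (Suc J)) powr (\<gamma> * R) = 2 powr (\<gamma> * R * real (Suc J))"
      by (simp only: powr_powr mult_ac)
    finally have "real (n + 1) powr (\<gamma> * R) / real (n + 1) \<le> 2 powr (\<gamma> * R * real (Suc J)) / 2 ^ J"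
      by (intro frac_le r1) auto
    then have "real (n + 1) powr (\<gamma> * R - 1) \<le> 2 powr (\<gamma> * R * real (Suc J)) / 2 ^ J"
      by (simp add: powr_diff)
    then show "?f n \<le> ?v" unfolding lv by (intro mult_left_mono) auto
  qed
  also have "\<dots> = t J powr R * 2 powr (\<gamma> * R * real (Suc J))"
  proof -
    have "(2::nat) ^ Suc J - 1 - (2 ^ J - 1) = 2 ^ J" by simp
    then show ?thesis by (simp add: sum_constant)
  qed
  also have "\<dots> = 2 powr (\<gamma> * R) * (t J * 2 powr (\<gamma> * real J)) powr R"
  proof -
    have "2 powr (\<gamma> * R * real (Suc J)) = 2 powr (\<gamma> * R) * (2 powr (\<gamma> * real J)) powr R"
      by (simp add: powr_powr powr_add[symmetric] algebra_simps)
    then show ?thesis by (simp add: powr_mult)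
  qed
  finally show ?case using Suc.IH unfolding split by (simp add: distrib_left)
qed simp

lemma decay_antimono: "m \<le> n \<Longrightarrow> decay E A n \<le> decay E A m"
  unfolding decay_def by (rule SUP_subset_mono) auto

lemma entry_le_decay: "ennreal (norm (A x z)) \<le> decay E A (gdist E x z)"
  unfolding decay_def by (rule SUP_upper2[of "(x, z)"]) auto

lemma epowr_ennreal: "0 \<le> x \<Longrightarrow> epowr (ennreal x) s = ennreal (x powr s)"
  by (simp add: epowr_def)

lemma epowr_mono: "x \<le> y \<Longrightarrow> 0 \<le> s \<Longrightarrow> epowr x s \<le> epowr y s"
  unfolding epowr_def by (auto simp: top_unique intro!: ennreal_leI powr_mono2 enn2real_mono simp: less_top)

lemma norm_imp_dyadic:
  fixes E :: "'v rel"
  assumes r: "1 \<le> r" and fin: "beurling_norm E d r \<alpha> A < \<infinity>"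
    and g: "0 < \<gamma>" "\<gamma> = \<alpha> + d * recip r"
  defines "s \<equiv> \<lambda>j. enn2real (decay E A (2 ^ j - 1))"
  shows "dyadic_bounded r \<gamma> s (2 powr (\<gamma> + 1) * enn2real (beurling_norm E d r \<alpha> A))"
    and "norm (A x z) \<le> s (lev (gdist E x z))"
    and "\<And>i j. i \<le> j \<Longrightarrow> s j \<le> s i"
proof -
  let ?w = "\<lambda>R n. real (n + 1) powr (\<gamma> * R - 1)"
  let ?h = "\<lambda>n. enn2real (decay E A n)"
  define H where "H = enn2real (beurling_norm E d r \<alpha> A)"
  have H: "beurling_norm E d r \<alpha> A = ennreal H" "0 \<le> H" using fin by (auto simp: H_def less_top)
  have pos: "0 < real (n + 1) powr b" for n b by simp
  have "decay E A n < \<infinity> \<and> (r = \<infinity> \<longrightarrow> ?h n * real (n + 1) powr \<alpha> \<le> H)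
    \<and> (r \<noteq> \<infinity> \<longrightarrow> (\<forall>M. (\<Sum>n<M. ?h n powr enn2real r * ?w (enn2real r) n) \<le> H powr enn2real r))" for n
  proof (cases "r = \<infinity>")
    case True
    have le: "decay E A n * ennreal (real (n + 1) powr \<alpha>) \<le> ennreal H"
      using H True unfolding beurling_norm_def by (metis (no_types, lifting) SUP_upper UNIV_I)
    have "decay E A n \<noteq> \<infinity>"
    proof
      assume "decay E A n = \<infinity>"
      then have "decay E A n * ennreal (real (n + 1) powr \<alpha>) = \<infinity>" using pos[of n \<alpha>] by (simp add: ennreal_top_mult)
      then show False using le by (simp add: top_unique)
    qed
    then obtain h where h: "decay E A n = ennreal h" "0 \<le> h" by (cases "decay E A n") auto
    have "h * real (n + 1) powr \<alpha> \<le> H" using le h H by (simp add: ennreal_mult[symmetric])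
    then show ?thesis using h True by simp
  next
    case False
    define R where "R = enn2real r"
    have R: "1 \<le> R" unfolding R_def by (rule enn2real_ge_1[OF r False])
    have ex: "\<alpha> * R + d - 1 = \<gamma> * R - 1"
      using R False recip_eq[OF r] g(2) by (simp add: R_def[symmetric] algebra_simps)
  let ?g = "\<lambda>n. epowr (decay E A n) R * ennreal (?w R n)"
    define T where "T = (\<Sum>n. ?g n)"
    have N: "epowr T (1 / R) = ennreal H"
      using H(1) False unfolding beurling_norm_def T_def R_def[symmetric] ex by simp
    then have "T \<noteq> \<infinity>" by (auto simp: epowr_def)
    then obtain u where u: "T = ennreal u" "0 \<le> u" by (cases T) auto
    have "u powr (1 / R) = H" using N u H by (simp add: epowr_ennreal)
    then have uH: "u = H powr R" using R u by (auto simp: powr_powr)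
    have part: "(\<Sum>n<M. ?g n) \<le> ennreal u" for M
      unfolding u(1)[symmetric] T_def by (rule sum_le_suminf) auto
    have fd: "decay E A n \<noteq> \<infinity>" for n
    proof
      assume "decay E A n = \<infinity>"
      then have "?g n = \<infinity>"
        using pos[of n "\<gamma> * R - 1"] by (simp add: epowr_def ennreal_top_mult)
      moreover have "?g n \<le> ennreal u"
        by (rule order_trans[OF _ part[of "Suc n"]]) (rule member_le_sum, auto)
      ultimately show False by (simp add: top_unique)
    qed
    have eq: "?g n
        = ennreal (?h n powr R * ?w R n)" for n
      using fd[of n] by (simp add: epowr_def ennreal_mult)
    have "(\<Sum>n<M. ?h n powr R * ?w R n) \<le> H powr R" for M
      using part[of M] u(2) unfolding eq uH[symmetric] by (simp add: sum_nonneg)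
    then show ?thesis using False fd[of n] by (auto simp: R_def less_top)
  qed
  note key = this
  have fd: "decay E A n \<noteq> \<infinity>" for n using key[of n] by auto
  have inf: "?h n * real (n + 1) powr \<alpha> \<le> H" if "r = \<infinity>" for n
    using key[of n] that by blast
  have nin: "(\<Sum>n<M. ?h n powr enn2real r * ?w (enn2real r) n) \<le> H powr enn2real r"
    if "r \<noteq> \<infinity>" for M
    using key[of 0] that by blast
  have mono: "?h n \<le> enn2real (decay E A m)" if "m \<le> n" for m n
    using decay_antimono[OF that, of E A] fd[of m] by (intro enn2real_mono) (auto simp: less_top)
  show "s j \<le> s i" if "i \<le> j" for i j
    unfolding s_def using that by (intro mono diff_le_mono power_increasing) auto
  show "norm (A x z) \<le> s (lev (gdist E x z))"
  proof -
    have "ennreal (norm (A x z)) \<le> decay E A (2 ^ lev (gdist E x z) - 1)"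
      by (rule order_trans[OF entry_le_decay decay_antimono]) (use two_pow_lev_le[of "gdist E x z"] in simp)
    then show ?thesis unfolding s_def using fd
      by (metis enn2real_ennreal enn2real_mono infinity_ennreal_def less_top norm_ge_zero)
  qed
  show "dyadic_bounded r \<gamma> s (2 powr (\<gamma> + 1) * enn2real (beurling_norm E d r \<alpha> A))"
  proof (cases "r = \<infinity>")
    case True
    have "s j * 2 powr (\<gamma> * real j) \<le> 2 powr (\<gamma> + 1) * H" for j
    proof -
      have "real (2 ^ j - 1 + 1) powr \<alpha> = 2 powr (\<gamma> * real j)"
        using g(2) True recip_eq[OF r] by (simp add: powr_powr powr_realpow[symmetric] mult.commute)
      then have "s j * 2 powr (\<gamma> * real j) \<le> H" using inf[OF True, of "2 ^ j - 1"] unfolding s_def by simp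
      also have "H \<le> 2 powr (\<gamma> + 1) * H"
        using g(1) H(2) ge_one_powr_ge_zero[of 2 "\<gamma> + 1"] by (simp add: mult_le_cancel_right1)
      finally show ?thesis .
    qed
    then show ?thesis using True H(2) unfolding dyadic_bounded_def H_def by simp
  next
    case False
    define R where "R = enn2real r"
    have R: "1 \<le> R" unfolding R_def by (rule enn2real_ge_1[OF r False])
    have "(\<Sum>j<J. (s j * 2 powr (\<gamma> * real j)) powr R) \<le> (2 powr (\<gamma> + 1) * H) powr R" for J
    proof -
      have "(\<Sum>j<J. (s j * 2 powr (\<gamma> * real j)) powr R) \<le> (\<Sum>j\<le>J. (s j * 2 powr (\<gamma> * real j)) powr R)"
        by (rule sum_mono2) auto
      also have "\<dots> \<le> 2 * 2 powr (\<gamma> * R) * (\<Sum>n<2 ^ J. ?h n powr R * ?w R n)"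
        unfolding s_def by (rule dyadic_sum_le_power_sum) (use mono R g in auto)
      also have "\<dots> \<le> (2 powr R * 2 powr (\<gamma> * R)) * H powr R"
        using nin[OF False, of "2 ^ J"] R powr_mono[of 1 R 2] unfolding R_def[symmetric]
        by (intro mult_mono) (auto intro: sum_nonneg)
      also have "\<dots> = (2 powr (\<gamma> + 1) * H) powr R"
        using H(2) by (simp add: powr_mult powr_powr powr_add[symmetric] distrib_right add.commute)
      finally show ?thesis .
    qed
    then show ?thesis using False H(2) unfolding dyadic_bounded_def H_def R_def by simp
  qed
qed

lemma dyadic_imp_norm:
  fixes E :: "'v rel"
  assumes r: "1 \<le> r" and g: "0 < \<gamma>" "\<gamma> = \<alpha> + d * recip r"
    and t0: "\<And>j. 0 \<le> t j" and mono: "\<And>i j. i \<le> j \<Longrightarrow> t j \<le> t i"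
    and A: "\<And>x z. norm (A x z) \<le> t (lev (gdist E x z))"
    and b: "dyadic_bounded r \<gamma> t Z"
  shows "beurling_norm E d r \<alpha> A \<le> ennreal (2 powr \<gamma> * Z)"
proof -
  have Z: "0 \<le> Z" using b unfolding dyadic_bounded_def by simp
  have dec: "decay E A n \<le> ennreal (t (lev n))" for n
    unfolding decay_def
  proof (rule SUP_least, clarify)
    fix x z assume "n \<le> gdist E x z"
    then show "ennreal (norm (A x z)) \<le> ennreal (t (lev n))"
      by (intro ennreal_leI order_trans[OF A] mono lev_mono)
  qed
  show ?thesis
  proof (cases "r = \<infinity>")
    case True
    have ga: "\<gamma> = \<alpha>" using g(2) True recip_eq[OF r] by simp
    have "decay E A n * ennreal (real (n + 1) powr \<alpha>) \<le> ennreal (2 powr \<gamma> * Z)" for n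
    proof -
      have "real (n + 1) \<le> 2 ^ (lev n + 1)"
        using less_two_pow_lev[of n] less_imp_le by (metis of_nat_le_iff of_nat_numeral of_nat_power)
      then have "real (n + 1) powr \<alpha> \<le> (2 ^ (lev n + 1)) powr \<gamma>"
        unfolding ga using g(1) ga by (intro powr_mono2) auto
      also have "\<dots> = 2 powr \<gamma> * 2 powr (\<gamma> * real (lev n))"
        by (simp add: powr_mult powr_powr powr_realpow[symmetric] mult.commute)
      finally have "t (lev n) * real (n + 1) powr \<alpha> \<le> t (lev n) * (2 powr \<gamma> * 2 powr (\<gamma> * real (lev n)))"
        by (rule mult_left_mono) (rule t0)
      also have "\<dots> \<le> 2 powr \<gamma> * Z"
        using dyadic_bounded_pointwise[OF b r, of "lev n"] by (simp add: mult.left_commute)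
      finally have "ennreal (t (lev n) * real (n + 1) powr \<alpha>) \<le> ennreal (2 powr \<gamma> * Z)" by (rule ennreal_leI)
      moreover have "decay E A n * ennreal (real (n + 1) powr \<alpha>) \<le> ennreal (t (lev n) * real (n + 1) powr \<alpha>)"
        using mult_right_mono[OF dec[of n], of "ennreal (real (n + 1) powr \<alpha>)"] t0 by (simp add: ennreal_mult)
      ultimately show ?thesis by (rule order_trans[rotated])
    qed
    then show ?thesis unfolding beurling_norm_def using True by (simp add: SUP_least)
  next
    case False
    define R where "R = enn2real r"
    have R: "1 \<le> R" unfolding R_def by (rule enn2real_ge_1[OF r False])
    have ex: "\<alpha> * R + d - 1 = \<gamma> * R - 1"
      using R False recip_eq[OF r] g(2) by (simp add: R_def[symmetric] algebra_simps)
    let ?f = "\<lambda>n. t (lev n) powr R * real (n + 1) powr (\<gamma> * R - 1)"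
  let ?g = "\<lambda>n. epowr (decay E A n) R * ennreal (real (n + 1) powr (\<gamma> * R - 1))"
    have part: "(\<Sum>n<M. ?f n) \<le> (2 powr \<gamma> * Z) powr R" for M
    proof -
      have "M \<le> 2 ^ M - 1" using less_exp[of M] by linarith
      then have "(\<Sum>n<M. ?f n) \<le> (\<Sum>n<2 ^ M - 1. ?f n)" by (intro sum_mono2) auto
      also have "\<dots> \<le> 2 powr (\<gamma> * R) * (\<Sum>j<M. (t j * 2 powr (\<gamma> * real j)) powr R)"
        by (rule power_sum_le_dyadic_sum) (use R g in auto)
      also have "\<dots> \<le> 2 powr (\<gamma> * R) * Z powr R"
        using b False unfolding dyadic_bounded_def R_def by (intro mult_left_mono) auto
      also have "\<dots> = (2 powr \<gamma> * Z) powr R" using Z by (simp add: powr_mult powr_powr)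
      finally show ?thesis .
    qed
    have "(\<Sum>n. ?g n) \<le> ennreal ((2 powr \<gamma> * Z) powr R)"
    proof (rule suminf_le_const)
      fix M
      have "(\<Sum>n<M. ?g n) \<le> (\<Sum>n<M. ennreal (?f n))"
      proof (rule sum_mono)
        fix n
        have "epowr (decay E A n) R \<le> ennreal (t (lev n) powr R)"
          using epowr_mono[OF dec[of n], of R] R by (simp add: epowr_ennreal t0)
        from mult_right_mono[OF this, of "ennreal (real (n + 1) powr (\<gamma> * R - 1))"]
        show "?g n \<le> ennreal (?f n)"
          by (simp add: ennreal_mult)
      qed
      also have "\<dots> = ennreal (\<Sum>n<M. ?f n)" by (rule sum_ennreal) auto
      also have "\<dots> \<le> ennreal ((2 powr \<gamma> * Z) powr R)" by (rule ennreal_leI[OF part])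
      finally show "(\<Sum>n<M. ?g n) \<le> ennreal ((2 powr \<gamma> * Z) powr R)" .
    qed simp
    then have "epowr (\<Sum>n. ?g n) (1 / R) \<le> epowr (ennreal ((2 powr \<gamma> * Z) powr R)) (1 / R)"
      using R by (intro epowr_mono) auto
    also have "\<dots> = ennreal (2 powr \<gamma> * Z)"
      using R Z by (simp add: epowr_ennreal powr_powr)
    finally show ?thesis unfolding beurling_norm_def using False by (simp add: R_def[symmetric] ex)
  qed
qed

definition C_env :: "ennreal \<Rightarrow> real \<Rightarrow> real" where
  "C_env r \<gamma> = (if r = \<infinity> then 1 else (4 + 1 / (2 powr (\<gamma> * enn2real r) - 1)) powr (1 / enn2real r))"

text \<open>
  The levels below \<open>k\<close> form a geometric sum. Above \<open>k\<close>, the recursion for the envelope becomes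
  \<open>x (i + 1) \<le> x i / 2 + V (i + 1)\<close> for the summands of the dyadic norm, so that their sum is
  bounded by twice the sum of the \<open>V i\<close> and the initial term.
\<close>
lemma (in scaled_kernel) envelope_dyadic_bounded:
  assumes r: "1 \<le> r" and v: "dyadic_bounded r \<gamma> v 1"
  shows "dyadic_bounded r \<gamma> (\<lambda>j. e (j - k)) (C_env r \<gamma> * 2 powr (\<gamma> * real k))"
proof (cases "r = \<infinity>")
  case True
  have "e (j - k) * 2 powr (\<gamma> * real j) \<le> 2 powr (\<gamma> * real k)" for j
  proof -
    have "e (j - k) * 2 powr (\<gamma> * real j) \<le> 2 powr - (\<gamma> * real (j - k)) * 2 powr (\<gamma> * real j)"
      by (intro mult_right_mono e_decay) simp
    also have "\<dots> = 2 powr (\<gamma> * (real j - real (j - k)))"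
      by (simp add: powr_add[symmetric] right_diff_distrib)
    also have "\<dots> \<le> 2 powr (\<gamma> * real k)"
      using gamma_pos by (intro powr_mono mult_left_mono) auto
    finally show ?thesis .
  qed
  then show ?thesis using True by (simp add: dyadic_bounded_def C_env_def)
next
  case False
  define R where "R = enn2real r"
  let ?z = "\<lambda>i. 2 powr - (\<gamma> + 1) * e i * 2 powr (\<gamma> * real (Suc i))"
  let ?y = "\<lambda>j. e (j - k) * 2 powr (\<gamma> * real j)"
  have R: "1 \<le> R" unfolding R_def by (rule enn2real_ge_1[OF r False])
  define q where "q = 2 powr (\<gamma> * R)"
  have q: "1 < q" unfolding q_def using gamma_pos R powr_less_mono[of 0 "\<gamma> * R" 2] by simp
  define x where "x i = (e i * 2 powr (\<gamma> * real i)) powr R" for i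
  define V where "V i = (v i * 2 powr (\<gamma> * real i)) powr R" for i
  have V: "(\<Sum>i<I. V i) \<le> 1" for I
    using v False unfolding dyadic_bounded_def V_def R_def by simp
  have step: "x (Suc i) \<le> 1 / 2 * x i + V (Suc i)" for i
  proof -
    have "?z i = 1 / 2 * (e i * 2 powr (\<gamma> * real i))"
    proof -
      have "2 powr - (\<gamma> + 1) * 2 powr (\<gamma> * real (Suc i)) = 2 powr (\<gamma> * real i - 1)"
        by (simp add: powr_add[symmetric] distrib_left)
      also have "\<dots> = 1 / 2 * 2 powr (\<gamma> * real i)" by (simp add: powr_diff)
      finally show ?thesis by (simp only: mult_ac)
    qed
    then have "(?z i) powr R = (1 / 2) powr R * x i"
      unfolding x_def by (simp only: powr_mult)
    also have "\<dots> \<le> 1 / 2 * x i"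
      using R powr_mono'[of 1 R "1/2::real"] by (intro mult_right_mono) (auto simp: x_def)
    finally have 1: "(?z i) powr R \<le> 1 / 2 * x i" .
    have "0 \<le> x i" "0 \<le> V (Suc i)" unfolding x_def V_def by auto
    then show ?thesis
      using 1 unfolding x_def[of "Suc i"] V_def[of "Suc i"] envelope.simps(2) max_def
      by (cases "2 powr - (\<gamma> + 1) * e i \<le> v (Suc i)"; simp only: if_True if_False; linarith)
  qed
  have half: "(\<Sum>i<I. x i) \<le> 4" for I
  proof (cases I)
    case (Suc I')
    have "(\<Sum>i<Suc I'. x i) = x 0 + (\<Sum>i<I'. x (Suc i))" by (rule sum.lessThan_Suc_shift)
    also have "\<dots> \<le> 1 + (\<Sum>i<I'. 1 / 2 * x i + V (Suc i))"
      by (intro add_mono sum_mono step) (simp add: x_def)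
    also have "\<dots> = 1 + 1 / 2 * (\<Sum>i<I'. x i) + (\<Sum>i<I'. V (Suc i))"
      by (simp add: sum.distrib sum_distrib_left)
    finally have 1: "(\<Sum>i<Suc I'. x i) \<le> 1 + 1 / 2 * (\<Sum>i<I'. x i) + (\<Sum>i<I'. V (Suc i))" .
    have "(\<Sum>i<I'. V (Suc i)) \<le> (\<Sum>i<Suc I'. V i)"
      unfolding sum.lessThan_Suc_shift by (simp add: V_def)
    then have 2: "(\<Sum>i<I'. V (Suc i)) \<le> 1" using V[of "Suc I'"] by linarith
    have "(\<Sum>i<I'. x i) \<le> (\<Sum>i<Suc I'. x i)" by (simp add: x_def)
    then show ?thesis unfolding Suc using 1 2 by linarith
  qed simp
  have pk: "(2 powr (\<gamma> * real j)) powr R = q ^ j" for j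
    unfolding q_def by (simp add: powr_realpow[symmetric] powr_powr mult_ac)
  have "(\<Sum>j<J. (?y j) powr R) \<le> (4 + 1 / (q - 1)) * q ^ k" for J
  proof -
    have "(\<Sum>j<J. (?y j) powr R) \<le> (\<Sum>j<k + J. (?y j) powr R)"
      by (rule sum_mono2) auto
    also have "\<dots> = (\<Sum>j<k. (?y j) powr R) + (\<Sum>i<J. (e (k + i - k) * 2 powr (\<gamma> * real (k + i))) powr R)"
      by (rule sum_lessThan_add)
    also have "(\<Sum>j<k. (?y j) powr R) = (\<Sum>j<k. q ^ j)"
      by (rule sum.cong) (simp_all add: pk)
    also have "(\<Sum>i<J. (e (k + i - k) * 2 powr (\<gamma> * real (k + i))) powr R) = (\<Sum>i<J. q ^ k * x i)"
    proof (rule sum.cong[OF refl])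
      fix i
      have "2 powr (\<gamma> * real (k + i)) = 2 powr (\<gamma> * real k) * 2 powr (\<gamma> * real i)"
        by (simp add: powr_add[symmetric] distrib_left)
      then show "(e (k + i - k) * 2 powr (\<gamma> * real (k + i))) powr R = q ^ k * x i"
        unfolding x_def by (simp add: powr_mult pk)
    qed
    also have "\<dots> = q ^ k * (\<Sum>i<J. x i)" by (simp add: sum_distrib_left)
    also have "(\<Sum>j<k. q ^ j) + q ^ k * (\<Sum>i<J. x i) \<le> q ^ k / (q - 1) + q ^ k * 4"
      using q by (intro add_mono sum_power_less mult_left_mono half) auto
    finally show ?thesis by (simp add: algebra_simps)
  qed
  moreover have "(4 + 1 / (q - 1)) * q ^ k = (C_env r \<gamma> * 2 powr (\<gamma> * real k)) powr R"
    unfolding C_env_def R_def[symmetric] q_def[symmetric] pk[symmetric] using False R q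
    by (simp add: powr_mult) (simp add: powr_powr)
  ultimately show ?thesis
    using False unfolding dyadic_bounded_def R_def[symmetric] by (simp add: C_env_def)
qed

section \<open>Choice of the scale\<close>

text \<open>
  Up to constants, \<open>smallness\<close> bounds the norm of the commutator at scale \<open>2 ^ k\<close> relative to
  that of \<open>A\<close>, and \<open>scale_bound\<close> is the scale at which \<open>smallness\<close> falls below \<open>1 / K\<close>.
\<close>
definition smallness :: "real \<Rightarrow> real \<Rightarrow> nat \<Rightarrow> real" where
  "smallness \<delta> q k = (if \<delta> \<noteq> 1 then 2 powr - (min \<delta> 1 * real k)
     else 2 powr - real k * real (k + 1) powr q)"

definition scale_bound :: "real \<Rightarrow> real \<Rightarrow> real \<Rightarrow> real" where
  "scale_bound \<delta> q K = (if \<delta> \<noteq> 1 then K powr (1 / min \<delta> 1) else K * ln (K + 1) powr q)"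

lemma two_powr_neg_le_smallness:
  assumes "0 \<le> q" shows "2 powr - (\<delta> * real k) \<le> smallness \<delta> q k"
proof (cases "\<delta> = 1")
  case True
  have "1 \<le> real (k + 1) powr q" using assms by (intro ge_one_powr_ge_zero) auto
  then have "2 powr - real k * 1 \<le> 2 powr - real k * real (k + 1) powr q" by (intro mult_left_mono) auto
  then show ?thesis using True by (simp add: smallness_def)
next
  case False
  have "min \<delta> 1 * real k \<le> \<delta> * real k" by (rule mult_right_mono) auto
  then show ?thesis using False by (simp add: smallness_def)
qed

text \<open>
  The three terms account for the levels above \<open>k\<close>, for the levels below \<open>k\<close> if \<open>\<delta> \<noteq> 1\<close>, and
  for the levels below \<open>k\<close> if \<open>\<delta> = 1\<close>; in the last case the middle term is \<open>1 / 0 = 0\<close>.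
\<close>
definition C_comm :: "real \<Rightarrow> real \<Rightarrow> real" where
  "C_comm d \<delta> = 2 * 2 powr d * (1 / (1 - 2 powr - \<delta>) + 1 / \<bar>1 - 2 powr (1 - \<delta>)\<bar> + 1)"

lemma C_comm_pos: "0 < \<delta> \<Longrightarrow> 0 < C_comm d \<delta>"
  unfolding C_comm_def using powr_less_one[of 2 "- \<delta>"]
  by (intro mult_pos_pos add_nonneg_pos add_nonneg_nonneg) auto

lemma dyadic_bounded_sum:
  assumes r: "1 \<le> r" and s: "dyadic_bounded r \<gamma> s H" and s0: "\<And>j. 0 \<le> s j"
  shows "(\<Sum>j<k. s j * 2 powr (\<gamma> * real j)) \<le> H * real (k + 1) powr (1 - recip r)"
proof (cases "r = \<infinity>")
  case True
  have "(\<Sum>j<k. s j * 2 powr (\<gamma> * real j)) \<le> (\<Sum>j<k. H)"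
    by (intro sum_mono dyadic_bounded_pointwise[OF s r])
  also have "\<dots> \<le> H * real (k + 1)" using s by (simp add: dyadic_bounded_def algebra_simps)
  finally show ?thesis using True recip_eq[OF r] by simp
next
  case False
  define R where "R = enn2real r"
  have R: "1 \<le> R" unfolding R_def by (rule enn2real_ge_1[OF r False])
  have H0: "0 \<le> H" using s unfolding dyadic_bounded_def by blast
  have "(\<Sum>j<k. 1 * (s j * 2 powr (\<gamma> * real j))) powr R
      \<le> (\<Sum>j<k. 1) powr (R - 1) * (\<Sum>j<k. 1 * (s j * 2 powr (\<gamma> * real j)) powr R)"
    by (rule sum_powr_Jensen) (use R s0 in auto)
  also have "\<dots> \<le> real (k + 1) powr (R - 1) * H powr R"
    using s False R unfolding dyadic_bounded_def R_def[symmetric]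
    by (intro mult_mono powr_mono2 sum_nonneg) auto
  also have "\<dots> = (H * real (k + 1) powr (1 - 1 / R)) powr R"
    using R H0 by (simp add: powr_mult powr_powr left_diff_distrib)
  finally have le: "(\<Sum>j<k. s j * 2 powr (\<gamma> * real j)) powr R \<le> (H * real (k + 1) powr (1 - 1 / R)) powr R"
    by simp
  have "1 - recip r = 1 - 1 / R" using False recip_eq[OF r] by (simp add: R_def)
  then show ?thesis using le_of_powr_le_powr[OF le] R H0 by simp
qed

text \<open>
  Above level \<open>k\<close> the decay \<open>2 powr (- \<delta> j)\<close> alone is summed. Below level \<open>k\<close> the summands are
  \<open>2 powr (- k) S j 2 powr ((1 - \<delta>) j)\<close>: a geometric sum dominated by its last term for
  \<open>\<delta> < 1\<close> and by its first term for \<open>\<delta> > 1\<close>, while for \<open>\<delta> = 1\<close> the \<open>\<ell>\<^sup>r\<close> bound on \<open>S\<close> enters.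
\<close>
lemma commutator_sum_le:
  assumes r: "1 \<le> r" and s: "dyadic_bounded r \<gamma> s H" and s0: "\<And>j. 0 \<le> s j"
    and dl: "d < \<gamma>"
  shows "(\<Sum>j<J. s j * min 1 (2 ^ (j + 1) / 2 ^ k) * (2 ^ (j + 1)) powr d)
    \<le> C_comm d (\<gamma> - d) * H * smallness (\<gamma> - d) (1 - recip r) k"
proof -
  let ?f = "\<lambda>j. s j * min 1 (2 ^ (j + 1) / 2 ^ k) * (2 ^ (j + 1)) powr d"
  define \<delta> where "\<delta> = \<gamma> - d"
  define q where "q = 1 - recip r"
  define \<Omega> where "\<Omega> = smallness \<delta> q k"
  have d0: "0 < \<delta>" unfolding \<delta>_def using dl by simp
  have H0: "0 \<le> H" using s unfolding dyadic_bounded_def by blast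
  have q0: "0 \<le> q"
    unfolding q_def recip_eq[OF r] using enn2real_ge_1[OF r] by auto
  define S where "S j = s j * 2 powr (\<gamma> * real j)" for j
  let ?q = "2 powr (1 - \<delta>)"
  let ?h = "\<Sum>j<k. S j * 2 powr ((1 - \<delta>) * real j)"
  have S0: "0 \<le> S j" for j unfolding S_def using s0 by simp
  have SH: "S j \<le> H" for j unfolding S_def by (rule dyadic_bounded_pointwise[OF s r])
  have sS: "s j * (2 ^ (j + 1)) powr d = 2 powr d * (S j * 2 powr - (\<delta> * real j))" for j
  proof -
    have "(2 ^ (j + 1)) powr d = 2 powr d * 2 powr (d * real j)"
      by (simp add: powr_mult powr_powr powr_realpow[symmetric] mult.commute)
    moreover have "2 powr (\<gamma> * real j) * 2 powr - (\<delta> * real j) = 2 powr (d * real j)"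
      by (simp add: powr_add[symmetric] \<delta>_def left_diff_distrib)
    ultimately show ?thesis unfolding S_def by simp
  qed
  have e1: "?f j
      = 2 powr d * (S j * 2 powr - (\<delta> * real j)) * min 1 (2 ^ (j + 1) / 2 ^ k)" for j
    unfolding sS[symmetric] by simp
  have head: "?f j
      \<le> 2 * 2 powr d * 2 powr - real k * (S j * 2 powr ((1 - \<delta>) * real j))" for j
  proof -
    have "2 powr d * (S j * 2 powr - (\<delta> * real j)) * min 1 (2 ^ (j + 1) / 2 ^ k)
        \<le> 2 powr d * (S j * 2 powr - (\<delta> * real j)) * (2 ^ (j + 1) / 2 ^ k)"
      by (intro mult_left_mono) (use S0 in auto)
    also have "\<dots> = 2 * 2 powr d * 2 powr - real k * (S j * (2 powr - (\<delta> * real j) * 2 powr real j))"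
      by (simp add: powr_minus powr_realpow field_simps)
    also have "2 powr - (\<delta> * real j) * 2 powr real j = 2 powr ((1 - \<delta>) * real j)"
      by (simp add: powr_add[symmetric] left_diff_distrib)
    finally show ?thesis unfolding e1 .
  qed
  have tail: "?f j
      \<le> 2 * 2 powr d * H * 2 powr - (\<delta> * real j)" for j
  proof -
    have "2 powr d * (S j * 2 powr - (\<delta> * real j)) * min 1 (2 ^ (j + 1) / 2 ^ k)
        \<le> 2 powr d * (H * 2 powr - (\<delta> * real j)) * 2"
      by (intro mult_mono mult_left_mono mult_right_mono SH) (use S0 H0 in auto)
    then show ?thesis unfolding e1 by (simp add: mult_ac)
  qed
  have pw: "2 powr (x * real j) = (2 powr x) ^ j" for x :: real and j :: nat
    by (simp add: powr_realpow[symmetric] powr_powr)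
  have hd: "2 powr - real k * ?h
      \<le> H * \<Omega> * (1 / \<bar>1 - ?q\<bar> + 1)"
  proof (cases "\<delta> = 1")
    case True
    have "?h \<le> H * real (k + 1) powr q"
      using dyadic_bounded_sum[OF r s s0, of k] True unfolding S_def q_def by simp
    then have "2 powr - real k * ?h \<le> 2 powr - real k * (H * real (k + 1) powr q)"
      by (rule mult_left_mono) simp
    also have "\<dots> = H * \<Omega> * (1 / \<bar>1 - ?q\<bar> + 1)" using True by (simp add: \<Omega>_def smallness_def)
    finally show ?thesis .
  next
    case False
    have "?h \<le> (\<Sum>j<k. H * ?q ^ j)"
      unfolding pw by (intro sum_mono mult_right_mono SH) auto
    also have "\<dots> = H * (\<Sum>j<k. ?q ^ j)" by (simp add: sum_distrib_left)
    finally have 1: "2 powr - real k * ?h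
       \<le> 2 powr - real k * (H * (\<Sum>j<k. ?q ^ j))" by (rule mult_left_mono) simp
    have 2: "2 powr - real k * (\<Sum>j<k. ?q ^ j) \<le> \<Omega> * (1 / \<bar>1 - ?q\<bar>)"
    proof (cases "\<delta> < 1")
      case True
      have g: "1 < ?q" using True powr_less_mono[of 0 "1 - \<delta>" 2] by simp
      have "2 powr - real k * (\<Sum>j<k. ?q ^ j) \<le> 2 powr - real k * (?q ^ k / (?q - 1))"
        by (intro mult_left_mono sum_power_less g) simp
      also have "2 powr - real k * (?q ^ k / (?q - 1)) = 2 powr - real k * 2 powr ((1 - \<delta>) * real k) / (?q - 1)"
        by (simp add: pw)
      also have "2 powr - real k * 2 powr ((1 - \<delta>) * real k) = \<Omega>"
        using True by (simp add: \<Omega>_def smallness_def powr_add[symmetric] left_diff_distrib)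
      finally show ?thesis using g by simp
    next
      case False
      then have "1 < \<delta>" using \<open>\<delta> \<noteq> 1\<close> by simp
      then have g: "?q < 1" "0 < ?q" using powr_less_mono[of "1 - \<delta>" 0 2] by auto
      have "2 powr - real k * (\<Sum>j<k. ?q ^ j) \<le> 2 powr - real k * (1 / (1 - ?q))"
        by (intro mult_left_mono sum_power_less_1 g) simp
      then show ?thesis using g \<open>1 < \<delta>\<close> by (simp add: \<Omega>_def smallness_def)
    qed
    have "2 powr - real k * (H * (\<Sum>j<k. ?q ^ j)) \<le> H * (\<Omega> * (1 / \<bar>1 - ?q\<bar>))"
      using mult_left_mono[OF 2 H0] by (simp add: mult.left_commute)
    also have "\<dots> \<le> H * \<Omega> * (1 / \<bar>1 - ?q\<bar> + 1)"
      using H0 False by (simp add: distrib_left \<Omega>_def smallness_def)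
    finally show ?thesis using 1 by linarith
  qed
  have tl: "(\<Sum>i<J. 2 powr - (\<delta> * real (k + i))) \<le> \<Omega> * (1 / (1 - 2 powr - \<delta>))"
  proof -
    have g: "2 powr - \<delta> < 1" "0 < 2 powr - \<delta>" using d0 powr_less_mono[of "- \<delta>" 0 2] by auto
    have "(\<Sum>i<J. 2 powr - (\<delta> * real (k + i))) = 2 powr - (\<delta> * real k) * (\<Sum>i<J. (2 powr - \<delta>) ^ i)"
      unfolding sum_distrib_left pw[symmetric]
      by (intro sum.cong refl) (simp add: powr_add[symmetric] distrib_left)
    also have "\<dots> \<le> \<Omega> * (1 / (1 - 2 powr - \<delta>))"
      unfolding \<Omega>_def by (intro mult_mono two_powr_neg_le_smallness[OF q0] sum_power_less_1 g)
        (auto simp: smallness_def intro: sum_nonneg)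
    finally show ?thesis .
  qed
  have "(\<Sum>j<J. ?f j) \<le> (\<Sum>j<k + J. ?f j)"
    by (rule sum_mono2) (use s0 in auto)
  also have "\<dots> = (\<Sum>j<k. ?f j) + (\<Sum>i<J. ?f (k + i))" by (rule sum_lessThan_add)
  also have "\<dots> \<le> (\<Sum>j<k. 2 * 2 powr d * 2 powr - real k * (S j * 2 powr ((1 - \<delta>) * real j)))
      + (\<Sum>i<J. 2 * 2 powr d * H * 2 powr - (\<delta> * real (k + i)))"
    by (intro add_mono sum_mono head tail)
  also have "\<dots> = 2 * 2 powr d * (2 powr - real k * ?h)
      + 2 * 2 powr d * H * (\<Sum>i<J. 2 powr - (\<delta> * real (k + i)))"
    by (simp only: sum_distrib_left mult.assoc)
  also have "\<dots> \<le> 2 * 2 powr d * (H * \<Omega> * (1 / \<bar>1 - ?q\<bar> + 1))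
      + 2 * 2 powr d * H * (\<Omega> * (1 / (1 - 2 powr - \<delta>)))"
    by (intro add_mono mult_left_mono hd tl) (use H0 in auto)
  also have "\<dots> = C_comm d \<delta> * H * \<Omega>" unfolding C_comm_def by (simp add: algebra_simps)
  finally show ?thesis unfolding \<delta>_def \<Omega>_def q_def .
qed

lemma Suc_power2_le: "(real k + 1) ^ 2 \<le> 4 * 2 ^ k"
proof -
  have "(real (n + 3) + 1) ^ 2 \<le> 4 * 2 ^ (n + 3)" for n
  proof (induction n)
    case (Suc n)
    have "(real (Suc n + 3) + 1) ^ 2 \<le> 2 * (real (n + 3) + 1) ^ 2"
      by (simp add: power2_eq_square algebra_simps)
    also have "\<dots> \<le> 2 * (4 * 2 ^ (n + 3))" using Suc.IH by linarith
    also have "\<dots> = 4 * 2 ^ (Suc n + 3)" by (simp add: power_add)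
    finally show ?case .
  qed (simp add: power2_eq_square)
  note large = this
  consider "k = 0" | "k = 1" | "k = 2" | "k - 3 + 3 = k" by linarith
  then show ?thesis
  proof cases
    case 4
    then show ?thesis using large[of "k - 3"] by (simp only:)
  qed (simp_all add: power2_eq_square)
qed

lemma choose_scale_noncritical:
  fixes \<mu> C c :: real
  assumes mu: "0 < \<mu>" and C: "0 < C" and c: "0 < c"
  shows "\<exists>C'>0. \<forall>K\<ge>c. \<exists>k::nat. C * K * 2 powr - (\<mu> * real k) \<le> 1 \<and> 2 ^ k \<le> C' * K powr (1 / \<mu>)"
proof -
  let ?r = "\<lambda>x. x powr (1 / \<mu>)"
  let ?C' = "2 * ?r C + 1 / ?r c"
  have pos: "0 < ?C'" using C c by (simp add: add_pos_pos)
  have main: "\<exists>k::nat. C * K * 2 powr - (\<mu> * real k) \<le> 1 \<and> 2 ^ k \<le> ?C' * ?r K"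
    if K: "c \<le> K" for K
  proof -
    have K0: "0 < K" using c K by simp
    define x where "x = log 2 (C * K) / \<mu>"
    define k where "k = nat \<lceil>x\<rceil>"
    have xk: "x \<le> real k" unfolding k_def by linarith
    then have "log 2 (C * K) \<le> \<mu> * real k" unfolding x_def using mu by (simp add: field_simps)
    then have "C * K \<le> 2 powr (\<mu> * real k)" using C K0 by (simp add: log_le_iff)
    then have 1: "C * K * 2 powr - (\<mu> * real k) \<le> 1" by (simp add: powr_minus field_simps)
    have cK: "1 \<le> 1 / ?r c * ?r K"
      using powr_mono2[of "1 / \<mu>" c K] K c mu by (simp add: field_simps)
    have x2: "2 powr x = ?r C * ?r K"
    proof -
      have "2 powr x = (2 powr log 2 (C * K)) powr (1 / \<mu>)" by (simp add: x_def powr_powr)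
      also have "2 powr log 2 (C * K) = C * K" using C K0 by simp
      finally show ?thesis by (simp add: powr_mult)
    qed
    have "2 ^ k \<le> 2 * 2 powr x + 1"
    proof (cases "k = 0")
      case False
      then have "real k \<le> x + 1" unfolding k_def by linarith
      then have "2 powr real k \<le> 2 powr (x + 1)" by simp
      then show ?thesis by (simp add: powr_add powr_realpow)
    qed simp
    also have "\<dots> \<le> 2 * (?r C * ?r K) + 1 / ?r c * ?r K"
      unfolding x2 using cK by simp
    also have "\<dots> = ?C' * ?r K" by (simp add: algebra_simps)
    finally have 2: "2 ^ k \<le> ?C' * ?r K" .
    show ?thesis using 1 2 by blast
  qed
  then show ?thesis using pos by blast
qed

text \<open>
  Take the least admissible \<open>k\<close>. If it is not \<open>0\<close>, then \<open>k - 1\<close> is not admissible, so that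
  \<open>2 ^ k\<close> is at most of order \<open>K k powr q\<close>; as \<open>k\<close> is of lower order than \<open>2 ^ (k / 2)\<close>, this
  also forces \<open>k\<close> to be of order \<open>ln (K + 1)\<close>. The lower bound \<open>c\<close> on \<open>K\<close> keeps the logarithm
  away from \<open>0\<close>.
\<close>
lemma choose_scale_critical:
  fixes q C c :: real
  assumes q: "0 \<le> q" "q \<le> 1" and C: "0 < C" and c: "0 < c"
  shows "\<exists>C'>0. \<forall>K\<ge>c. \<exists>k::nat. C * K * (2 powr - real k * real (k + 1) powr q) \<le> 1
     \<and> 2 ^ k \<le> C' * (K * ln (K + 1) powr q)"
proof -
  let ?K = "\<lambda>K. K * ln (K + 1) powr q"
  let ?l = "\<bar>ln (4 * C ^ 2)\<bar>"
  define L where "L = ln (c + 1)"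
  have L: "0 < L" unfolding L_def using c by simp
  define C3 where "C3 = (1 + ?l / ln 2) / L + 2 / ln 2"
  have C3: "0 < C3" unfolding C3_def using L by (intro add_nonneg_pos divide_nonneg_pos add_nonneg_nonneg) auto
  define C' where "C' = 2 * C * C3 powr q + 1 / (c * L powr q)"
  have C'0: "0 < C'" unfolding C'_def using C C3 c L by (intro add_pos_pos) auto
  have main: "\<exists>k::nat. C * K * (2 powr - real k * real (k + 1) powr q) \<le> 1 \<and> 2 ^ k \<le> C' * ?K K"
    if K: "c \<le> K" for K
  proof -
    have K0: "0 < K" using K c by simp
    have LK: "L \<le> ln (K + 1)" unfolding L_def using K c by simp
    have lnK: "0 < ln (K + 1)" using L LK by linarith
    define good where "good k \<longleftrightarrow> C * K * real (k + 1) powr q \<le> 2 ^ k" for k :: nat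
    have pq: "real (k + 1) powr q \<le> real (k + 1)" for k :: nat
      using powr_mono[OF q(2), of "real (k + 1)"] by simp
    have "\<exists>k. good k"
    proof -
      obtain k where k: "(2 * C * K) ^ 2 < 2 ^ k" using real_arch_pow[of 2 "(2 * C * K) ^ 2"] by auto
      have "(C * K * (real k + 1)) ^ 2 = (2 * C * K) ^ 2 * (real k + 1) ^ 2 / 4" by (simp add: power_mult_distrib)
      also have "\<dots> \<le> 2 ^ k * (4 * 2 ^ k) / 4"
        by (intro divide_right_mono mult_mono Suc_power2_le) (use k in auto)
      also have "\<dots> = (2 ^ k) ^ 2" by (simp add: power2_eq_square)
      finally have "C * K * (real k + 1) \<le> 2 ^ k" by (rule power2_le_imp_le) simp
      moreover have "C * K * real (k + 1) powr q \<le> C * K * (real k + 1)"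
        using pq[of k] C K0 by (intro mult_left_mono) auto
      ultimately show ?thesis unfolding good_def by (intro exI[of _ k]) linarith
    qed
    then obtain k where k: "good k" "\<And>j. j < k \<Longrightarrow> \<not> good j"
      using LeastI_ex[of good] not_less_Least[of _ good] by metis
    have 1: "C * K * (2 powr - real k * real (k + 1) powr q) \<le> 1"
      using k(1) unfolding good_def by (simp add: powr_minus powr_realpow field_simps)
    have 2: "2 ^ k \<le> C' * ?K K"
    proof (cases k)
      case 0
      have "c * L powr q \<le> ?K K"
        using K c L LK q by (intro mult_mono powr_mono2) auto
      then have "1 \<le> 1 / (c * L powr q) * ?K K"
        using c L by (simp add: field_simps)
      also have "\<dots> \<le> C' * ?K K"
        unfolding C'_def using C C3 K0 by (intro mult_right_mono) auto
      finally show ?thesis using 0 by simp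
    next
      case (Suc j)
      then have j: "2 ^ j < C * K * real (j + 1) powr q" using k(2)[of j] unfolding good_def by simp
      also have "\<dots> \<le> C * K * (real j + 1)" using pq[of j] C K0 by (intro mult_left_mono) auto
      finally have "(2 ^ j) ^ 2 \<le> (C * K * (real j + 1)) ^ 2" by (intro power_mono) auto
      also have "\<dots> = (C * K) ^ 2 * (real j + 1) ^ 2" by (rule power_mult_distrib)
      also have "\<dots> \<le> (C * K) ^ 2 * (4 * 2 ^ j)" by (intro mult_left_mono Suc_power2_le) simp
      finally have "2 ^ j * 2 ^ j \<le> (4 * C ^ 2 * K ^ 2) * 2 ^ j" by (simp add: power2_eq_square mult_ac)
      then have jj: "2 ^ j \<le> 4 * C ^ 2 * K ^ 2" by simp
      have "real j * ln 2 = ln (2 ^ j)" by (simp add: ln_realpow)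
      also have "\<dots> \<le> ln (4 * C ^ 2 * K ^ 2)" using jj C K0 by (subst ln_le_cancel_iff) auto
      also have "\<dots> = ln (4 * C ^ 2) + 2 * ln K" using C K0 by (simp add: ln_mult ln_realpow)
      also have "\<dots> \<le> ?l + 2 * ln (K + 1)" using K0 by (intro add_mono mult_left_mono) auto
      finally have "real j \<le> (?l + 2 * ln (K + 1)) / ln 2"
        by (simp add: pos_le_divide_eq)
      then have "real j + 1 \<le> (1 + ?l / ln 2) + 2 / ln 2 * ln (K + 1)"
        by (simp add: add_divide_distrib)
      also have "1 + ?l / ln 2 \<le> (1 + ?l / ln 2) / L * ln (K + 1)"
      proof -
        have "(1 + ?l / ln 2) / L * L \<le> (1 + ?l / ln 2) / L * ln (K + 1)"
          using L by (intro mult_left_mono LK divide_nonneg_pos add_nonneg_nonneg) auto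
        then show ?thesis using L by simp
      qed
      finally have "real (j + 1) \<le> C3 * ln (K + 1)" unfolding C3_def by (simp add: distrib_right)
      then have "real (j + 1) powr q \<le> (C3 * ln (K + 1)) powr q" using q by (intro powr_mono2) auto
      also have "\<dots> = C3 powr q * ln (K + 1) powr q" by (rule powr_mult)
      finally have "C * K * real (j + 1) powr q \<le> C * K * (C3 powr q * ln (K + 1) powr q)"
        using C K0 by (intro mult_left_mono) auto
      with j have "2 ^ k \<le> (2 * C * C3 powr q) * ?K K" using Suc by (simp add: mult_ac)
      also have "\<dots> \<le> C' * ?K K"
        unfolding C'_def using c L K0 by (intro mult_right_mono) auto
      finally show ?thesis .
    qed
    show ?thesis using 1 2 by blast
  qed
  then show ?thesis using C'0 by blast
qed

lemma choose_scale:
  fixes \<delta> q C c :: real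
  assumes "0 < \<delta>" "0 \<le> q" "q \<le> 1" "0 < C" "0 < c"
  shows "\<exists>C'>0. \<forall>K\<ge>c. \<exists>k. C * K * smallness \<delta> q k \<le> 1 \<and> 2 ^ k \<le> C' * scale_bound \<delta> q K"
proof (cases "\<delta> = 1")
  case True
  then show ?thesis
    using choose_scale_critical[OF assms(2-5)] unfolding smallness_def scale_bound_def by simp
next
  case False
  then show ?thesis
    using choose_scale_noncritical[of "min \<delta> 1" C c] assms unfolding smallness_def scale_bound_def by simp
qed

section \<open>The graph as a space of polynomial growth\<close>

lemma gdist_path:
  assumes "connected_simple_graph E"
  shows "(x, y) \<in> E ^^ gdist E x y"
proof -
  have "\<exists>n. (x, y) \<in> E ^^ n"
    using assms unfolding connected_simple_graph_def by (simp add: rtrancl_power)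
  then show ?thesis unfolding gdist_def by (rule LeastI_ex)
qed

lemma gdist_le: "(x, y) \<in> E ^^ n \<Longrightarrow> gdist E x y \<le> n"
  unfolding gdist_def by (rule Least_le)

lemma gdist_self: "gdist E x x = 0"
  using gdist_le[where n = 0 and x = x and y = x] by simp

lemma gdist_eq_0:
  assumes "connected_simple_graph E" "gdist E x y = 0"
  shows "x = y"
  using gdist_path[OF assms(1), of x y] assms(2) by simp

lemma relpow_sym: "sym E \<Longrightarrow> (a, b) \<in> E ^^ n \<Longrightarrow> (b, a) \<in> E ^^ n"
proof (induction n arbitrary: b)
  case (Suc n)
  from Suc.prems(2) obtain c where c: "(a, c) \<in> E ^^ n" "(c, b) \<in> E" by (rule relpow_Suc_E)
  have "(c, a) \<in> E ^^ n" using Suc.IH[OF Suc.prems(1) c(1)] .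
  moreover have "(b, c) \<in> E" using c(2) Suc.prems(1) by (rule symD[rotated])
  ultimately show ?case using relpow_Suc_I2 by metis
qed simp

lemma gdist_sym:
  assumes "connected_simple_graph E"
  shows "gdist E x y = gdist E y x"
proof -
  have "sym E" using assms unfolding connected_simple_graph_def by simp
  then have le: "gdist E a b \<le> gdist E b a" for a b
    by (rule gdist_le[OF relpow_sym]) (rule gdist_path[OF assms])
  show ?thesis by (rule antisym[OF le le])
qed

lemma gdist_triangle:
  assumes "connected_simple_graph E"
  shows "gdist E x z \<le> gdist E x y + gdist E y z"
proof (rule gdist_le)
  show "(x, z) \<in> E ^^ (gdist E x y + gdist E y z)"
    unfolding relpow_add using gdist_path[OF assms] by blast
qed

lemma gball_of_nat: "gball E x (real n) = {z. gdist E x z \<le> n}"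
  by (simp add: gball_def)

lemma counting_le_ennreal:
  assumes "counting S \<le> ennreal c"
  shows "finite S" "real (card S) \<le> max 0 c"
proof -
  show fin: "finite S"
  proof (rule ccontr)
    assume "infinite S"
    then have "counting S = \<infinity>" by (simp add: emeasure_count_space)
    then show False using assms by (simp add: top_unique)
  qed
  have "ennreal (real (card S)) \<le> ennreal c"
    using assms fin by (simp add: emeasure_count_space ennreal_of_nat_eq_real_of_nat)
  then show "real (card S) \<le> max 0 c"
    by (cases "0 \<le> c") (auto simp: ennreal_le_iff ennreal_neg)
qed

lemma beurling_exponent_card:
  assumes "beurling_exponent E d"
  obtains D where "1 \<le> D" "\<And>x n. finite {z. gdist E x z \<le> n}"
    "\<And>x n. real (card {z. gdist E x z \<le> n}) \<le> D * real (n + 1) powr d"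
proof -
  obtain D where D: "\<And>x r. 0 \<le> r \<Longrightarrow> counting (gball E x r) \<le> ennreal (D * (r + 1) powr d)"
    using assms unfolding beurling_exponent_def by blast
  have b: "counting {z. gdist E x z \<le> n} \<le> ennreal (D * real (n + 1) powr d)" for x n
    using D[of "real n" x] unfolding gball_of_nat by (simp add: add.commute)
  have "real (card {z. gdist E x z \<le> n}) \<le> max 1 D * real (n + 1) powr d" for x n
  proof -
    have "max 0 (D * real (n + 1) powr d) \<le> max 1 D * real (n + 1) powr d"
      by (auto simp: max_def intro: mult_right_mono)
    then show ?thesis using counting_le_ennreal(2)[OF b[of x n]] by linarith
  qed
  then show thesis using that[of "max 1 D"] counting_le_ennreal(1)[OF b] by simp
qed

lemma beurling_exponent_nonneg:
  assumes "beurling_exponent E d" shows "0 \<le> d"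
proof (rule ccontr)
  assume "\<not> 0 \<le> d"
  then have d: "d < 0" by simp
  obtain D where D: "1 \<le> D" "\<And>x n. finite {z. gdist E x z \<le> n}"
    "\<And>x n. real (card {z. gdist E x z \<le> n}) \<le> D * real (n + 1) powr d"
    using beurling_exponent_card[OF assms] by blast
  obtain n :: nat where n: "(D + 1) powr (1 / - d) < real n" using reals_Archimedean2 by blast
  have "x \<in> {z. gdist E x z \<le> n}" for x using gdist_self[of E x] by simp
  then have "1 \<le> real (card {z. gdist E x z \<le> n})" for x
    using D(2)[of x n] by (metis One_nat_def Suc_leI card_gt_0_iff empty_iff of_nat_1 of_nat_mono)
  then have "1 \<le> D * real (n + 1) powr d" using D(3) order_trans by blast
  then have "real (n + 1) powr - d \<le> D" by (simp add: powr_minus field_simps)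
  moreover have "D + 1 \<le> real (n + 1) powr - d"
  proof -
    have "((D + 1) powr (1 / - d)) powr - d \<le> real (n + 1) powr - d"
      by (rule powr_mono2) (use d n in auto)
    then show ?thesis using d D(1) by (simp add: powr_powr)
  qed
  ultimately show False by simp
qed

text \<open>At scale \<open>0\<close> the whole vertex set is maximal disjoint, and its counting bound is volume growth.\<close>
lemma beurling_exponent_if_gen:
  assumes g: "connected_simple_graph E" and "gen_beurling_exponent E dt"
  shows "beurling_exponent E dt"
proof -
  obtain D where D: "\<And>R N S. 0 \<le> R \<Longrightarrow> 0 \<le> N \<Longrightarrow> maximal_disjoint E N S \<Longrightarrow>
     (SUP x. counting {m \<in> S. real (gdist E m x) \<le> (N + 1) * R}) \<le> ennreal (D * (R + 1) powr dt)"
    using assms(2) unfolding gen_beurling_exponent_def by blast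
  have b0: "gball E x 0 = {x}" for x
    using gdist_eq_0[OF g] by (auto simp: gball_def gdist_self)
  have m: "maximal_disjoint E 0 UNIV" unfolding maximal_disjoint_def b0 by auto
  have "counting (gball E x r) \<le> ennreal (D * (r + 1) powr dt)" if "0 \<le> r" for x r
  proof -
    have "counting (gball E x r) = counting {m \<in> UNIV. real (gdist E m x) \<le> (0 + 1) * r}"
      by (simp add: gball_def gdist_sym[OF g, of x])
    also have "\<dots> \<le> (SUP x. counting {m \<in> UNIV. real (gdist E m x) \<le> (0 + 1) * r})"
      by (rule SUP_upper) simp
    also have "\<dots> \<le> ennreal (D * (r + 1) powr dt)" by (rule D[OF that _ m]) simp
    finally show ?thesis .
  qed
  then show ?thesis unfolding beurling_exponent_def by blast
qed

lemma maximal_disjoint_exists: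
  assumes N: "0 \<le> N"
  shows "\<exists>S. maximal_disjoint E N S"
proof -
  define \<A> where "\<A> = {S. \<forall>m\<in>S. \<forall>n\<in>S. m \<noteq> n \<longrightarrow> gball E m N \<inter> gball E n N = {}}"
  have AD: "gball E m N \<inter> gball E n N = {}" if "M \<in> \<A>" "m \<in> M" "n \<in> M" "m \<noteq> n" for M m n
    using that unfolding \<A>_def by blast
  have AI: "M \<in> \<A>" if "\<And>m n. m \<in> M \<Longrightarrow> n \<in> M \<Longrightarrow> m \<noteq> n \<Longrightarrow> gball E m N \<inter> gball E n N = {}" for M
    using that unfolding \<A>_def by blast
  \<comment> \<open>A maximal element of \<open>\<A>\<close> is maximal \<open>N\<close>-disjoint: otherwise the missing centre could be added.\<close>
  have "\<exists>M\<in>\<A>. \<forall>X\<in>\<A>. M \<subseteq> X \<longrightarrow> X = M"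
  proof (rule Zorn_Lemma, rule ballI, rule AI)
    fix C m n assume C: "C \<in> chains \<A>" and "m \<in> \<Union>C" "n \<in> \<Union>C" and ne: "m \<noteq> n"
    then obtain M1 M2 where *: "m \<in> M1" "M1 \<in> C" "n \<in> M2" "M2 \<in> C" by blast
    then have "M1 \<subseteq> M2 \<or> M2 \<subseteq> M1" using C unfolding chains_def chain_subset_def by blast
    then obtain M where M: "M \<in> C" "m \<in> M" "n \<in> M" using * by blast
    have "C \<subseteq> \<A>" using C unfolding chains_def by blast
    then show "gball E m N \<inter> gball E n N = {}" using AD[OF _ M(2,3) ne] M(1) by blast
  qed
  then obtain M where M: "M \<in> \<A>" "\<And>X. X \<in> \<A> \<Longrightarrow> M \<subseteq> X \<Longrightarrow> X = M"
    by metis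
  have self: "x \<in> gball E x N" for x using N by (simp add: gball_def gdist_self)
  have "gball E x N \<inter> (\<Union>m\<in>M. gball E m N) \<noteq> {}" for x
  proof
    assume e: "gball E x N \<inter> (\<Union>m\<in>M. gball E m N) = {}"
    then have x: "gball E x N \<inter> gball E m N = {}" if "m \<in> M" for m using that by blast
    have "insert x M \<in> \<A>"
    proof (rule AI)
      fix m n assume "m \<in> insert x M" "n \<in> insert x M" "m \<noteq> n"
      then consider "m = x" "n \<in> M" | "n = x" "m \<in> M" | "m \<in> M" "n \<in> M" by blast
      then show "gball E m N \<inter> gball E n N = {}"
        using x AD[OF M(1) _ _ \<open>m \<noteq> n\<close>] by cases (simp_all add: Int_commute)
    qed
    then have "insert x M = M" by (rule M(2)) blast
    then have "x \<in> M" by blast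
    then show False using e self[of x] by blast
  qed
  then have "maximal_disjoint E N M" using AD[OF M(1)] unfolding maximal_disjoint_def by simp
  then show ?thesis by blast
qed

text \<open>
  The nets are maximal disjoint sets: if the balls of radius \<open>N\<close> around \<open>x\<close> and \<open>m\<close> meet, then
  \<open>x\<close> and \<open>m\<close> are at distance at most \<open>2 N\<close>.
\<close>
lemma graph_growth_space:
  fixes E :: "'v rel"
  assumes g: "connected_simple_graph E" and dbl: "doubling E"
    and d: "beurling_exponent E d" and dt: "gen_beurling_exponent E dt" and le: "d \<le> dt" and p: "1 \<le> p"
  shows "\<exists>D Q P. growth_space (gdist E) d dt p D Q P"
proof -
  let ?b = "\<lambda>x n. {z. gdist E x z \<le> n}"
  obtain D where D: "1 \<le> D" and fin: "\<And>x n. finite (?b x n)"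
    and gr: "\<And>x n. real (card (?b x n)) \<le> D * real (n + 1) powr d"
    using beurling_exponent_card[OF d] by metis
  obtain Q where Q: "0 < Q" "\<And>x r. 0 < r \<Longrightarrow> counting (gball E x (2 * r)) \<le> ennreal Q * counting (gball E x r)"
    using dbl unfolding doubling_def by blast
  have dbl': "real (card (?b x (2 * n))) \<le> max 1 Q * real (card (?b x n))" for x n
  proof (cases "n = 0")
    case True
    then show ?thesis by (simp add: mult_le_cancel_right1)
  next
    case False
    have "counting (?b x (2 * n)) \<le> ennreal Q * counting (?b x n)"
      using Q(2)[of "real n" x] False gball_of_nat[of E x "2 * n"] by (simp add: gball_of_nat)
    also have "\<dots> = ennreal (Q * real (card (?b x n)))"
      using fin[of x n] Q(1) by (simp add: emeasure_count_space ennreal_mult ennreal_of_nat_eq_real_of_nat)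
    finally have "real (card (?b x (2 * n))) \<le> max 0 (Q * real (card (?b x n)))"
      by (rule counting_le_ennreal(2))
    also have "\<dots> \<le> max 1 Q * real (card (?b x n))" using Q(1) by (simp add: mult_right_mono)
    finally show ?thesis .
  qed
  obtain P where P: "\<And>R N S. 0 \<le> R \<Longrightarrow> 0 \<le> N \<Longrightarrow> maximal_disjoint E N S \<Longrightarrow>
     (SUP x. counting {m \<in> S. real (gdist E m x) \<le> (N + 1) * R}) \<le> ennreal (P * (R + 1) powr dt)"
    using dt unfolding gen_beurling_exponent_def by blast
  have nets: "\<exists>S. (\<forall>x. \<exists>m\<in>S. gdist E x m \<le> 2 * N) \<and>
      (\<forall>x R. real (card {m \<in> S. gdist E x m \<le> (N + 1) * R}) \<le> max 1 P * real (R + 1) powr dt)" for N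
  proof -
    obtain S where S: "maximal_disjoint E (real N) S" using maximal_disjoint_exists[of "real N" E] by auto
    have "\<exists>m\<in>S. gdist E x m \<le> 2 * N" for x
    proof -
      have "gball E x (real N) \<inter> (\<Union>m\<in>S. gball E m (real N)) \<noteq> {}"
        using S unfolding maximal_disjoint_def by blast
      then obtain m z where "m \<in> S" "gdist E x z \<le> N" "gdist E m z \<le> N"
        unfolding gball_of_nat by blast
      then show ?thesis using gdist_triangle[OF g, of x m z] gdist_sym[OF g, of m z] by force
    qed
    moreover have "real (card {m \<in> S. gdist E x m \<le> (N + 1) * R}) \<le> max 1 P * real (R + 1) powr dt" for x R
    proof -
      have e: "{m \<in> S. gdist E x m \<le> (N + 1) * R} = {m \<in> S. real (gdist E m x) \<le> (real N + 1) * real R}"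
      proof -
        have "gdist E x m \<le> (N + 1) * R \<longleftrightarrow> real (gdist E m x) \<le> (real N + 1) * real R" for m
          unfolding gdist_sym[OF g, of x m] of_nat_le_iff[symmetric, where 'a = real] by (simp add: algebra_simps)
        then show ?thesis by blast
      qed
      have "counting {m \<in> S. gdist E x m \<le> (N + 1) * R} \<le> (SUP x. counting {m \<in> S. real (gdist E m x) \<le> (real N + 1) * real R})"
        unfolding e by (rule SUP_upper) simp
      also have "\<dots> \<le> ennreal (P * (real R + 1) powr dt)" by (rule P[OF _ _ S]) auto
      finally have "real (card {m \<in> S. gdist E x m \<le> (N + 1) * R}) \<le> max 0 (P * (real R + 1) powr dt)"
        by (rule counting_le_ennreal(2))
      also have "\<dots> \<le> max 1 P * (real R + 1) powr dt" by (auto simp: max_def intro: mult_right_mono)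
      finally show ?thesis by (simp add: add.commute)
    qed
    ultimately show ?thesis by blast
  qed
  have "growth_space (gdist E) d dt p D (max 1 Q) (max 1 P)"
    by unfold_locales
      (use gdist_self gdist_sym[OF g] gdist_triangle[OF g] fin gr dbl' nets beurling_exponent_nonneg[OF d] le p D in auto)
  then show ?thesis by blast
qed


section \<open>Muckenhoupt weights\<close>

text \<open>
  For \<open>p > 1\<close> this is Hoelder's inequality with the dual weight \<open>\<sigma> = w powr (- 1 / (p - 1))\<close>,
  written as Jensen's inequality for \<open>u / \<sigma>\<close> with respect to \<open>\<sigma>\<close>.
\<close>
lemma muckenhoupt_average:
  fixes E :: "'v rel"
  assumes p: "1 \<le> p" and w: "\<And>x. 0 < w x" and C: "muckenhoupt_bound E p w C"
    and fin: "finite {z. gdist E x z \<le> n}" and u: "\<And>z. 0 \<le> u z"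
  defines "Bn \<equiv> {z. gdist E x z \<le> n}"
  shows "(\<Sum>z\<in>Bn. u z) powr p * sum w Bn \<le> C * real (card Bn) powr p * (\<Sum>z\<in>Bn. u z powr p * w z)"
proof -
  let ?S = "\<Sum>z\<in>Bn. u z powr p * w z"
  have xB: "x \<in> Bn" unfolding Bn_def by (simp add: gdist_self)
  have fB: "finite Bn" unfolding Bn_def by (rule fin)
  define N where "N = real (card Bn)"
  have N: "0 < N" unfolding N_def using xB fB card_gt_0_iff by fastforce
  have C0: "0 < C" using C unfolding muckenhoupt_bound_def by simp
  have bd: "if p = 1 then average w Bn \<le> C * (INF y\<in>Bn. w y)
        else average w Bn * average (\<lambda>y. w y powr (- 1 / (p - 1))) Bn powr (p - 1) \<le> C"
    using C gball_of_nat[of E x n] unfolding muckenhoupt_bound_def Let_def Bn_def by (metis of_nat_0_le_iff)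
  show ?thesis
  proof (cases "p = 1")
    case True
    have "sum w Bn / N \<le> C * (INF y\<in>Bn. w y)" using bd True unfolding average_def N_def by simp
    then have 1: "sum w Bn \<le> C * N * (INF y\<in>Bn. w y)" using N by (simp add: field_simps)
    have "(\<Sum>z\<in>Bn. u z) * sum w Bn \<le> (\<Sum>z\<in>Bn. u z) * (C * N * (INF y\<in>Bn. w y))"
      by (rule mult_left_mono[OF 1]) (use u in \<open>auto intro: sum_nonneg\<close>)
    also have "\<dots> = C * N * (\<Sum>z\<in>Bn. u z * (INF y\<in>Bn. w y))" by (simp add: sum_distrib_right[symmetric])
    also have "\<dots> \<le> C * N * (\<Sum>z\<in>Bn. u z * w z)"
      using C0 N by (intro mult_left_mono sum_mono cINF_lower u) (use fB in auto)
    finally show ?thesis using True u N by (simp add: N_def[symmetric] sum_nonneg)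
  next
    case False
    then have p1: "1 < p" using p by simp
    define \<sigma> where "\<sigma> z = w z powr (- 1 / (p - 1))" for z
    have s0: "0 < \<sigma> z" for z unfolding \<sigma>_def using w[of z] by simp
    have W0: "0 < sum w Bn" by (rule sum_pos[OF fB]) (use w xB in auto)
    have S0: "0 < sum \<sigma> Bn" by (rule sum_pos[OF fB]) (use s0 xB in auto)
    have "sum w Bn / N * (sum \<sigma> Bn / N) powr (p - 1) \<le> C"
      using bd False unfolding average_def N_def \<sigma>_def by simp
    then have "sum w Bn / N * (sum \<sigma> Bn powr (p - 1) / N powr (p - 1)) \<le> C" by (simp add: powr_divide)
    then have "sum w Bn * sum \<sigma> Bn powr (p - 1) \<le> C * (N * N powr (p - 1))"
      using N by (simp add: field_simps)
    also have "N * N powr (p - 1) = N powr p" using N by (simp add: powr_mult_base)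
    finally have 1: "sum w Bn * sum \<sigma> Bn powr (p - 1) \<le> C * N powr p" .
    have "(\<Sum>z\<in>Bn. \<sigma> z * (u z / \<sigma> z)) powr p \<le> sum \<sigma> Bn powr (p - 1) * (\<Sum>z\<in>Bn. \<sigma> z * (u z / \<sigma> z) powr p)"
      by (rule sum_powr_Jensen[OF fB p]) (use s0 u less_imp_le[OF s0] in auto)
    also have "(\<Sum>z\<in>Bn. \<sigma> z * (u z / \<sigma> z)) = (\<Sum>z\<in>Bn. u z)"
      by (rule sum.cong) (use s0 less_irrefl in \<open>auto simp: less_imp_neq[symmetric]\<close>)
    also have "(\<Sum>z\<in>Bn. \<sigma> z * (u z / \<sigma> z) powr p) = ?S"
    proof (rule sum.cong[OF refl])
      fix z
      have "\<sigma> z / \<sigma> z powr p = \<sigma> z powr (1 - p)" using s0[of z] by (simp add: powr_diff)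
      also have "\<dots> = w z powr (- 1 / (p - 1) * (1 - p))" unfolding \<sigma>_def powr_powr ..
      also have "- 1 / (p - 1) * (1 - p) = 1" using p1 by (simp add: field_simps)
      finally have "\<sigma> z / \<sigma> z powr p = w z" using w[of z] by simp
      moreover have "\<sigma> z * (u z / \<sigma> z) powr p = u z powr p * (\<sigma> z / \<sigma> z powr p)"
        by (simp add: powr_divide)
      ultimately show "\<sigma> z * (u z / \<sigma> z) powr p = u z powr p * w z" by simp
    qed
    finally have 2: "(\<Sum>z\<in>Bn. u z) powr p \<le> sum \<sigma> Bn powr (p - 1) * ?S" .
    have U0: "0 \<le> ?S" by (intro sum_nonneg mult_nonneg_nonneg less_imp_le[OF w]) simp
    have "(\<Sum>z\<in>Bn. u z) powr p * sum w Bn \<le> (sum \<sigma> Bn powr (p - 1) * ?S) * sum w Bn"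
      by (rule mult_right_mono[OF 2]) (use W0 in simp)
    also have "\<dots> = (sum w Bn * sum \<sigma> Bn powr (p - 1)) * ?S" by simp
    also have "\<dots> \<le> C * N powr p * ?S" by (rule mult_right_mono[OF 1 U0])
    finally show ?thesis unfolding N_def .
  qed
qed

text \<open>
  The infimum of the admissible constants is itself admissible, because each instance of the
  averaging inequality is a closed condition on the constant. Testing on single points shows
  that it is at least \<open>1\<close>.
\<close>
lemma (in growth_space) muckenhoupt_imp_averaging_weight:
  assumes rho: "\<rho> = gdist E" and mw: "muckenhoupt_weight E p w"
  shows "averaging_weight w (Ap_const E p w)"
proof -
  have w: "0 < w x" for x using mw unfolding muckenhoupt_weight_def by blast
  define T where "T = {C. muckenhoupt_bound E p w C}"
  have T: "T \<noteq> {}" using mw unfolding muckenhoupt_weight_def T_def by blast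
  have av: "(\<Sum>z\<in>B x n. u z) powr p * sum w (B x n) \<le> C * real (card (B x n)) powr p * (\<Sum>z\<in>B x n. u z powr p * w z)"
    if "C \<in> T" "\<And>z. 0 \<le> u z" for C x n u
    using muckenhoupt_average[OF p_ge_1 w, where E = E and C = C and x = x and n = n and u = u] that finite_balls[of x n] unfolding rho T_def by simp
  have one: "1 \<le> C" if "C \<in> T" for C
  proof -
    fix x :: 'v
    have xB: "x \<in> B x 0" by simp
    have cB: "0 < real (card (B x 0))" using card_ball_pos[of x 0] by (simp only: of_nat_0_less_iff)
    have "real (card (B x 0)) powr p * sum w (B x 0) \<le> C * real (card (B x 0)) powr p * sum w (B x 0)"
      using av[OF that, of "\<lambda>_. 1" x 0] by simp
    moreover have "0 < sum w (B x 0)" by (rule sum_pos[OF finite_balls]) (use w xB in blast)+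
    ultimately show ?thesis using cB by (simp add: mult.assoc mult_le_cancel_right1)
  qed
  have ge1: "1 \<le> Inf T" by (rule cInf_greatest[OF T one])
  show ?thesis
    unfolding averaging_weight_def Ap_const_def T_def[symmetric]
  proof (intro conjI allI impI w ge1)
    fix x n and u :: "'v \<Rightarrow> real" assume u: "\<forall>z. 0 \<le> u z"
    define Z where "Z = real (card (B x n)) powr p * (\<Sum>z\<in>B x n. u z powr p * w z)"
    define Y where "Y = (\<Sum>z\<in>B x n. u z) powr p * sum w (B x n)"
    have Z0: "0 \<le> Z" unfolding Z_def by (intro mult_nonneg_nonneg sum_nonneg less_imp_le[OF w]) auto
    have YZ: "Y \<le> C * Z" if "C \<in> T" for C
      using av[OF that, of u x n] u unfolding Y_def Z_def by (simp add: mult.assoc)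
    have "Y \<le> Inf T * Z"
    proof (cases "Z = 0")
      case True
      then show ?thesis using YZ T by fastforce
    next
      case False
      then have "Y / Z \<le> Inf T" using Z0 YZ by (intro cInf_greatest[OF T]) (simp add: pos_divide_le_eq)
      then show ?thesis using False Z0 by (simp add: pos_divide_le_eq)
    qed
    then show "(\<Sum>z\<in>B x n. u z) powr p * sum w (B x n) \<le> Inf T * real (card (B x n)) powr p * (\<Sum>z\<in>B x n. u z powr p * w z)"
      unfolding Y_def Z_def by (simp add: mult.assoc)
  qed
qed


section \<open>Matrices bounded on weighted sequence spaces\<close>

lemma wlp_norm_nonneg: "0 \<le> wlp_norm p w c"
  unfolding wlp_norm_def by simp

lemma wlp_norm_powr:
  assumes "0 < p" "\<And>x. 0 \<le> w x"
  shows "wlp_norm p w c powr p = (\<Sum>\<^sub>\<infinity>x. norm (c x) powr p * w x)"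
proof -
  have "0 \<le> (\<Sum>\<^sub>\<infinity>x. norm (c x) powr p * w x)" by (rule infsum_nonneg) (use assms in auto)
  then show ?thesis unfolding wlp_norm_def using assms by (simp add: powr_powr)
qed

lemma wlp_scale:
  assumes p: "0 < p" and w: "\<And>x. 0 \<le> w x" and c: "c \<in> wlp p w"
  shows "(\<lambda>x. of_real t * c x) \<in> wlp p w"
    and "wlp_norm p w (\<lambda>x. of_real t * c x) = \<bar>t\<bar> * wlp_norm p w c"
proof -
  have s: "(\<lambda>x. norm (c x) powr p * w x) summable_on UNIV" using c unfolding wlp_def by simp
  have e: "norm (of_real t * c x) powr p * w x = \<bar>t\<bar> powr p * (norm (c x) powr p * w x)" for x
    by (simp add: norm_mult powr_mult)
  show "(\<lambda>x. of_real t * c x) \<in> wlp p w"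
    unfolding wlp_def mem_Collect_eq e by (rule summable_on_cmult_right[OF s])
  have "(\<Sum>\<^sub>\<infinity>x. norm (of_real t * c x) powr p * w x) = \<bar>t\<bar> powr p * (\<Sum>\<^sub>\<infinity>x. norm (c x) powr p * w x)"
    unfolding e by (rule infsum_cmult_right[OF s])
  then show "wlp_norm p w (\<lambda>x. of_real t * c x) = \<bar>t\<bar> * wlp_norm p w c"
    unfolding wlp_norm_def using p by (simp add: powr_mult powr_powr)
qed

lemma bounded_matricesD:
  assumes "A \<in> bounded_matrices p w" "c \<in> wlp p w"
  shows "(\<lambda>y. A x y * c y) summable_on UNIV" "mat_apply A c \<in> wlp p w"
  using assms unfolding bounded_matrices_def by auto

lemma op_norm_bound:
  assumes p: "0 < p" and w: "\<And>x. 0 \<le> w x" and B: "B \<in> bounded_matrices p w"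
  shows op_norm_nonneg: "0 \<le> op_norm p w B"
    and wlp_norm_apply_le: "c \<in> wlp p w \<Longrightarrow> wlp_norm p w (mat_apply B c) \<le> op_norm p w B * wlp_norm p w c"
proof -
  let ?n = "wlp_norm p w"
  define U where "U = {c \<in> wlp p w. ?n c \<le> 1}"
  obtain K where K: "\<And>c. c \<in> wlp p w \<Longrightarrow> ?n (mat_apply B c) \<le> K * ?n c"
    using B unfolding bounded_matrices_def by blast
  have "?n (mat_apply B c) \<le> \<bar>K\<bar>" if "c \<in> U" for c
  proof -
    have "?n (mat_apply B c) \<le> K * ?n c" using K that unfolding U_def by blast
    also have "\<dots> \<le> \<bar>K\<bar> * 1"
      using that wlp_norm_nonneg[of p w c] unfolding U_def by (intro mult_mono) auto
    finally show ?thesis by simp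
  qed
  then have bdd: "bdd_above ((\<lambda>c. ?n (mat_apply B c)) ` U)" by (rule bdd_aboveI2)
  have up: "?n (mat_apply B c) \<le> op_norm p w B" if "c \<in> U" for c
    unfolding op_norm_def U_def[symmetric] by (rule cSUP_upper[OF that bdd])
  have "(\<lambda>_. 0) \<in> U" using p unfolding U_def wlp_def wlp_norm_def by simp
  from up[OF this] show "0 \<le> op_norm p w B"
    using wlp_norm_nonneg order_trans by blast
  show "?n (mat_apply B c) \<le> op_norm p w B * ?n c" if c: "c \<in> wlp p w"
  proof (cases "?n c = 0")
    case True
    then show ?thesis using K[OF c] by simp
  next
    case False
    define t where "t = 1 / ?n c"
    have pos: "0 < ?n c" using False wlp_norm_nonneg[of p w c] by simp
    have sm: "(\<lambda>y. B x y * c y) summable_on UNIV" for x by (rule bounded_matricesD(1)[OF B c])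
    have Bc: "mat_apply B c \<in> wlp p w" by (rule bounded_matricesD(2)[OF B c])
    have "(\<lambda>x. of_real t * c x) \<in> U"
      unfolding U_def using wlp_scale[OF p w c, of t] pos by (simp add: t_def)
    from up[OF this] have "?n (mat_apply B (\<lambda>x. of_real t * c x)) \<le> op_norm p w B" .
    also have "mat_apply B (\<lambda>x. of_real t * c x) = (\<lambda>x. of_real t * mat_apply B c x)"
    proof
      fix x
      have "mat_apply B (\<lambda>x. of_real t * c x) x = (\<Sum>\<^sub>\<infinity>y. of_real t * (B x y * c y))"
        unfolding mat_apply_def by (simp add: mult.left_commute)
      also have "\<dots> = of_real t * mat_apply B c x"
        unfolding mat_apply_def by (rule infsum_cmult_right[OF sm])
      finally show "mat_apply B (\<lambda>x. of_real t * c x) x = of_real t * mat_apply B c x" .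
    qed
    also have "?n \<dots> = \<bar>t\<bar> * ?n (mat_apply B c)" by (rule wlp_scale(2)[OF p w Bc])
    finally show ?thesis using pos unfolding t_def by (simp add: field_simps)
  qed
qed

lemma finite_support_wlp:
  fixes f :: "'v \<Rightarrow> complex"
  assumes "finite F" and p: "0 < p"
  defines "f0 \<equiv> \<lambda>z. if z \<in> F then f z else 0"
  shows "f0 \<in> wlp p w"
    and "(\<Sum>\<^sub>\<infinity>x. norm (f0 x) powr p * w x) = (\<Sum>x\<in>F. norm (f x) powr p * w x)"
    and "mat_apply A f0 x = (\<Sum>z\<in>F. A x z * f z)"
proof -
  have "(\<lambda>x. norm (f0 x) powr p * w x) summable_on F" by (rule summable_on_finite[OF assms(1)])
  then have "(\<lambda>x. norm (f0 x) powr p * w x) summable_on UNIV"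
    by (rule summable_on_cong_neutral[THEN iffD1, rotated -1]) (use p in \<open>auto simp: f0_def\<close>)
  then show "f0 \<in> wlp p w" unfolding wlp_def by simp
  have "(\<Sum>\<^sub>\<infinity>x. norm (f0 x) powr p * w x) = (\<Sum>\<^sub>\<infinity>x\<in>F. norm (f0 x) powr p * w x)"
    by (rule infsum_cong_neutral) (use p in \<open>auto simp: f0_def\<close>)
  also have "\<dots> = (\<Sum>x\<in>F. norm (f x) powr p * w x)" using assms(1) by (simp add: f0_def)
  finally show "(\<Sum>\<^sub>\<infinity>x. norm (f0 x) powr p * w x) = (\<Sum>x\<in>F. norm (f x) powr p * w x)" .
  have "mat_apply A f0 x = (\<Sum>\<^sub>\<infinity>z\<in>F. A x z * f0 z)"
    unfolding mat_apply_def by (rule infsum_cong_neutral) (auto simp: f0_def)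
  also have "\<dots> = (\<Sum>z\<in>F. A x z * f z)" using assms(1) by (simp add: f0_def)
  finally show "mat_apply A f0 x = (\<Sum>z\<in>F. A x z * f z)" .
qed

lemma bounded_matrix_column:
  assumes p: "0 < p" and A: "A \<in> bounded_matrices p w"
  shows "(\<lambda>x. A x y) \<in> wlp p w"
proof -
  have "mat_apply A (\<lambda>z. if z \<in> {y} then 1 else 0) = (\<lambda>x. A x y)"
    using finite_support_wlp(3)[where F = "{y}" and p = p and f = "\<lambda>_. 1"] p by (intro ext) simp
  moreover have "(\<lambda>z. if z \<in> {y} then 1 else 0) \<in> wlp p w" by (rule finite_support_wlp(1)) (use p in auto)
  ultimately show ?thesis using bounded_matricesD(2)[OF A] by metis
qed

text \<open>
  For finitely supported \<open>f\<close> the identity \<open>B (A f) = f\<close> follows from \<open>B A = I\<close> by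
  interchanging an infinite sum with a finite one.
\<close>
lemma inverse_lower_bound:
  fixes A B :: "'v matrix"
  assumes p: "0 < p" and w: "\<And>x. 0 \<le> w x" and inv: "is_inverse_in p w A B" and F: "finite F"
    and G: "\<And>X. finite X \<Longrightarrow> (\<Sum>x\<in>X. norm (\<Sum>z\<in>F. A x z * f z) powr p * w x) \<le> G"
  shows "(\<Sum>z\<in>F. norm (f z) powr p * w z) \<le> op_norm p w B powr p * G"
proof -
  let ?o = "op_norm p w B powr p"
  have A: "A \<in> bounded_matrices p w" and B: "B \<in> bounded_matrices p w" and BA: "mat_mult B A = mat_id"
    using inv unfolding is_inverse_in_def by auto
  define f0 where "f0 z = (if z \<in> F then f z else 0)" for z
  note f0 = finite_support_wlp[OF F p, where f = f, folded f0_def]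
  define g where "g = mat_apply A f0"
  have g: "g \<in> wlp p w" unfolding g_def by (rule bounded_matricesD(2)[OF A f0(1)])
  have gx: "g x = (\<Sum>z\<in>F. A x z * f z)" for x unfolding g_def by (rule f0(3))
  have col: "(\<lambda>y. B x y * A y z) summable_on UNIV" for x z
    by (rule bounded_matricesD(1)[OF B bounded_matrix_column[OF p A]])
  have Bg: "mat_apply B g = f0"
  proof
    fix x
    have "((\<lambda>y. \<Sum>z\<in>F. B x y * A y z * f z) has_sum (\<Sum>z\<in>F. mat_id x z * f z)) UNIV"
    proof (rule has_sum_finite_sum)
      fix z
      have "((\<lambda>y. B x y * A y z) has_sum mat_mult B A x z) UNIV"
        unfolding mat_mult_def by (rule has_sum_infsum[OF col])
      then show "((\<lambda>y. B x y * A y z * f z) has_sum mat_id x z * f z) UNIV"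
        unfolding BA by (rule has_sum_cmult_left)
    qed (rule F)
    then have "mat_apply B g x = (\<Sum>z\<in>F. mat_id x z * f z)"
      unfolding mat_apply_def gx by (simp add: sum_distrib_left mult.assoc infsumI)
    also have "\<dots> = (\<Sum>z\<in>F. if x = z then f z else 0)" by (rule sum.cong) (auto simp: mat_id_def)
    also have "\<dots> = f0 x" using F by (simp add: f0_def)
    finally show "mat_apply B g x = f0 x" .
  qed
  have "wlp_norm p w f0 \<le> op_norm p w B * wlp_norm p w g"
    using wlp_norm_apply_le[OF p w B g] unfolding Bg .
  then have "wlp_norm p w f0 powr p \<le> (op_norm p w B * wlp_norm p w g) powr p"
    using p wlp_norm_nonneg by (intro powr_mono2) auto
  also have "\<dots> = ?o * wlp_norm p w g powr p"
    by (rule powr_mult)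
  finally have 1: "wlp_norm p w f0 powr p \<le> ?o * wlp_norm p w g powr p" .
  have 2: "wlp_norm p w g powr p \<le> G"
    unfolding wlp_norm_powr[OF p w]
  proof (rule infsum_le_finite_sums)
    show "(\<lambda>x. norm (g x) powr p * w x) summable_on UNIV" using g unfolding wlp_def by simp
    show "(\<Sum>x\<in>X. norm (g x) powr p * w x) \<le> G" if "finite X" "X \<subseteq> UNIV" for X
      using G[OF that(1)] by (simp add: gx)
  qed
  have "(\<Sum>z\<in>F. norm (f z) powr p * w z) = wlp_norm p w f0 powr p"
    unfolding wlp_norm_powr[OF p w] by (rule f0(2)[symmetric])
  also have "\<dots> \<le> ?o * G"
    using 1 mult_left_mono[OF 2, of "?o"] by simp
  finally show ?thesis .
qed

lemma inverse_column:
  fixes A B :: "'v matrix"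
  assumes p: "0 < p" and w: "\<And>x. 0 \<le> w x" and inv: "is_inverse_in p w A B"
  shows "(\<lambda>z. A x z * B z y) summable_on UNIV"
    and "(\<Sum>\<^sub>\<infinity>z. A x z * B z y) = of_bool (x = y)"
    and "finite X \<Longrightarrow> (\<Sum>z\<in>X. norm (B z y) powr p * w z) \<le> (\<Sum>\<^sub>\<infinity>z. norm (B z y) powr p * w z)"
proof -
  have A: "A \<in> bounded_matrices p w" and B: "B \<in> bounded_matrices p w" and AB: "mat_mult A B = mat_id"
    using inv unfolding is_inverse_in_def by auto
  have col: "(\<lambda>z. B z y) \<in> wlp p w" by (rule bounded_matrix_column[OF p B])
  show "(\<lambda>z. A x z * B z y) summable_on UNIV"
    by (rule bounded_matricesD(1)[OF A col])
  show "(\<Sum>\<^sub>\<infinity>z. A x z * B z y) = of_bool (x = y)"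
    using fun_cong[OF fun_cong[OF AB, of x], of y] unfolding mat_mult_def mat_id_def by simp
  show "(\<Sum>z\<in>X. norm (B z y) powr p * w z) \<le> (\<Sum>\<^sub>\<infinity>z. norm (B z y) powr p * w z)" if "finite X"
    by (rule finite_sum_le_infsum) (use col that w in \<open>auto simp: wlp_def\<close>)
qed

section \<open>Inverse-closedness and norm control\<close>

lemma dyadic_bounded_shift:
  assumes s: "dyadic_bounded r \<gamma> s H" and H: "0 < H" and s0: "\<And>j. 0 \<le> s j"
  shows "dyadic_bounded r \<gamma> (\<lambda>i. s (k + i) * 2 powr (\<gamma> * real k) / H) 1"
proof -
  let ?s = "\<lambda>j. s j * 2 powr (\<gamma> * real j)"
  have e: "s (k + i) * 2 powr (\<gamma> * real k) / H * 2 powr (\<gamma> * real i) = ?s (k + i) / H" for i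
    by (simp add: powr_add distrib_left)
  show ?thesis
  proof (cases "r = \<infinity>")
    case True
    have "?s (k + i) / H \<le> 1" for i
      using s True H unfolding dyadic_bounded_def by (simp del: of_nat_add)
    then show ?thesis using True unfolding dyadic_bounded_def e by simp
  next
    case False
    define R where "R = enn2real r"
    have "(\<Sum>i<I. (?s (k + i) / H) powr R) \<le> 1" for I
    proof -
      have "(\<Sum>i<I. (?s (k + i) / H) powr R)
          = (\<Sum>i<I. (?s (k + i)) powr R) / H powr R"
        by (simp only: powr_divide sum_divide_distrib)
      also have "(\<Sum>i<I. (?s (k + i)) powr R)
          \<le> (\<Sum>j<k + I. ?s j powr R)"
        unfolding sum_lessThan_add[of _ k I] by (simp add: sum_nonneg del: of_nat_add)
      also have "\<dots> \<le> H powr R" using s False unfolding dyadic_bounded_def R_def by (simp del: of_nat_add)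
      finally show ?thesis using H by (simp add: divide_right_mono)
    qed
    then show ?thesis using False unfolding dyadic_bounded_def e R_def by simp
  qed
qed

lemma dyadic_bounded_scale:
  assumes t: "dyadic_bounded r \<gamma> t Z" and c: "0 \<le> c"
  shows "dyadic_bounded r \<gamma> (\<lambda>j. c * t j) (c * Z)"
proof (cases "r = \<infinity>")
  case True
  then show ?thesis using t c unfolding dyadic_bounded_def by (simp add: mult.assoc mult_left_mono)
next
  case False
  have "(\<Sum>j<J. (c * t j * 2 powr (\<gamma> * real j)) powr enn2real r) \<le> (c * Z) powr enn2real r" for J
  proof -
    have "(\<Sum>j<J. (c * t j * 2 powr (\<gamma> * real j)) powr enn2real r)
        = c powr enn2real r * (\<Sum>j<J. (t j * 2 powr (\<gamma> * real j)) powr enn2real r)"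
      by (simp only: mult.assoc powr_mult sum_distrib_left)
    also have "\<dots> \<le> c powr enn2real r * Z powr enn2real r"
      using t False unfolding dyadic_bounded_def by (intro mult_left_mono) auto
    also have "\<dots> = (c * Z) powr enn2real r" by (rule powr_mult[symmetric])
    finally show ?thesis .
  qed
  then show ?thesis using False t c unfolding dyadic_bounded_def by simp
qed

lemma recip_bounds:
  assumes "1 \<le> r" shows "0 \<le> recip r" "recip r \<le> 1"
  using enn2real_ge_1[OF assms] unfolding recip_eq[OF assms] by auto

context growth_space
begin

text \<open>\<open>C_low\<close> bounds the condition number from below, \<open>C_scale\<close> determines the admissible scales.\<close>
definition C_low :: "real \<Rightarrow> real" where
  "C_low \<gamma> = (P * 9 powr dt * D powr p) powr (1 / p) * C_comm d (\<gamma> - d)"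

definition C_scale :: "real \<Rightarrow> real" where
  "C_scale \<gamma> = 6 * (C_near \<gamma> * C_comm d (\<gamma> - d) + C_far \<gamma>) * (2 * 2 powr (\<gamma> + 1) * C_net \<gamma>)"

lemma a_root_le: "1 \<le> a \<Longrightarrow> a powr (1 / p) \<le> a powr (2 / p)"
  using p_ge_1 by (intro powr_mono divide_right_mono) auto

text \<open>
  Compare the norms of a unit vector \<open>\<one>\<^sub>y\<close> and of its image under \<open>A\<close>, the latter being
  bounded by the kernel bound. The sum needed for it is the commutator sum at scale \<open>1\<close>.
\<close>
lemma norm_product_lower_bound:
  assumes weight: "averaging_weight w a" and dl: "d < \<gamma>" and r: "1 \<le> r"
    and s: "dyadic_bounded r \<gamma> s H" and s0: "\<And>j. 0 \<le> s j"
    and A: "\<And>x z. norm (A x z) \<le> s (lev (\<rho> x z))"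
    and inv: "is_inverse_in p w A Ainv"
  shows "1 \<le> C_low \<gamma> * (a powr (2 / p) * op_norm p w Ainv * H)"
proof -
  have p: "0 < p" using p_ge_1 by simp
  have a1: "1 \<le> a" by (rule weight_const_ge_1[OF weight])
  have wn: "0 \<le> w x" for x by (rule weight_nonneg[OF weight])
  have H0: "0 \<le> H" using s unfolding dyadic_bounded_def by blast
  define \<beta> where "\<beta> = op_norm p w Ainv"
  have b0: "0 \<le> \<beta>"
    unfolding \<beta>_def by (rule op_norm_nonneg[OF p wn]) (use inv in \<open>auto simp: is_inverse_in_def\<close>)
  define C where "C = P * 9 powr dt * D powr p"
  have C0: "0 \<le> C" unfolding C_def using P_ge_1 by simp
  define \<tau> where "\<tau> = C_comm d (\<gamma> - d) * H"
  fix y :: 'v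
  have tau: "(\<Sum>j<J. s j * (2 ^ (j + 1)) powr d) \<le> \<tau>" for J
  proof -
    have m1: "min 1 (2 ^ (j + 1) / 2 ^ 0) = (1::real)" for j
      using one_le_power[of "2::real" "j + 1"] by (simp add: min_def del: one_le_power)
    have "smallness (\<gamma> - d) (1 - recip r) 0 = 1" by (simp add: smallness_def)
    then show ?thesis
      using commutator_sum_le[OF r s s0 dl, where J = J and k = 0] unfolding m1 \<tau>_def by simp
  qed
  have t0: "0 \<le> \<tau>" using tau[of 0] by simp
  let ?t = "a powr (1 / p) * C powr (1 / p) * \<tau>"
  have G: "(\<Sum>x\<in>X. norm (\<Sum>z\<in>{y}. A x z * 1) powr p * w x) \<le> a * C * \<tau> powr p * w y" if X: "finite X" for X
  proof -
    have "(\<Sum>x\<in>X. w x * (\<Sum>z\<in>{y}. norm (A x z) * 1) powr p) \<le> a * C * \<tau> powr p * (\<Sum>z\<in>{y}. 1 powr p * w z)"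
      unfolding C_def by (rule weighted_kernel_bound[OF weight X _ _ s0 _ A tau]) auto
    then show ?thesis by (simp add: mult.commute)
  qed
  have "(\<Sum>z\<in>{y}. norm (1::complex) powr p * w z) \<le> \<beta> powr p * (a * C * \<tau> powr p * w y)"
    unfolding \<beta>_def by (rule inverse_lower_bound[OF p wn inv _ G]) auto
  then have "1 \<le> \<beta> powr p * (a * C * \<tau> powr p)"
    using weight_pos[OF weight, of y] by simp
  also have "\<dots> = (\<beta> * ?t) powr p"
    using a1 C0 p by (simp add: powr_mult powr_powr)
  finally have "1 powr p \<le> (\<beta> * ?t) powr p" by simp
  then have "1 \<le> \<beta> * ?t"
    by (rule le_of_powr_le_powr[OF _ p]) (use b0 t0 in simp)
  also have "\<dots> \<le> \<beta> * (a powr (2 / p) * C powr (1 / p) * \<tau>)"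
    by (intro mult_left_mono mult_right_mono a_root_le a1) (use b0 t0 in auto)
  also have "\<dots> = C_low \<gamma> * (a powr (2 / p) * \<beta> * H)"
    unfolding C_low_def C_def[symmetric] \<tau>_def by (simp add: mult_ac)
  finally show ?thesis unfolding \<beta>_def .
qed

text \<open>
  The decay estimate for all columns at once. The profile \<open>v\<close> of the kernel consists of the
  levels of \<open>A\<close> from \<open>k\<close> on, normalized so that its dyadic bound is \<open>1\<close>; then the kernel does
  not depend on the size of \<open>A\<close>, and its dyadic bound depends on the scale alone.
\<close>
lemma inverse_entry_decay:
  assumes weight: "averaging_weight w a" and dtl: "dt < \<gamma>" and r: "1 \<le> r"
    and s: "dyadic_bounded r \<gamma> s H" and s0: "\<And>j. 0 \<le> s j" and mono: "\<And>i j. i \<le> j \<Longrightarrow> s j \<le> s i"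
    and A: "\<And>x z. norm (A x z) \<le> s (lev (\<rho> x z))" and H: "0 < H"
    and inv: "is_inverse_in p w A Ainv"
    and k: "C_scale \<gamma> * (a powr (2 / p) * op_norm p w Ainv * H) * smallness (\<gamma> - d) (1 - recip r) k \<le> 1"
  defines "F \<equiv> C_entry \<gamma> * a powr (1 / p) * op_norm p w Ainv * (2 ^ k) powr d"
    and "v \<equiv> \<lambda>i. s (k + i) * 2 powr (\<gamma> * real k) / H"
  shows "norm (Ainv x y) \<le> F * envelope \<gamma> v (lev (\<rho> x y) - k)"
    and "dyadic_bounded r \<gamma> (\<lambda>j. F * envelope \<gamma> v (j - k)) (F * (C_env r \<gamma> * 2 powr (\<gamma> * real k)))"
    and "0 \<le> F * envelope \<gamma> v (j - k)"
    and "i \<le> j \<Longrightarrow> F * envelope \<gamma> v (j - k) \<le> F * envelope \<gamma> v (i - k)"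
proof -
  let ?e = "envelope \<gamma> v"
  have p: "0 < p" using p_ge_1 by simp
  have dl: "d < \<gamma>" using d_le_dt dtl by simp
  have a1: "1 \<le> a" by (rule weight_const_ge_1[OF weight])
  have wn: "0 \<le> w x" for x by (rule weight_nonneg[OF weight])
  define \<beta> where "\<beta> = op_norm p w Ainv"
  have b0: "0 \<le> \<beta>"
    unfolding \<beta>_def by (rule op_norm_nonneg[OF p wn]) (use inv in \<open>auto simp: is_inverse_in_def\<close>)
  have F0: "0 \<le> F" unfolding F_def C_entry_def \<beta>_def[symmetric] using b0 P_ge_1 D_ge_1 by simp
  have v1: "dyadic_bounded r \<gamma> v 1" unfolding v_def by (rule dyadic_bounded_shift[OF s H s0])
  have vd: "v i \<le> 2 powr - (\<gamma> * real i)" for i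
    using dyadic_bounded_pointwise[OF v1 r, of i] by (simp add: powr_minus field_simps)
  interpret scaled_kernel \<rho> d dt p D Q P \<gamma> k v
  proof unfold_locales
    show "v j \<le> v i" if "i \<le> j" for i j
      unfolding v_def using mono that H by (intro divide_right_mono mult_right_mono) auto
  qed (rule dtl vd)+
  define \<Omega> where "\<Omega> = smallness (\<gamma> - d) (1 - recip r) k"
  define \<omega> where "\<omega> = C_comm d (\<gamma> - d) * H * \<Omega>"
  define M where "M y = (\<Sum>\<^sub>\<infinity>z. norm (Ainv z y) powr p * w z)" for y
  show "dyadic_bounded r \<gamma> (\<lambda>j. F * ?e (j - k)) (F * (C_env r \<gamma> * 2 powr (\<gamma> * real k)))"
    by (rule dyadic_bounded_scale[OF envelope_dyadic_bounded[OF r v1] F0])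
  show "0 \<le> F * ?e (j - k)" using F0 e_nonneg by simp
  show "F * ?e (j - k) \<le> F * ?e (i - k)" if "i \<le> j"
    using F0 e_antimono that by (intro mult_left_mono) auto
  interpret localized_column \<rho> d dt p D Q P \<gamma> k v A s w a H \<omega> \<beta> "\<lambda>z. Ainv z y" y "M y"
  proof unfold_locales
    show "s (k + i) \<le> H * (2 ^ k) powr - \<gamma> * v i" for i
    proof -
      have "(2 ^ k) powr - \<gamma> * 2 powr (\<gamma> * real k) = 1"
        by (simp add: powr_realpow[symmetric] powr_powr powr_add[symmetric])
      then have "H * (2 ^ k) powr - \<gamma> * v i = s (k + i)" unfolding v_def using H by (simp add: mult_ac)
      then show ?thesis by simp
    qed
    show "(\<Sum>j<J. s j * min 1 (2 ^ (j + 1) / 2 ^ k) * (2 ^ (j + 1)) powr d) \<le> \<omega>" for J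
      unfolding \<omega>_def \<Omega>_def by (rule commutator_sum_le[OF r s s0 dl])
    show "(\<Sum>z\<in>F. norm (f z) powr p * w z) \<le> \<beta> powr p * G"
      if "finite F" "\<And>X. finite X \<Longrightarrow> (\<Sum>x\<in>X. norm (\<Sum>z\<in>F. A x z * f z) powr p * w x) \<le> G" for F f G
      unfolding \<beta>_def by (rule inverse_lower_bound[OF p wn inv that])
    show "(\<lambda>z. A x z * Ainv z y) summable_on UNIV" for x by (rule inverse_column(1)[OF p wn inv])
    show "(\<Sum>\<^sub>\<infinity>z. A x z * Ainv z y) = of_bool (x = y)" for x by (rule inverse_column(2)[OF p wn inv])
    show "(\<Sum>x\<in>X. norm (Ainv x y) powr p * w x) \<le> M y" if "finite X" for X
      unfolding M_def by (rule inverse_column(3)[OF p wn inv that])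
  qed (use weight A s0 H b0 in auto)
  have "3 * \<beta> * (C_near \<gamma> * a powr (2 / p) * \<omega> + C_far \<gamma> * a powr (1 / p) * H * real N powr (d - \<gamma>))
      * (2 * 2 powr (\<gamma> + 1) * C_net \<gamma>)
    \<le> 3 * \<beta> * (C_near \<gamma> * a powr (2 / p) * \<omega> + C_far \<gamma> * a powr (2 / p) * H * \<Omega>)
      * (2 * 2 powr (\<gamma> + 1) * C_net \<gamma>)"
  proof (intro mult_right_mono mult_left_mono add_left_mono mult_mono a_root_le a1)
    have "real N powr (d - \<gamma>) = 2 powr - ((\<gamma> - d) * real k)"
      by (simp add: powr_realpow[symmetric] powr_powr algebra_simps)
    also have "\<dots> \<le> \<Omega>"
      unfolding \<Omega>_def by (rule two_powr_neg_le_smallness) (use recip_bounds[OF r] in simp)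
    finally show "real N powr (d - \<gamma>) \<le> \<Omega>" .
  qed (use C_net_pos H b0 D_ge_1 in \<open>auto simp: C_far_def\<close>)
  also have "\<dots> = 1 / 2 * (C_scale \<gamma> * (a powr (2 / p) * \<beta> * H) * \<Omega>)"
    unfolding C_scale_def \<omega>_def by (simp add: algebra_simps)
  also have "\<dots> \<le> 1 / 2" using k unfolding \<beta>_def \<Omega>_def by simp
  finally have "norm (Ainv x y) \<le> C_entry \<gamma> * a powr (1 / p) * \<beta> * real N powr d * e (level x y)"
    by (rule column_decay)
  then show "norm (Ainv x y) \<le> F * ?e (lev (\<rho> x y) - k)"
    unfolding F_def \<beta>_def level_def by simp
qed

lemma C_scale_pos:
  assumes "dt < \<gamma>"
  shows "0 < C_scale \<gamma>"
proof -
  have 1: "2 powr (dt - \<gamma>) < 1" using assms by (simp add: powr_less_one)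
  have "0 < C_far \<gamma>" unfolding C_far_def using D_ge_1 by simp
  moreover have "0 < C_net \<gamma>" unfolding C_net_def using 1 P_ge_1 by simp
  moreover have "0 \<le> C_near \<gamma>" unfolding C_near_def by simp
  moreover have "0 < C_comm d (\<gamma> - d)" by (rule C_comm_pos) (use assms d_le_dt in simp)
  ultimately show ?thesis unfolding C_scale_def
    by (intro mult_pos_pos add_nonneg_pos mult_nonneg_nonneg) auto
qed

lemma C_low_pos: "d < \<gamma> \<Longrightarrow> 0 < C_low \<gamma>"
  unfolding C_low_def using P_ge_1 D_ge_1 by (intro mult_pos_pos C_comm_pos) auto

end

lemma C_env_pos: "0 < \<gamma> \<Longrightarrow> 1 \<le> r \<Longrightarrow> 0 < C_env r \<gamma>"
proof (cases "r = \<infinity>")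
  case False
  assume g: "0 < \<gamma>" and r: "1 \<le> r"
  have "1 < 2 powr (\<gamma> * enn2real r)"
    using enn2real_ge_1[OF r False] g powr_less_mono[of 0 "\<gamma> * enn2real r" 2] by simp
  then have "0 < 4 + 1 / (2 powr (\<gamma> * enn2real r) - 1)" by (intro add_pos_pos divide_pos_pos) auto
  then show ?thesis using False unfolding C_env_def by simp
qed (simp add: C_env_def)

theorem theorem4p1:
  fixes E :: "'v rel" and r :: ennreal and p \<alpha> d dt :: real
  assumes "1 \<le> r" and "1 \<le> p"
    and "connected_simple_graph E" and "doubling E"
    and "is_beurling_dim E d" and "is_gen_beurling_dim E dt"
    and "\<alpha> > dt - d * recip r"
  shows "\<exists>C::real. C > 0 \<and>
    (\<forall>w A Ainv. muckenhoupt_weight E p w \<and> A \<in> beurling_algebra E d r \<alpha> \<and>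
                 is_inverse_in p w A Ainv \<longrightarrow>
       Ainv \<in> beurling_algebra E d r \<alpha> \<and>
       (let a = Ap_const E p w;
            K = a powr (2 / p) * op_norm p w Ainv * enn2real (beurling_norm E d r \<alpha> A);
            q = 1 - recip r
        in enn2real (beurling_norm E d r \<alpha> Ainv)
           \<le> C * a powr (1 / p) * op_norm p w Ainv *
              K powr ((\<alpha> + d * (1 + recip r)) / min (\<alpha> - d * q) 1) *
              (if \<alpha> \<noteq> 1 + d * q then 1 else ln (K + 1) powr ((2 * d + 1) * q))))"
proof -
  note r = assms(1) and p = assms(2)
  have dex: "beurling_exponent E d" and dtex: "gen_beurling_exponent E dt"
    using assms(5,6) unfolding is_beurling_dim_def is_gen_beurling_dim_def by auto
  have ddt: "d \<le> dt"
    using assms(5) beurling_exponent_if_gen[OF assms(3) dtex] unfolding is_beurling_dim_def by blast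
  obtain D Q P where gs: "growth_space (gdist E) d dt p D Q P"
    using graph_growth_space[OF assms(3,4) dex dtex ddt p] by blast
  interpret growth_space "gdist E" d dt p D Q P by (rule gs)
  define q where "q = 1 - recip r"
  let ?g = "\<lambda>K. K powr ((\<alpha> + d * (1 + recip r)) / min (\<alpha> - d * q) 1) *
      (if \<alpha> \<noteq> 1 + d * q then 1 else ln (K + 1) powr ((2 * d + 1) * q))"
  define \<gamma> where "\<gamma> = \<alpha> + d * recip r"
  define \<delta> where "\<delta> = \<gamma> - d"
  have q: "0 \<le> q" "q \<le> 1" using recip_bounds[OF r] unfolding q_def by auto
  have dtg: "dt < \<gamma>" using assms(7) unfolding \<gamma>_def by simp
  have dg: "d < \<gamma>" using ddt dtg by simp
  have g0: "0 < \<gamma>" using d_nonneg dg by simp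
  have d0: "0 < \<delta>" unfolding \<delta>_def using dg by simp
  have de: "\<delta> = \<alpha> - d * q" unfolding \<delta>_def \<gamma>_def q_def by (simp add: algebra_simps)
  \<comment> \<open>\<open>2 powr (\<gamma> + 1)\<close> is the ratio between the dyadic bound \<open>H\<close> below and the Beurling norm of \<open>A\<close>.\<close>
  define Cl where "Cl = C_low \<gamma> * 2 powr (\<gamma> + 1)"
  define Cs where "Cs = C_scale \<gamma> * 2 powr (\<gamma> + 1)"
  have Cl: "0 < Cl" unfolding Cl_def using C_low_pos[OF dg] by simp
  have Cs: "0 < Cs" unfolding Cs_def using C_scale_pos[OF dtg] by simp
  obtain C' where C': "0 < C'" and
    scale: "\<And>K. 1 / Cl \<le> K \<Longrightarrow> \<exists>k. Cs * K * smallness \<delta> q k \<le> 1 \<and> 2 ^ k \<le> C' * scale_bound \<delta> q K"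
    using choose_scale[OF d0 q Cs, of "1 / Cl"] Cl by auto
  define C where "C = 2 powr \<gamma> * C_env r \<gamma> * C_entry \<gamma> * C' powr (d + \<gamma>)"
  have Ce: "0 < C_entry \<gamma>" unfolding C_entry_def using P_ge_1 D_ge_1 by simp
  have C0: "0 < C" unfolding C_def using C_env_pos[OF g0 r] Ce C' by simp
  have main: "beurling_norm E d r \<alpha> Ainv \<le> ennreal
      (C * a powr (1 / p) * op_norm p w Ainv * ?g K)"
    if w: "muckenhoupt_weight E p w" and A: "A \<in> beurling_algebra E d r \<alpha>" and inv: "is_inverse_in p w A Ainv"
      and a: "a = Ap_const E p w"
      and K: "K = a powr (2 / p) * op_norm p w Ainv * enn2real (beurling_norm E d r \<alpha> A)" for w A Ainv a K
  proof -
    have weight: "averaging_weight w a" unfolding a by (rule muckenhoupt_imp_averaging_weight[OF refl w])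
    have pp: "0 < p" using p by simp
    have b0: "0 \<le> op_norm p w Ainv"
      by (rule op_norm_nonneg[OF pp weight_nonneg[OF weight]]) (use inv in \<open>auto simp: is_inverse_in_def\<close>)
    have fin: "beurling_norm E d r \<alpha> A < \<infinity>" using A unfolding beurling_algebra_def by simp
    define s where "s j = enn2real (decay E A (2 ^ j - 1))" for j
    define H where "H = 2 powr (\<gamma> + 1) * enn2real (beurling_norm E d r \<alpha> A)"
    note conv = norm_imp_dyadic[OF r fin g0 \<gamma>_def, folded s_def, folded H_def]
    have s0: "0 \<le> s j" for j unfolding s_def by simp
    have KH: "a powr (2 / p) * op_norm p w Ainv * H = 2 powr (\<gamma> + 1) * K"
      unfolding K H_def by simp
    have low: "1 \<le> Cl * K"
      using norm_product_lower_bound[OF weight dg r conv(1) s0 conv(2) inv] unfolding KH Cl_def by (simp add: mult_ac)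
    then have Kc: "1 / Cl \<le> K" using Cl by (simp add: field_simps)
    then have K0: "0 < K" using Cl by (meson less_le_trans zero_less_divide_1_iff)
    have "0 \<le> H" unfolding H_def by simp
    moreover have "H \<noteq> 0"
    proof
      assume "H = 0"
      then have "K = 0" unfolding K H_def by simp
      then show False using K0 by simp
    qed
    ultimately have H: "0 < H" by simp
    obtain k where k: "Cs * K * smallness \<delta> q k \<le> 1" "2 ^ k \<le> C' * scale_bound \<delta> q K"
      using scale[OF Kc] by blast
    have small: "C_scale \<gamma> * (a powr (2 / p) * op_norm p w Ainv * H) * smallness (\<gamma> - d) (1 - recip r) k \<le> 1"
      using k(1) unfolding KH Cs_def \<delta>_def q_def by (simp add: mult_ac)
    define F where "F = C_entry \<gamma> * a powr (1 / p) * op_norm p w Ainv * (2 ^ k) powr d"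
    define v where "v i = s (k + i) * 2 powr (\<gamma> * real k) / H" for i
    note ent = inverse_entry_decay[OF weight dtg r conv(1) s0 conv(3) conv(2) H inv small, folded F_def v_def]
    have "beurling_norm E d r \<alpha> Ainv \<le> ennreal (2 powr \<gamma> * (F * (C_env r \<gamma> * 2 powr (\<gamma> * real k))))"
      by (rule dyadic_imp_norm[OF r g0 \<gamma>_def ent(3) ent(4) ent(1) ent(2)])
    also have "\<dots> \<le> ennreal (C * a powr (1 / p) * op_norm p w Ainv * ?g K)"
    proof (rule ennreal_leI)
      have "(2 ^ k) powr d * 2 powr (\<gamma> * real k) = (2 ^ k) powr (d + \<gamma>)"
        by (simp add: powr_add powr_realpow[symmetric] powr_powr mult.commute)
      also have "\<dots> \<le> (C' * scale_bound \<delta> q K) powr (d + \<gamma>)"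
        by (rule powr_mono2[OF _ _ k(2)]) (use d_nonneg g0 in auto)
      also have "\<dots> = C' powr (d + \<gamma>) * scale_bound \<delta> q K powr (d + \<gamma>)" by (rule powr_mult)
      also have "scale_bound \<delta> q K powr (d + \<gamma>) = ?g K"
      proof -
        have e: "\<alpha> + d * (1 + recip r) = d + \<gamma>" unfolding \<gamma>_def by (simp add: algebra_simps)
        show ?thesis
        proof (cases "\<delta> = 1")
          case True
          then have "d + \<gamma> = 2 * d + 1" unfolding \<delta>_def by simp
          then show ?thesis using True K0 unfolding scale_bound_def e de[symmetric]
            using de by (simp add: powr_mult powr_powr mult_ac)
        next
          case False
          then show ?thesis unfolding scale_bound_def e de[symmetric] using de by (simp add: powr_powr)
        qed
      qed
      finally have kb: "(2 ^ k) powr d * 2 powr (\<gamma> * real k) \<le> C' powr (d + \<gamma>) * ?g K" .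
      have "2 powr \<gamma> * (F * (C_env r \<gamma> * 2 powr (\<gamma> * real k)))
         = (2 powr \<gamma> * C_env r \<gamma> * C_entry \<gamma> * a powr (1 / p) * op_norm p w Ainv) * ((2 ^ k) powr d * 2 powr (\<gamma> * real k))"
        unfolding F_def by (simp add: mult_ac)
      also have "\<dots> \<le> (2 powr \<gamma> * C_env r \<gamma> * C_entry \<gamma> * a powr (1 / p) * op_norm p w Ainv) * (C' powr (d + \<gamma>) * ?g K)"
        using C_env_pos[OF g0 r] Ce b0 by (intro mult_left_mono[OF kb] mult_nonneg_nonneg) auto
      also have "\<dots> = C * a powr (1 / p) * op_norm p w Ainv * ?g K"
        unfolding C_def by (simp only: mult_ac)
      finally show "2 powr \<gamma> * (F * (C_env r \<gamma> * 2 powr (\<gamma> * real k))) \<le> \<dots>" .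
    qed
    finally show ?thesis .
  qed
  show ?thesis
  proof (intro exI[of _ C] conjI allI impI)
    show "0 < C" by (rule C0)
    fix w A Ainv
    assume h: "muckenhoupt_weight E p w \<and> A \<in> beurling_algebra E d r \<alpha> \<and> is_inverse_in p w A Ainv"
    define a where "a = Ap_const E p w"
    define K where "K = a powr (2 / p) * op_norm p w Ainv * enn2real (beurling_norm E d r \<alpha> A)"
    define Y where "Y = C * a powr (1 / p) * op_norm p w Ainv * ?g K"
    have le: "beurling_norm E d r \<alpha> Ainv \<le> ennreal Y"
      unfolding Y_def by (rule main[OF _ _ _ a_def K_def]) (use h in auto)
    have "averaging_weight w a" unfolding a_def by (rule muckenhoupt_imp_averaging_weight[OF refl]) (use h in auto)
    then have "0 \<le> op_norm p w Ainv"
      using h p by (intro op_norm_nonneg) (auto simp: is_inverse_in_def weight_nonneg)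
    then have Y0: "0 \<le> Y" unfolding Y_def using C0 by (intro mult_nonneg_nonneg) auto
    show "Ainv \<in> beurling_algebra E d r \<alpha>"
      unfolding beurling_algebra_def using le by (simp add: order_le_less_trans[OF le])
    have "enn2real (beurling_norm E d r \<alpha> Ainv) \<le> Y"
      using enn2real_mono[OF le] Y0 by simp
    then show "let a = Ap_const E p w;
            K = a powr (2 / p) * op_norm p w Ainv * enn2real (beurling_norm E d r \<alpha> A);
            q = 1 - recip r
        in enn2real (beurling_norm E d r \<alpha> Ainv)
           \<le> C * a powr (1 / p) * op_norm p w Ainv *
              K powr ((\<alpha> + d * (1 + recip r)) / min (\<alpha> - d * q) 1) *
              (if \<alpha> \<noteq> 1 + d * q then 1 else ln (K + 1) powr ((2 * d + 1) * q))"
      unfolding Let_def a_def[symmetric] K_def[symmetric] q_def[symmetric] Y_def by (simp only: mult.assoc)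
  qed
qed

end
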